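(* The maximal Poisson ideals of $\mathrm{S}(\mathrm{Vir})$ are the ideals $(z-\zeta)$ for $\zeta\in\Bbbk^\times$, the ideals $\mathrm{P}(\chi_{1;0,\gamma})$ for $\gamma\in\Bbbk^\times$, and the augmentation ideal $\mathrm{P}(0)$.
   Context: $\Bbbk$ is an uncountable algebraically closed field of characteristic $0$; $\partial=d/dt$. $\mathrm{Vir}=\Bbbk[t,t^{-1}]\partial\oplus\Bbbk z$ is the Virasoro algebra, with $z$ central and $[f\partial,g\partial]=(fg'-f'g)\partial+\mathrm{Res}_0(f'g''-f''g')z$ ($\mathrm{Res}_0$ is the coefficient of $t^{-1}$). $\mathrm{S}(\mathrm{Vir})$ is a Poisson algebra with bracket extending $\{u,v\}=[u,v]$; a Poisson ideal is an ideal $I$ with $\{I,\mathrm{S}(\mathrm{Vir})\}\subseteq I$, and a maximal Poisson ideal is one maximal among proper Poisson ideals. For $\chi\in\mathrm{Vir}^*$, $\mathrm{P}(\chi)$ is the largest Poisson ideal contained in $\mathfrak m_\chi$, the kernel of the algebra homomorphism $\mathrm{S}(\mathrm{Vir})\to\Bbbk$ extending $\chi$. $\chi_{1;0,\gamma}\in\mathrm{Vir}^*$ is the function with $z\mapsto0$ and $f\partial\mapsto\gamma f'(1)$. The augmentation ideal is the ideal generated by $\mathrm{Vir}\subset\mathrm{S}(\mathrm{Vir})$. *)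

theory Defs
  imports
    "HOL-Library.Poly_Mapping"
    "HOL-Library.Product_Plus"
    "HOL-Library.Countable_Set"
    "HOL-Computational_Algebra.Polynomial"
begin

section \<open>The Virasoro algebra\<close>

text \<open>The convolution product of \<open>Poly_Mapping\<close> makes \<open>int \<Rightarrow>\<^sub>0 'k\<close> the ring of Laurent
  polynomials: \<open>single n c\<close> is \<open>c t^n\<close>.\<close>

type_synonym 'k laurent = "int \<Rightarrow>\<^sub>0 'k"

definition laurent_deriv :: "'k::comm_ring_1 laurent \<Rightarrow> 'k laurent" where
  "laurent_deriv f = (\<Sum>n\<in>Poly_Mapping.keys f.
     Poly_Mapping.single (n - 1) (of_int n * Poly_Mapping.lookup f n))"

definition laurent_res :: "'k::zero laurent \<Rightarrow> 'k" where
  "laurent_res f = Poly_Mapping.lookup f (- 1)"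

definition laurent_eval :: "'k::field laurent \<Rightarrow> 'k \<Rightarrow> 'k" where
  "laurent_eval f a = (\<Sum>n\<in>Poly_Mapping.keys f. Poly_Mapping.lookup f n * a powi n)"

text \<open>The pair \<open>(f, a)\<close> stands for \<open>f \<partial> + a z\<close>.\<close>

type_synonym 'k vir = "'k laurent \<times> 'k"

definition vir_scale :: "'k::comm_ring_1 \<Rightarrow> 'k vir \<Rightarrow> 'k vir" where
  "vir_scale c u = (Poly_Mapping.single 0 c * fst u, c * snd u)"

definition vir_bracket :: "'k::comm_ring_1 vir \<Rightarrow> 'k vir \<Rightarrow> 'k vir" where
  "vir_bracket u v =
    (let f = fst u; f' = laurent_deriv f; f'' = laurent_deriv f';
         g = fst v; g' = laurent_deriv g; g'' = laurent_deriv g'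
     in (f * g' - f' * g, laurent_res (f' * g'' - f'' * g')))"

text \<open>\<open>Del n\<close> indexes the basis vector \<open>t^n \<partial>\<close> and \<open>Cen\<close> the basis vector \<open>z\<close>.\<close>

datatype vir_index = Del int | Cen

fun vir_basis :: "vir_index \<Rightarrow> 'k::comm_ring_1 vir" where
  "vir_basis (Del n) = (Poly_Mapping.single n 1, 0)"
| "vir_basis Cen = (0, 1)"

section \<open>The symmetric algebra\<close>

text \<open>The symmetric algebra is the polynomial ring on the above basis: monomials are finitely
  supported exponent vectors, multiplied by adding exponents. The lemmas \<open>sym_lift_mult\<close>,
  \<open>sym_lift_incl\<close>, \<open>sym_lift_unique\<close> and \<open>poisson_incl\<close>, \<open>poisson_unique\<close> below show that the
  two basis-dependent definitions \<open>sym_lift\<close> and \<open>poisson\<close> are the canonical ones.\<close>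

type_synonym 'k sym_vir = "(vir_index \<Rightarrow>\<^sub>0 nat) \<Rightarrow>\<^sub>0 'k"

definition sym_const :: "'k::comm_ring_1 \<Rightarrow> 'k sym_vir" where
  "sym_const c = Poly_Mapping.single 0 c"

definition sym_var :: "vir_index \<Rightarrow> 'k::comm_ring_1 sym_vir" where
  "sym_var x = Poly_Mapping.single (Poly_Mapping.single x 1) 1"

definition sym_incl :: "'k::comm_ring_1 vir \<Rightarrow> 'k sym_vir" where
  "sym_incl u =
    (\<Sum>n\<in>Poly_Mapping.keys (fst u). sym_const (Poly_Mapping.lookup (fst u) n) * sym_var (Del n))
      + sym_const (snd u) * sym_var Cen"

text \<open>The algebra homomorphism to the ground field that extends a linear functional \<open>\<chi>\<close>.\<close>

definition sym_lift :: "('k::comm_ring_1 vir \<Rightarrow> 'k) \<Rightarrow> 'k sym_vir \<Rightarrow> 'k" where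
  "sym_lift \<chi> p = (\<Sum>m\<in>Poly_Mapping.keys p.
     Poly_Mapping.lookup p m * (\<Prod>x\<in>Poly_Mapping.keys m. \<chi> (vir_basis x) ^ Poly_Mapping.lookup m x))"

definition sym_vars :: "'k::zero sym_vir \<Rightarrow> vir_index set" where
  "sym_vars p = (\<Union>m\<in>Poly_Mapping.keys p. Poly_Mapping.keys m)"

text \<open>Partial derivative. If \<open>x\<close> does not occur in \<open>m\<close>, the truncated difference of exponents is
  harmless because the coefficient vanishes.\<close>

definition sym_pderiv :: "vir_index \<Rightarrow> 'k::comm_ring_1 sym_vir \<Rightarrow> 'k sym_vir" where
  "sym_pderiv x p = (\<Sum>m\<in>Poly_Mapping.keys p.
     Poly_Mapping.single (m - Poly_Mapping.single x 1)
       (of_nat (Poly_Mapping.lookup m x) * Poly_Mapping.lookup p m))"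

definition poisson :: "'k::comm_ring_1 sym_vir \<Rightarrow> 'k sym_vir \<Rightarrow> 'k sym_vir" where
  "poisson p q = (\<Sum>x\<in>sym_vars p. \<Sum>y\<in>sym_vars q.
     sym_pderiv x p * sym_pderiv y q * sym_incl (vir_bracket (vir_basis x) (vir_basis y)))"

section \<open>Poisson ideals\<close>

text \<open>An ideal of a commutative ring is a submodule of the ring over itself.\<close>

abbreviation is_ideal :: "'a::comm_ring_1 set \<Rightarrow> bool" where
  "is_ideal \<equiv> module.subspace (*)"

abbreviation ideal_gen :: "'a::comm_ring_1 set \<Rightarrow> 'a set" where
  "ideal_gen \<equiv> module.span (*)"

definition poisson_ideal :: "'k::comm_ring_1 sym_vir set \<Rightarrow> bool" where
  "poisson_ideal I \<longleftrightarrow> is_ideal I \<and> (\<forall>p\<in>I. \<forall>q. poisson p q \<in> I)"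

definition maximal_poisson_ideal :: "'k::comm_ring_1 sym_vir set \<Rightarrow> bool" where
  "maximal_poisson_ideal I \<longleftrightarrow> poisson_ideal I \<and> I \<noteq> UNIV \<and>
     (\<forall>J. poisson_ideal J \<and> J \<noteq> UNIV \<and> I \<subseteq> J \<longrightarrow> J = I)"

definition max_ideal_at :: "('k::comm_ring_1 vir \<Rightarrow> 'k) \<Rightarrow> 'k sym_vir set" where
  "max_ideal_at \<chi> = {p. sym_lift \<chi> p = 0}"

text \<open>The greatest element always exists: see \<open>poisson_core_greatest\<close>.\<close>

definition poisson_core :: "('k::comm_ring_1 vir \<Rightarrow> 'k) \<Rightarrow> 'k sym_vir set" where
  "poisson_core \<chi> = (GREATEST I. poisson_ideal I \<and> I \<subseteq> max_ideal_at \<chi>)"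

definition augmentation_ideal :: "'k::comm_ring_1 sym_vir set" where
  "augmentation_ideal = ideal_gen (range sym_incl)"

text \<open>The functional \<open>\<chi>\<^bsub>1;0,\<gamma>\<^esub>\<close>, which kills \<open>z\<close> and maps \<open>f \<partial>\<close> to \<open>\<gamma> f'(1)\<close>.\<close>

definition chi_one :: "'k::field \<Rightarrow> 'k vir \<Rightarrow> 'k" where
  "chi_one \<gamma> u = \<gamma> * laurent_eval (laurent_deriv (fst u)) 1"

definition vir_linear :: "('k::comm_ring_1 vir \<Rightarrow> 'k) \<Rightarrow> bool" where
  "vir_linear \<chi> \<longleftrightarrow> (\<forall>u v. \<chi> (u + v) = \<chi> u + \<chi> v) \<and> (\<forall>c u. \<chi> (vir_scale c u) = c * \<chi> u)"

section \<open>Laurent polynomials and the Lie bracket\<close>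

lemma pm_induct [case_names zero add]:
  fixes p :: "'a \<Rightarrow>\<^sub>0 'b::comm_monoid_add"
  assumes "P 0"
    and "\<And>p m a. P p \<Longrightarrow> P (p + Poly_Mapping.single m a)"
  shows "P p"
proof (induction p rule: update_induct)
  case const
  then show ?case by (fact assms(1))
next
  case (update f a b)
  have "Poly_Mapping.lookup f a = 0"
    using update by (simp add: in_keys_iff)
  then have "Poly_Mapping.update a b f = f + Poly_Mapping.single a b"
    by (intro poly_mapping_eqI) (auto simp: lookup_update lookup_add lookup_single when_def)
  then show ?case using assms(2) update by metis
qed

lemma lookup_laurent_deriv:
  "Poly_Mapping.lookup (laurent_deriv f) n = of_int (n + 1) * Poly_Mapping.lookup f (n + 1)"
proof -
  have "Poly_Mapping.lookup (laurent_deriv f) n =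
      (\<Sum>k\<in>Poly_Mapping.keys f. if k = n + 1 then of_int k * Poly_Mapping.lookup f k else 0)"
    unfolding laurent_deriv_def lookup_sum
    by (intro sum.cong refl) (auto simp: lookup_single when_def)
  also have "\<dots> = of_int (n + 1) * Poly_Mapping.lookup f (n + 1)"
    by (subst sum.delta) (auto simp: in_keys_iff)
  finally show ?thesis .
qed

lemma laurent_deriv_add: "laurent_deriv (f + g) = laurent_deriv f + laurent_deriv g"
  by (intro poly_mapping_eqI) (simp add: lookup_laurent_deriv lookup_add distrib_left)

lemma lookup_const_mult:
  fixes f :: "'m::monoid_add \<Rightarrow>\<^sub>0 'k::comm_ring_1"
  shows "Poly_Mapping.lookup (Poly_Mapping.single 0 c * f) n = c * Poly_Mapping.lookup f n"
proof -
  have "Poly_Mapping.lookup (Poly_Mapping.map ((*) c) f) n = c * Poly_Mapping.lookup f n"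
    by (simp add: Poly_Mapping.map.rep_eq when_def)
  then show ?thesis by (simp add: mult_map_scale_conv_mult)
qed

lemma laurent_deriv_scale:
  "laurent_deriv (Poly_Mapping.single 0 c * f) = Poly_Mapping.single 0 c * laurent_deriv f"
  by (intro poly_mapping_eqI) (simp only: lookup_laurent_deriv lookup_const_mult mult.left_commute)

lemma laurent_res_add: "laurent_res (f + g) = laurent_res f + laurent_res g"
  by (simp add: laurent_res_def lookup_add)

lemma laurent_res_diff:
  "laurent_res (f - g) = laurent_res f - laurent_res (g :: 'k::comm_ring_1 laurent)"
  by (simp add: laurent_res_def lookup_minus)

lemma laurent_res_scale:
  "laurent_res (Poly_Mapping.single 0 c * f) = c * laurent_res (f :: 'k::comm_ring_1 laurent)"
  by (simp add: laurent_res_def lookup_const_mult)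

lemma vir_bracket_add_left: "vir_bracket (u + v) w = vir_bracket u w + vir_bracket v w"
  by (simp add: vir_bracket_def Let_def laurent_deriv_add laurent_res_add laurent_res_diff
      algebra_simps)

lemma vir_bracket_antisym: "vir_bracket v u = - vir_bracket u v"
  by (simp add: vir_bracket_def Let_def laurent_res_diff algebra_simps)

lemma vir_bracket_scale_left: "vir_bracket (vir_scale c u) w = vir_scale c (vir_bracket u w)"
proof -
  have diff: "Poly_Mapping.single 0 c * f * g - Poly_Mapping.single 0 c * f' * g' =
      Poly_Mapping.single 0 c * (f * g - f' * g')" for f g f' g' :: "'a laurent"
    by (simp add: algebra_simps)
  show ?thesis
    by (simp add: vir_bracket_def vir_scale_def Let_def laurent_deriv_scale diff laurent_res_scale)
qed

lemma vir_scale_uminus: "vir_scale c (- u) = - vir_scale c u"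
  by (simp add: vir_scale_def)

lemma vir_bracket_add_right: "vir_bracket w (u + v) = vir_bracket w u + vir_bracket w v"
  using vir_bracket_add_left[of u v w] vir_bracket_antisym[of w "u + v"] vir_bracket_antisym[of w u]
    vir_bracket_antisym[of w v]
  by simp

lemma vir_bracket_scale_right: "vir_bracket w (vir_scale c u) = vir_scale c (vir_bracket w u)"
  using vir_bracket_scale_left[of c u w] vir_bracket_antisym[of w "vir_scale c u"]
    vir_bracket_antisym[of w u]
  by (simp add: vir_scale_uminus)

section \<open>Bases and polynomial induction\<close>

lemma pm_sum_superset:
  assumes "finite A" "Poly_Mapping.keys p \<subseteq> A" "\<And>m. g m 0 = 0"
  shows "(\<Sum>m\<in>Poly_Mapping.keys p. g m (Poly_Mapping.lookup p m)) =
    (\<Sum>m\<in>A. g m (Poly_Mapping.lookup p m))"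
  using assms by (intro sum.mono_neutral_left) (auto simp: in_keys_iff)

lemma pm_sum_add:
  fixes g :: "'m \<Rightarrow> 'k::comm_monoid_add \<Rightarrow> 'c::comm_monoid_add"
  assumes "\<And>m. g m 0 = 0" "\<And>m a b. g m (a + b) = g m a + g m b"
  shows "(\<Sum>m\<in>Poly_Mapping.keys (p + q). g m (Poly_Mapping.lookup (p + q) m)) =
    (\<Sum>m\<in>Poly_Mapping.keys p. g m (Poly_Mapping.lookup p m)) +
    (\<Sum>m\<in>Poly_Mapping.keys q. g m (Poly_Mapping.lookup q m))"
proof -
  let ?A = "Poly_Mapping.keys p \<union> Poly_Mapping.keys q"
  have "Poly_Mapping.keys (p + q) \<subseteq> ?A" by (rule keys_add)
  then show ?thesis
    using assms pm_sum_superset[of ?A p g] pm_sum_superset[of ?A q g] pm_sum_superset[of ?A "p + q" g]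
    by (simp add: lookup_add sum.distrib)
qed

lemma vir_induct [case_names basis add]:
  assumes "\<And>c x. P (vir_scale c (vir_basis x))"
    and "\<And>u v. P u \<Longrightarrow> P v \<Longrightarrow> P (u + v)"
  shows "P (u :: 'k::comm_ring_1 vir)"
proof -
  have P0: "P 0" using assms(1)[of 0 Cen] by (simp add: vir_scale_def zero_prod_def)
  have "P (f, 0)" for f
  proof (induction f rule: pm_induct)
    case zero
    then show ?case using P0 by (simp add: zero_prod_def)
  next
    case (add f n a)
    have "P (Poly_Mapping.single n a, 0)"
      using assms(1)[of a "Del n"] by (simp add: vir_scale_def mult_single)
    from assms(2)[OF add this] show ?case by simp
  qed
  moreover have "P (0, a)" for a
    using assms(1)[of a Cen] by (simp add: vir_scale_def)
  ultimately show ?thesis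
    using assms(2)[of "(fst u, 0)" "(0, snd u)"] by simp
qed

lemma sym_const_add: "sym_const (a + b) = sym_const a + sym_const b"
  by (simp add: sym_const_def single_add)

lemma sym_const_mult: "sym_const (a * b) = sym_const a * sym_const b"
  by (simp add: sym_const_def mult_single)

lemma sym_const_0 [simp]: "sym_const 0 = 0"
  and sym_const_1 [simp]: "sym_const 1 = 1"
  by (simp_all add: sym_const_def)

lemma sym_incl_add: "sym_incl (u + v) = sym_incl u + sym_incl v"
  using pm_sum_add[of "\<lambda>n a. sym_const a * sym_var (Del n)" "fst u" "fst v"]
  by (simp add: sym_incl_def sym_const_add algebra_simps)

lemma sym_incl_basis: "sym_incl (vir_basis x) = sym_var x"
  by (cases x) (simp_all add: sym_incl_def)

lemma sym_incl_scale: "sym_incl (vir_scale c u) = sym_const c * sym_incl u"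
proof -
  let ?g = "\<lambda>n a. sym_const a * sym_var (Del n)"
  have "Poly_Mapping.keys (Poly_Mapping.single 0 c * fst u) \<subseteq> Poly_Mapping.keys (fst u)"
    by (auto simp: in_keys_iff lookup_const_mult)
  then show ?thesis
    using pm_sum_superset[of "Poly_Mapping.keys (fst u)" "Poly_Mapping.single 0 c * fst u" ?g]
    by (simp add: sym_incl_def vir_scale_def lookup_const_mult sym_const_mult sum_distrib_left
        distrib_left mult.assoc)
qed

lemma sym_induct [case_names const var add mult]:
  assumes const: "\<And>c. P (sym_const c)" and var: "\<And>x. P (sym_var x)"
    and add: "\<And>p q. P p \<Longrightarrow> P q \<Longrightarrow> P (p + q)"
    and mult: "\<And>p q. P p \<Longrightarrow> P q \<Longrightarrow> P (p * q)"
  shows "P (p :: 'k::comm_ring_1 sym_vir)"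
proof (induction p rule: pm_induct)
  case zero
  then show ?case using const[of 0] by simp
next
  case (add p m a)
  have pow: "P (Poly_Mapping.single (Poly_Mapping.single x k) (1 :: 'k))" for x k
  proof (induction k)
    case 0
    then show ?case using const[of 1] by simp
  next
    case (Suc k)
    have "Poly_Mapping.single (Poly_Mapping.single x (Suc k)) (1 :: 'k) =
        sym_var x * Poly_Mapping.single (Poly_Mapping.single x k) 1"
      by (simp add: sym_var_def mult_single single_add[symmetric])
    then show ?case using mult[OF var Suc] by simp
  qed
  have "P (Poly_Mapping.single m a)" for a
  proof (induction m rule: pm_induct)
    case zero
    then show ?case using const[of a] by (simp add: sym_const_def)
  next
    case (add m x k)
    have "Poly_Mapping.single (m + Poly_Mapping.single x k) a =
        Poly_Mapping.single m a * Poly_Mapping.single (Poly_Mapping.single x k) 1"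
      by (simp add: mult_single)
    then show ?case using mult[OF add pow] by simp
  qed
  then show ?case using assms(3) add by blast
qed

section \<open>Universal property of the symmetric algebra\<close>

lemma sym_lift_add: "sym_lift \<chi> (p + q) = sym_lift \<chi> p + sym_lift \<chi> q"
  unfolding sym_lift_def
  by (rule pm_sum_add[of "\<lambda>m a. a * (\<Prod>x\<in>Poly_Mapping.keys m.
        \<chi> (vir_basis x) ^ Poly_Mapping.lookup m x)"]) (simp_all add: distrib_right)

lemma sym_lift_const: "sym_lift \<chi> (sym_const c) = c"
  by (simp add: sym_lift_def sym_const_def)

lemma sym_lift_var: "sym_lift \<chi> (sym_var x) = \<chi> (vir_basis x)"
  by (simp add: sym_lift_def sym_var_def)

lemma sym_lift_mult: "sym_lift \<chi> (p * q) = sym_lift \<chi> p * sym_lift \<chi> q"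
proof -
  define w where "w m = (\<Prod>x\<in>Poly_Mapping.keys m. \<chi> (vir_basis x) ^ Poly_Mapping.lookup m x)"
    for m :: "vir_index \<Rightarrow>\<^sub>0 nat"
  have w: "w m = (\<Prod>x\<in>A. \<chi> (vir_basis x) ^ Poly_Mapping.lookup m x)"
    if "finite A" "Poly_Mapping.keys m \<subseteq> A" for m A
    unfolding w_def using that by (intro prod.mono_neutral_left) (auto simp: in_keys_iff)
  have w_add: "w (m + n) = w m * w n" for m n
  proof -
    let ?A = "Poly_Mapping.keys m \<union> Poly_Mapping.keys n"
    have "Poly_Mapping.keys (m + n) \<subseteq> ?A" by (rule keys_add)
    then show ?thesis
      using w[of ?A m] w[of ?A n] w[of ?A "m + n"]
      by (simp add: lookup_add power_add prod.distrib)
  qed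
  have mono: "sym_lift \<chi> (Poly_Mapping.single m a) = a * w m" for m a
    by (simp add: sym_lift_def w_def)
  have zero: "sym_lift \<chi> 0 = 0" by (simp add: sym_lift_def)
  show ?thesis
  proof (induction p rule: pm_induct)
    case zero
    then show ?case by (simp add: \<open>sym_lift \<chi> 0 = 0\<close>)
  next
    case (add p m a)
    have "sym_lift \<chi> (Poly_Mapping.single m a * q) =
        sym_lift \<chi> (Poly_Mapping.single m a) * sym_lift \<chi> q"
    proof (induction q rule: pm_induct)
      case zero
      then show ?case by (simp add: \<open>sym_lift \<chi> 0 = 0\<close>)
    next
      case (add q n b)
      then show ?case
        by (simp add: distrib_left sym_lift_add mult_single mono w_add mult_ac)
    qed
    with add show ?case by (simp add: distrib_right sym_lift_add)
  qed
qed

lemma sym_lift_incl: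
  assumes "vir_linear \<chi>"
  shows "sym_lift \<chi> (sym_incl u) = \<chi> u"
proof (induction u rule: vir_induct)
  case (basis c x)
  have "\<chi> (vir_scale c (vir_basis x)) = c * \<chi> (vir_basis x)"
    using assms unfolding vir_linear_def by blast
  then show ?case
    by (simp add: sym_incl_scale sym_incl_basis sym_lift_mult sym_lift_const sym_lift_var)
next
  case (add u v)
  have "\<chi> (u + v) = \<chi> u + \<chi> v"
    using assms unfolding vir_linear_def by blast
  with add show ?case by (simp add: sym_incl_add sym_lift_add)
qed

lemma sym_lift_unique:
  assumes "vir_linear \<chi>"
    and "\<And>p q. h (p + q) = h p + h q" "\<And>p q. h (p * q) = h p * h q"
    and "\<And>c. h (sym_const c) = c" "\<And>u. h (sym_incl u) = \<chi> u"
  shows "h = sym_lift \<chi>"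
proof
  fix p
  show "h p = sym_lift \<chi> p"
  proof (induction p rule: sym_induct)
    case (var x)
    then show ?case using assms(5)[of "vir_basis x"] by (simp add: sym_incl_basis sym_lift_var)
  qed (simp_all add: assms sym_lift_const sym_lift_add sym_lift_mult)
qed

lemma vir_linear_chi_one: "vir_linear (chi_one \<gamma>)"
proof -
  have add: "laurent_eval (f + g) 1 = laurent_eval f 1 + laurent_eval g 1" for f g :: "'a laurent"
    unfolding laurent_eval_def
    by (rule pm_sum_add[of "\<lambda>n a. a * 1 powi n"]) (simp_all add: distrib_right)
  have scale: "laurent_eval (Poly_Mapping.single 0 c * f) 1 = c * laurent_eval f 1"
    for f :: "'a laurent" and c
  proof -
    have "Poly_Mapping.keys (Poly_Mapping.single 0 c * f) \<subseteq> Poly_Mapping.keys f"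
      by (auto simp: in_keys_iff lookup_const_mult)
    then show ?thesis
      using pm_sum_superset[of "Poly_Mapping.keys f" "Poly_Mapping.single 0 c * f" "\<lambda>n a. a"]
      by (simp add: laurent_eval_def lookup_const_mult sum_distrib_left)
  qed
  show ?thesis
    unfolding vir_linear_def chi_one_def
    by (simp add: laurent_deriv_add laurent_deriv_scale add scale vir_scale_def distrib_left
        mult.left_commute)
qed

section \<open>The Poisson bracket\<close>

lemma sym_pderiv_add: "sym_pderiv x (p + q) = sym_pderiv x p + sym_pderiv x q"
  unfolding sym_pderiv_def
  by (rule pm_sum_add[of "\<lambda>m a. Poly_Mapping.single (m - Poly_Mapping.single x 1)
        (of_nat (Poly_Mapping.lookup m x) * a)"]) (simp_all add: distrib_left single_add)

lemma sym_pderiv_single: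
  "sym_pderiv x (Poly_Mapping.single m a) =
    Poly_Mapping.single (m - Poly_Mapping.single x 1) (of_nat (Poly_Mapping.lookup m x) * a)"
  by (simp add: sym_pderiv_def)

lemma sym_pderiv_0 [simp]: "sym_pderiv x 0 = 0"
  by (simp add: sym_pderiv_def)

lemma sym_pderiv_const [simp]: "sym_pderiv x (sym_const c) = 0"
  by (simp add: sym_const_def sym_pderiv_single)

lemma sym_pderiv_var: "sym_pderiv x (sym_var y) = (if x = y then 1 else 0)"
  by (simp add: sym_var_def sym_pderiv_single lookup_single when_def)

lemma sym_pderiv_mult: "sym_pderiv x (p * q) = sym_pderiv x p * q + p * sym_pderiv x q"
proof (induction p rule: pm_induct)
  case zero
  then show ?case by simp
next
  case (add p m a)
  let ?e = "Poly_Mapping.single x (1 :: nat)"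
  have "sym_pderiv x (Poly_Mapping.single m a * q) =
      sym_pderiv x (Poly_Mapping.single m a) * q + Poly_Mapping.single m a * sym_pderiv x q"
  proof (induction q rule: pm_induct)
    case zero
    then show ?case by simp
  next
    case (add q n b)
    have move: "m - ?e + n = m + n - ?e" if "Poly_Mapping.lookup m x \<noteq> 0"
      for m n :: "vir_index \<Rightarrow>\<^sub>0 nat"
      using that
      by (intro poly_mapping_eqI) (auto simp: lookup_add lookup_minus lookup_single when_def)
    have left: "Poly_Mapping.single (m - ?e + n) (of_nat (Poly_Mapping.lookup m x) * c) =
        Poly_Mapping.single (m + n - ?e) (of_nat (Poly_Mapping.lookup m x) * c)"
      for m n and c :: 'a
      using move[of m n] by (cases "Poly_Mapping.lookup m x = 0") auto
    have right: "Poly_Mapping.single (m + (n - ?e)) (of_nat (Poly_Mapping.lookup n x) * c) =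
        Poly_Mapping.single (m + n - ?e) (of_nat (Poly_Mapping.lookup n x) * c)"
      for m n and c :: 'a
      using left[of n m c] by (simp add: add.commute)
    have "sym_pderiv x (Poly_Mapping.single m a * Poly_Mapping.single n b) =
        sym_pderiv x (Poly_Mapping.single m a) * Poly_Mapping.single n b
          + Poly_Mapping.single m a * sym_pderiv x (Poly_Mapping.single n b)"
      unfolding mult_single sym_pderiv_single mult.assoc mult.left_commute[of a] left right
      by (simp only: lookup_add of_nat_add distrib_right single_add)
    with add show ?case by (simp add: sym_pderiv_add algebra_simps)
  qed
  with add show ?case by (simp add: sym_pderiv_add algebra_simps)
qed

lemma finite_sym_vars [simp]: "finite (sym_vars p)"
  by (simp add: sym_vars_def)

lemma sym_pderiv_not_var: "x \<notin> sym_vars p \<Longrightarrow> sym_pderiv x p = 0"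
  unfolding sym_pderiv_def sym_vars_def by (intro sum.neutral) (auto simp: in_keys_iff)

lemma poisson_superset:
  assumes "finite A" "finite B" "sym_vars p \<subseteq> A" "sym_vars q \<subseteq> B"
  shows "poisson p q = (\<Sum>x\<in>A. \<Sum>y\<in>B.
     sym_pderiv x p * sym_pderiv y q * sym_incl (vir_bracket (vir_basis x) (vir_basis y)))"
proof -
  let ?f = "\<lambda>x y. sym_pderiv x p * sym_pderiv y q * sym_incl (vir_bracket (vir_basis x) (vir_basis y))"
  have "(\<Sum>x\<in>A. \<Sum>y\<in>B. ?f x y) = (\<Sum>x\<in>A. \<Sum>y\<in>sym_vars q. ?f x y)"
    using assms by (intro sum.cong refl sum.mono_neutral_right) (auto simp: sym_pderiv_not_var)
  also have "\<dots> = (\<Sum>x\<in>sym_vars p. \<Sum>y\<in>sym_vars q. ?f x y)"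
    using assms by (intro sum.mono_neutral_right) (auto simp: sym_pderiv_not_var)
  finally show ?thesis by (simp add: poisson_def)
qed

lemma poisson_add_left: "poisson (p + q) r = poisson p r + poisson q r"
proof -
  let ?A = "sym_vars p \<union> sym_vars q \<union> sym_vars (p + q)"
  show ?thesis
    using poisson_superset[of ?A "sym_vars r" p r] poisson_superset[of ?A "sym_vars r" q r]
      poisson_superset[of ?A "sym_vars r" "p + q" r]
    by (simp add: sym_pderiv_add distrib_right sum.distrib le_supI1)
qed

lemma poisson_antisym: "poisson q p = - poisson p q"
proof -
  have minus: "sym_incl (- u) = - sym_incl u" for u :: "'a vir"
    using sym_incl_add[of u "- u"] sym_incl_scale[of 0 u]
    by (simp add: vir_scale_def zero_prod_def eq_neg_iff_add_eq_0 add.commute)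
  have "poisson q p = (\<Sum>x\<in>sym_vars p. \<Sum>y\<in>sym_vars q. sym_pderiv y q * sym_pderiv x p
      * sym_incl (vir_bracket (vir_basis y) (vir_basis x)))"
    unfolding poisson_def by (rule sum.swap)
  also have "\<dots> = - poisson p q"
    unfolding poisson_def sum_negf[symmetric]
    by (intro sum.cong refl, subst vir_bracket_antisym) (simp add: minus mult_ac)
  finally show ?thesis .
qed

lemma poisson_add_right: "poisson r (p + q) = poisson r p + poisson r q"
  using poisson_add_left[of p q r] poisson_antisym[of r "p + q"] poisson_antisym[of r p]
    poisson_antisym[of r q]
  by simp

lemma poisson_mult_left: "poisson (p * q) r = p * poisson q r + q * poisson p r"
proof -
  let ?A = "sym_vars p \<union> sym_vars q \<union> sym_vars (p * q)"
  let ?b = "\<lambda>x y. sym_incl (vir_bracket (vir_basis x) (vir_basis y))"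
  have "poisson (p * q) r =
      (\<Sum>x\<in>?A. \<Sum>y\<in>sym_vars r. sym_pderiv x (p * q) * sym_pderiv y r * ?b x y)"
    by (intro poisson_superset) auto
  also have "\<dots> = (\<Sum>x\<in>?A. \<Sum>y\<in>sym_vars r.
      p * (sym_pderiv x q * sym_pderiv y r * ?b x y) + q * (sym_pderiv x p * sym_pderiv y r * ?b x y))"
    by (intro sum.cong refl) (simp add: sym_pderiv_mult algebra_simps)
  also have "\<dots> = p * (\<Sum>x\<in>?A. \<Sum>y\<in>sym_vars r. sym_pderiv x q * sym_pderiv y r * ?b x y)
      + q * (\<Sum>x\<in>?A. \<Sum>y\<in>sym_vars r. sym_pderiv x p * sym_pderiv y r * ?b x y)"
    by (simp only: sum.distrib sum_distrib_left)
  also have "\<dots> = p * poisson q r + q * poisson p r"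
    using poisson_superset[of ?A "sym_vars r" p r] poisson_superset[of ?A "sym_vars r" q r]
    by (simp add: le_supI1)
  finally show ?thesis .
qed

lemma poisson_mult_right: "poisson r (p * q) = p * poisson r q + q * poisson r p"
  using poisson_mult_left[of p q r] poisson_antisym[of r "p * q"] poisson_antisym[of r p]
    poisson_antisym[of r q]
  by simp

lemma poisson_const_left: "poisson (sym_const c) p = 0"
  by (simp add: poisson_def)

lemma poisson_const_right: "poisson p (sym_const c) = 0"
  by (simp add: poisson_def)

lemma poisson_var: "poisson (sym_var x) (sym_var y) = sym_incl (vir_bracket (vir_basis x) (vir_basis y))"
  by (subst poisson_superset[of "{x}" "{y}"]) (auto simp: sym_vars_def sym_var_def sym_pderiv_single)

lemma poisson_incl: "poisson (sym_incl u) (sym_incl v) = sym_incl (vir_bracket u v)"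
proof (induction u rule: vir_induct)
  case (basis c x)
  have "poisson (sym_var x) (sym_incl v) = sym_incl (vir_bracket (vir_basis x) v)"
  proof (induction v rule: vir_induct)
    case (basis d y)
    then show ?case
      by (simp add: sym_incl_scale sym_incl_basis poisson_mult_right poisson_const_right poisson_var
          vir_bracket_scale_right)
  next
    case (add v w)
    then show ?case by (simp add: sym_incl_add vir_bracket_add_right poisson_add_right)
  qed
  then show ?case
    by (simp add: sym_incl_scale sym_incl_basis poisson_mult_left poisson_const_left
        vir_bracket_scale_left)
next
  case (add u w)
  then show ?case by (simp add: sym_incl_add vir_bracket_add_left poisson_add_left)
qed

lemma poisson_unique:
  assumes "\<And>p q r. B (p + q) r = B p r + B q r" "\<And>p q r. B r (p + q) = B r p + B r q"
    and "\<And>p q r. B (p * q) r = p * B q r + q * B p r" "\<And>p q r. B r (p * q) = p * B r q + q * B r p"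
    and "\<And>c p. B (sym_const c) p = 0" "\<And>c p. B p (sym_const c) = 0"
    and "\<And>u v. B (sym_incl u) (sym_incl v) = sym_incl (vir_bracket u v)"
  shows "B = poisson"
proof (intro ext)
  fix p q
  show "B p q = poisson p q"
  proof (induction p rule: sym_induct)
    case (var x)
    show ?case
    proof (induction q rule: sym_induct)
      case (var y)
      then show ?case
        using assms(7)[of "vir_basis x" "vir_basis y"] by (simp add: sym_incl_basis poisson_var)
    qed (simp_all add: assms poisson_const_right poisson_add_right poisson_mult_right)
  qed (simp_all add: assms poisson_const_left poisson_add_left poisson_mult_left)
qed

section \<open>Largest Poisson ideals\<close>

lemma module_mult: "module ((*) :: 'a::comm_ring_1 \<Rightarrow> 'a \<Rightarrow> 'a)"
  by standard (simp_all add: algebra_simps)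

lemma is_ideal_max_ideal_at: "is_ideal (max_ideal_at \<chi>)"
  by (simp add: module.subspace_def[OF module_mult] max_ideal_at_def sym_lift_add sym_lift_mult)
     (simp add: sym_lift_def)

lemma poisson_core_greatest:
  shows "poisson_ideal (poisson_core \<chi>)" "poisson_core \<chi> \<subseteq> max_ideal_at \<chi>"
    and "\<And>J. poisson_ideal J \<Longrightarrow> J \<subseteq> max_ideal_at \<chi> \<Longrightarrow> J \<subseteq> poisson_core \<chi>"
proof -
  let ?U = "\<Union>{J. poisson_ideal J \<and> J \<subseteq> max_ideal_at \<chi>}"
  let ?I = "ideal_gen ?U"
  interpret module "(*) :: 'a sym_vir \<Rightarrow> 'a sym_vir \<Rightarrow> 'a sym_vir" by (rule module_mult)
  have "poisson p q \<in> ?I" if "p \<in> ?I" for p q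
    using that
  proof (induction rule: span_induct_alt)
    case base
    then show ?case using span_zero by (simp add: poisson_def sym_vars_def)
  next
    case (step c x y)
    then obtain J where J: "poisson_ideal J" "J \<subseteq> max_ideal_at \<chi>" "x \<in> J" by blast
    then have "x \<in> ?U" "poisson x q \<in> ?U" by (auto simp: poisson_ideal_def)
    then have "x \<in> ?I" "poisson x q \<in> ?I" by (simp_all add: span_base)
    then have "c * poisson x q + poisson c q * x + poisson y q \<in> ?I"
      using step(2) by (intro span_add span_scale)
    then show ?case by (simp add: poisson_add_left poisson_mult_left mult.commute)
  qed
  then have I: "poisson_ideal ?I" by (simp add: poisson_ideal_def subspace_span)
  have sub: "?I \<subseteq> max_ideal_at \<chi>" by (rule span_minimal) (auto simp: is_ideal_max_ideal_at)
  have max: "J \<subseteq> ?I" if "poisson_ideal J" "J \<subseteq> max_ideal_at \<chi>" for J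
    using that span_superset[of ?U] by blast
  have "poisson_core \<chi> = ?I"
    unfolding poisson_core_def by (rule Greatest_equality) (use I sub max in auto)
  with I sub max show "poisson_ideal (poisson_core \<chi>)" "poisson_core \<chi> \<subseteq> max_ideal_at \<chi>"
    "\<And>J. poisson_ideal J \<Longrightarrow> J \<subseteq> max_ideal_at \<chi> \<Longrightarrow> J \<subseteq> poisson_core \<chi>"
    by auto
qed

end

theory Submission
  imports Defs "Jordan_Normal_Form.Char_Poly" "HOL-Computational_Algebra.Polynomial_FPS"
begin

text \<open>
  The algebra \<open>S(Vir)\<close> has countable dimension and the ground field is uncountable, so every proper
  ideal \<open>I\<close> is contained in the kernel of evaluation at some functional \<open>\<chi>\<close> (\<open>nullstellensatz\<close>).
  Call such \<open>\<chi>\<close> the points of \<open>I\<close>. The points of a Poisson ideal form, in a formal sense, a union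
  of coadjoint orbits, and the proof studies which points are possible.

  Suppose that a Poisson ideal \<open>I\<close> contains a nonzero polynomial \<open>q\<close> in finitely many of the
  variables \<open>t^n \<partial>\<close>. Then each point \<open>\<chi>\<close> of \<open>I\<close> is annihilated, in the coadjoint action, by a vector
  field \<open>f \<partial> \<noteq> 0\<close> whose exponents occur in \<open>q\<close>: otherwise Poisson brackets with suitable elements
  act on the lowest order part of \<open>q\<close> at \<open>\<chi>\<close> like arbitrary partial derivatives, and repeating them
  leads to an element of \<open>I\<close> that does not vanish at \<open>\<chi>\<close> (\<open>exists_stabiliser\<close>). The condition that
  \<open>f \<partial>\<close> annihilates \<open>\<chi>\<close> is a differential equation; after multiplication by \<open>f\<close> it can be
  integrated, and then it says that \<open>f\<^sup>2 \<chi>\<close> is the residue pairing with the Laurent polynomial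
  \<open>\<zeta> (2 f f'' - f'\<^sup>2) + c\<close>, where \<open>\<zeta> = \<chi>(z)\<close> (\<open>stabiliser_square\<close>). In particular the numbers
  \<open>\<chi>(t^n \<partial>)\<close> satisfy a linear recurrence for large \<open>n\<close>. Hence a determinant in variables far away
  vanishes at all points of \<open>I\<close>, a power of it lies in \<open>I\<close>, and the argument can be repeated with this
  new relation (\<open>exists_far_relation\<close>). One obtains two stabilising fields of different large
  degrees. Comparing leading coefficients of their two equations yields \<open>\<zeta> = 0\<close> and \<open>f\<^sup>2 \<chi> = 0\<close> for one
  of them (\<open>two_stabilisers\<close>).

  For \<open>\<zeta> \<noteq> 0\<close> this shows that no proper Poisson ideal is strictly larger than \<open>(z - \<zeta>)\<close>. A proper
  Poisson ideal that contains \<open>z\<close> either equals \<open>(z)\<close> or has only local points: functionals that are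
  annihilated by a nonzero polynomial, that is, combinations of values of derivatives at finitely
  many points of the line. An arc of functionals with values in power series, which starts at a point of \<open>I\<close> and moves
  along a coadjoint orbit, consists of points of \<open>I\<close>; if the arc is rational in its parameter, all
  its regular values are points of \<open>I\<close> as well (\<open>degeneration\<close>). Two such arcs suffice. The first
  adds a multiple of the evaluation at a support point and arranges \<open>\<chi>(\<partial>) = 0\<close>
  (\<open>translate_by_support_point\<close>). The second is the dilation about \<open>t = 1\<close>. Because \<open>\<chi>(\<partial>) = 0\<close>, it has
  a limit when the dilation factor tends to \<open>0\<close>, namely \<open>f \<partial> \<mapsto> \<gamma> f'(1)\<close> with \<open>\<gamma> = \<chi>(t \<partial>)\<close>
  (\<open>dilation_limit\<close>). So every proper Poisson ideal containing \<open>z\<close> lies in some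
  \<open>P(\<chi>\<^bsub>1;0,\<gamma>\<^esub>)\<close>, and \<open>\<gamma> = 0\<close> gives the augmentation ideal.

  These ideals are maximal because they are pairwise incomparable: for \<open>\<gamma> \<noteq> 0\<close> an explicit cubic
  element of \<open>P(\<chi>\<^bsub>1;0,\<gamma>\<^esub>)\<close> vanishes at no other \<open>\<chi>\<^bsub>1;0,\<delta>\<^esub>\<close> (\<open>poisson_core_chi_one_separated\<close>).
\<close>

section \<open>Ideals\<close>

lemma is_ideal_iff:
  "is_ideal I \<longleftrightarrow> 0 \<in> I \<and> (\<forall>x\<in>I. \<forall>y\<in>I. x + y \<in> I) \<and> (\<forall>c. \<forall>x\<in>I. c * x \<in> I)"
  by (simp add: module.subspace_def[OF module_mult])

context
  fixes I :: "'a::comm_ring_1 set"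
  assumes I: "is_ideal I"
begin

lemma ideal_zero: "0 \<in> I"
  and ideal_add: "x \<in> I \<Longrightarrow> y \<in> I \<Longrightarrow> x + y \<in> I"
  and ideal_mult_left: "x \<in> I \<Longrightarrow> c * x \<in> I"
  using I by (auto simp: is_ideal_iff)

lemma ideal_mult_right: "x \<in> I \<Longrightarrow> x * c \<in> I"
  using ideal_mult_left[of x c] by (simp add: mult.commute)

lemma ideal_uminus: "x \<in> I \<Longrightarrow> - x \<in> I"
  using ideal_mult_left[of x "-1"] by simp

lemma ideal_diff: "x \<in> I \<Longrightarrow> y \<in> I \<Longrightarrow> x - y \<in> I"
  using ideal_add[of x "- y"] ideal_uminus[of y] by simp

lemma ideal_sum: "(\<And>a. a \<in> A \<Longrightarrow> f a \<in> I) \<Longrightarrow> sum f A \<in> I"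
  by (induction A rule: infinite_finite_induct) (auto intro: ideal_add ideal_zero)

lemma ideal_UNIV_iff: "I = UNIV \<longleftrightarrow> 1 \<in> I"
proof
  assume "1 \<in> I"
  then have "c \<in> I" for c using ideal_mult_left[of 1 c] by simp
  then show "I = UNIV" by auto
qed auto

end

lemma ideal_gen_singleton: "ideal_gen {a} = range (\<lambda>c. c * a)"
  using module.span_singleton[OF module_mult] by auto

lemma is_ideal_ideal_gen: "is_ideal (ideal_gen A)"
  by (rule module.subspace_span[OF module_mult])

lemma is_ideal_plus_principal:
  assumes "is_ideal I"
  shows "is_ideal {x + c * a | x c. x \<in> I}"
  unfolding is_ideal_iff
proof (intro conjI ballI allI)
  show "0 \<in> {x + c * a | x c. x \<in> I}"
    using ideal_zero[OF assms] by (intro CollectI exI[of _ 0]) auto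
next
  fix u v assume "u \<in> {x + c * a | x c. x \<in> I}" "v \<in> {x + c * a | x c. x \<in> I}"
  then obtain x c y d where "x \<in> I" "y \<in> I" "u = x + c * a" "v = y + d * a" by auto
  then show "u + v \<in> {x + c * a | x c. x \<in> I}"
    using ideal_add[OF assms] by (intro CollectI exI[of _ "x + y"] exI[of _ "c + d"])
      (auto simp: algebra_simps)
next
  fix e u assume "u \<in> {x + c * a | x c. x \<in> I}"
  then obtain x c where "x \<in> I" "u = x + c * a" by auto
  then show "e * u \<in> {x + c * a | x c. x \<in> I}"
    using ideal_mult_left[OF assms, of x e]
    by (intro CollectI exI[of _ "e * x"] exI[of _ "e * c"]) (simp add: distrib_left mult.assoc)
qed

section \<open>Homomorphisms and Poisson ideals\<close>

text \<open>Values outside the ground field are essential: arcs of functionals take values in power series,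
  and the functions on a two-dimensional coadjoint orbit form a polynomial ring over power series.\<close>

definition sym_hom ::
    "('k::comm_ring_1 \<Rightarrow> 'c::comm_ring_1) \<Rightarrow> (vir_index \<Rightarrow> 'c) \<Rightarrow> 'k sym_vir \<Rightarrow> 'c" where
  "sym_hom \<iota> \<phi> p = (\<Sum>m\<in>Poly_Mapping.keys p.
     \<iota> (Poly_Mapping.lookup p m) * (\<Prod>x\<in>Poly_Mapping.keys m. \<phi> x ^ Poly_Mapping.lookup m x))"

lemma sym_hom_var: "\<iota> 1 = 1 \<Longrightarrow> sym_hom \<iota> \<phi> (sym_var x) = \<phi> x"
  by (simp add: sym_hom_def sym_var_def)

lemma sym_hom_const: "\<iota> 0 = 0 \<Longrightarrow> sym_hom \<iota> \<phi> (sym_const c) = \<iota> c"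
  by (simp add: sym_hom_def sym_const_def)

lemma comm_ring_hom_sym_hom:
  assumes "comm_ring_hom \<iota>"
  shows "comm_ring_hom (sym_hom \<iota> \<phi>)"
proof -
  interpret \<iota>: comm_ring_hom \<iota> by fact
  define w where "w m = (\<Prod>x\<in>Poly_Mapping.keys m. \<phi> x ^ Poly_Mapping.lookup m x)"
    for m :: "vir_index \<Rightarrow>\<^sub>0 nat"
  have w: "w m = (\<Prod>x\<in>A. \<phi> x ^ Poly_Mapping.lookup m x)"
    if "finite A" "Poly_Mapping.keys m \<subseteq> A" for m A
    unfolding w_def using that by (intro prod.mono_neutral_left) (auto simp: in_keys_iff)
  have w_add: "w (m + n) = w m * w n" for m n
    using w[of "Poly_Mapping.keys m \<union> Poly_Mapping.keys n" m]
      w[of "Poly_Mapping.keys m \<union> Poly_Mapping.keys n" n]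
      w[of "Poly_Mapping.keys m \<union> Poly_Mapping.keys n" "m + n"] keys_add[of m n]
    by (simp add: lookup_add power_add prod.distrib)
  have single: "sym_hom \<iota> \<phi> (Poly_Mapping.single m a) = \<iota> a * w m" for m a
    by (simp add: sym_hom_def w_def)
  have add: "sym_hom \<iota> \<phi> (p + q) = sym_hom \<iota> \<phi> p + sym_hom \<iota> \<phi> q" for p q
    unfolding sym_hom_def
    by (rule pm_sum_add[of "\<lambda>m a. \<iota> a * (\<Prod>x\<in>Poly_Mapping.keys m. \<phi> x ^ Poly_Mapping.lookup m x)"])
      (simp_all add: \<iota>.hom_add distrib_right)
  have zero: "sym_hom \<iota> \<phi> 0 = 0" by (simp add: sym_hom_def)
  have mult1: "sym_hom \<iota> \<phi> (Poly_Mapping.single m a * q) =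
      sym_hom \<iota> \<phi> (Poly_Mapping.single m a) * sym_hom \<iota> \<phi> q" for m a q
    by (induction q rule: pm_induct)
      (simp_all add: zero add single distrib_left mult_single w_add \<iota>.hom_mult mult_ac)
  have mult: "sym_hom \<iota> \<phi> (p * q) = sym_hom \<iota> \<phi> p * sym_hom \<iota> \<phi> q" for p q
    by (induction p rule: pm_induct) (simp_all add: zero add distrib_right mult1)
  have "sym_hom \<iota> \<phi> 1 = 1"
    using single[of 0 1] by (simp add: w_def)
  with add mult zero show ?thesis by unfold_locales auto
qed

lemma comm_ring_hom_sym_lift: "comm_ring_hom (sym_lift \<chi>)"
proof -
  have "comm_ring_hom (id :: 'a \<Rightarrow> 'a)" by unfold_locales auto
  then have "comm_ring_hom (sym_hom id (\<lambda>x. \<chi> (vir_basis x)))"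
    by (rule comm_ring_hom_sym_hom)
  then show ?thesis by (simp add: sym_hom_def[abs_def] sym_lift_def[abs_def])
qed

interpretation sym_lift: comm_ring_hom "sym_lift \<chi>" for \<chi>
  by (rule comm_ring_hom_sym_lift)

interpretation sym_const: comm_ring_hom "sym_const :: 'k::comm_ring_1 \<Rightarrow> 'k sym_vir"
  by unfold_locales (auto simp: sym_const_add sym_const_mult)

lemma comm_ring_hom_fps_const: "comm_ring_hom (fps_const :: 'k::comm_ring_1 \<Rightarrow> 'k fps)"
  by unfold_locales auto

lemma poisson_0 [simp]: "poisson 0 r = 0" "poisson r 0 = 0"
  using poisson_const_left[of 0 r] poisson_const_right[of r 0] by auto

lemma poisson_diff_left: "poisson (p - q) r = poisson p r - poisson q r"
  using poisson_add_left[of "p - q" q r] by simp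

lemma poisson_pderiv_left:
  assumes "finite A" "sym_vars p \<subseteq> A"
  shows "poisson p r = (\<Sum>x\<in>A. sym_pderiv x p * poisson (sym_var x) r)"
proof -
  have "poisson (sym_var x) r =
      (\<Sum>y\<in>sym_vars r. sym_pderiv y r * sym_incl (vir_bracket (vir_basis x) (vir_basis y)))" for x
  proof -
    have "sym_vars (sym_var x :: 'a sym_vir) \<subseteq> {x}"
      by (auto simp: sym_vars_def sym_var_def)
    then show ?thesis
      by (subst poisson_superset[of "{x}" "sym_vars r"]) (auto simp: sym_pderiv_var)
  qed
  then show ?thesis
    using assms by (subst poisson_superset[of A "sym_vars r"]) (auto simp: sum_distrib_left mult.assoc)
qed

text \<open>For fixed \<open>p\<close> the bracket \<open>{p, _}\<close> is a derivation, so it is controlled by the variables.\<close>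

lemma poisson_idealI:
  assumes "is_ideal I" "\<And>p x. p \<in> I \<Longrightarrow> poisson p (sym_var x) \<in> I"
  shows "poisson_ideal I"
  unfolding poisson_ideal_def
proof (intro conjI ballI allI)
  fix p r assume "p \<in> I"
  show "poisson p r \<in> I"
    by (induction r rule: sym_induct)
      (simp_all add: \<open>p \<in> I\<close> assms poisson_const_right poisson_add_right poisson_mult_right
        ideal_zero ideal_add ideal_mult_left)
qed fact

lemma laurent_deriv_single:
  "laurent_deriv (Poly_Mapping.single n c) = Poly_Mapping.single (n - 1) (of_int n * c)"
  by (intro poly_mapping_eqI) (auto simp: lookup_laurent_deriv lookup_single when_def)

lemma laurent_deriv_0 [simp]: "laurent_deriv 0 = 0"
  by (simp add: laurent_deriv_def)

lemma laurent_res_0 [simp]: "laurent_res 0 = 0"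
  by (simp add: laurent_res_def)

lemma sym_incl_0 [simp]: "sym_incl 0 = 0"
  by (simp add: sym_incl_def)

lemma vir_bracket_Cen_left: "vir_bracket (0, c) u = 0"
  by (simp add: vir_bracket_def Let_def zero_prod_def)

lemma poisson_Cen_left: "poisson (sym_var Cen) p = 0"
  by (induction p rule: sym_induct)
    (simp_all add: poisson_const_right poisson_add_right poisson_mult_right poisson_var
      vir_bracket_Cen_left)

lemma poisson_ideal_plus_central:
  assumes I: "poisson_ideal I" and a: "\<And>r. poisson a r = 0"
  shows "poisson_ideal {x + c * a | x c. x \<in> I}"
proof -
  have "is_ideal I" using I by (simp add: poisson_ideal_def)
  have "\<exists>y d. poisson (x + c * a) r = y + d * a \<and> y \<in> I" if "x \<in> I" for x c r
    using that I a by (intro exI[of _ "poisson x r"] exI[of _ "poisson c r"])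
      (auto simp: poisson_ideal_def poisson_add_left poisson_mult_left mult.commute)
  with is_ideal_plus_principal[OF \<open>is_ideal I\<close>] show ?thesis
    unfolding poisson_ideal_def by blast
qed

lemma poisson_ideal_zero: "poisson_ideal {0}"
  by (auto simp: poisson_ideal_def is_ideal_iff)

lemma poisson_ideal_central: "(\<And>r. poisson a r = 0) \<Longrightarrow> poisson_ideal (ideal_gen {a})"
  using poisson_ideal_plus_central[OF poisson_ideal_zero, of a]
  by (simp add: ideal_gen_singleton full_SetCompr_eq)

lemma poisson_Cen_minus_const: "poisson (sym_var Cen - sym_const \<zeta>) r = 0"
  by (simp add: poisson_diff_left poisson_Cen_left poisson_const_left)

section \<open>Nullstellensatz\<close>

instance vir_index :: countable
proof
  show "\<exists>to_nat :: vir_index \<Rightarrow> nat. inj to_nat"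
    by (rule exI[of _ "\<lambda>x. case x of Del n \<Rightarrow> Suc (to_nat n) | Cen \<Rightarrow> 0"])
      (auto simp: inj_def split: vir_index.splits)
qed

lemma countable_poly_mapping: "countable (UNIV :: ('a::countable \<Rightarrow>\<^sub>0 'b::{zero,countable}) set)"
proof -
  let ?g = "\<lambda>p :: 'a \<Rightarrow>\<^sub>0 'b. (\<lambda>x. (x, Poly_Mapping.lookup p x)) ` Poly_Mapping.keys p"
  have "inj ?g"
  proof (rule injI)
    fix p q assume eq: "?g p = ?g q"
    have "Poly_Mapping.keys p = Poly_Mapping.keys q"
      using arg_cong[OF eq, of "image fst"] by (simp add: image_image)
    moreover have "Poly_Mapping.lookup p x = Poly_Mapping.lookup q x" if "x \<in> Poly_Mapping.keys p" for x
      using eq that by blast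
    ultimately show "p = q"
      by (intro poly_mapping_eqI) (metis in_keys_iff)
  qed
  moreover have "range ?g \<subseteq> {A. finite A}" by auto
  moreover have "countable {A :: ('a \<times> 'b) set. finite A}"
    using countable_Collect_finite_subset[of "UNIV :: ('a \<times> 'b) set"] by simp
  ultimately have "countable (range ?g)" by (blast intro: countable_subset)
  then show ?thesis using countable_image_inj_eq[OF \<open>inj ?g\<close>] by simp
qed

text \<open>Gaussian elimination, one coordinate of \<open>K\<close> at a time. The vectors are indexed, so that repeated
  vectors count as a dependency.\<close>

lemma finite_support_dependent:
  fixes b :: "'c \<Rightarrow> 'm \<Rightarrow>\<^sub>0 'k::field"
  assumes "finite K" "infinite U" "\<And>c. c \<in> U \<Longrightarrow> Poly_Mapping.keys (b c) \<subseteq> K"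
  shows "\<exists>A l. finite A \<and> A \<subseteq> U \<and> (\<exists>c\<in>A. l c \<noteq> 0) \<and>
    (\<forall>m. (\<Sum>c\<in>A. l c * Poly_Mapping.lookup (b c) m) = 0)"
  using assms
proof (induction K arbitrary: U b rule: finite_induct)
  case empty
  then obtain c where "c \<in> U" by fastforce
  moreover have "Poly_Mapping.keys (b c) = {}" using empty \<open>c \<in> U\<close> by blast
  ultimately show ?case
    by (intro exI[of _ "{c}"] exI[of _ "\<lambda>_. 1"]) auto
next
  case (insert k K)
  show ?case
  proof (cases "\<forall>c\<in>U. Poly_Mapping.lookup (b c) k = 0")
    case True
    then have "Poly_Mapping.keys (b c) \<subseteq> K" if "c \<in> U" for c
      using insert.prems(2)[OF that] that by (auto simp: in_keys_iff)
    with insert.IH[OF insert.prems(1)] show ?thesis by blast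
  next
    case False
    then obtain c0 where c0: "c0 \<in> U" "Poly_Mapping.lookup (b c0) k \<noteq> 0" by auto
    define r where "r c = Poly_Mapping.lookup (b c) k / Poly_Mapping.lookup (b c0) k" for c
    define b' where "b' c = b c - Poly_Mapping.map ((*) (r c)) (b c0)" for c
    have b': "Poly_Mapping.lookup (b' c) m =
        Poly_Mapping.lookup (b c) m - r c * Poly_Mapping.lookup (b c0) m" for c m
      by (simp add: b'_def lookup_minus Poly_Mapping.map.rep_eq when_def)
    have "Poly_Mapping.keys (b' c) \<subseteq> K" if "c \<in> U - {c0}" for c
    proof
      fix m assume "m \<in> Poly_Mapping.keys (b' c)"
      then have *: "Poly_Mapping.lookup (b c) m - r c * Poly_Mapping.lookup (b c0) m \<noteq> 0"
        by (simp add: in_keys_iff b')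
      then have "m \<noteq> k" using c0 by (auto simp: r_def)
      moreover have "m \<in> Poly_Mapping.keys (b c) \<union> Poly_Mapping.keys (b c0)"
        using * by (auto simp: in_keys_iff)
      ultimately show "m \<in> K" using insert.prems(2)[of c] insert.prems(2)[of c0] c0 that by auto
    qed
    moreover have "infinite (U - {c0})" using insert.prems by simp
    ultimately obtain A l where A: "finite A" "A \<subseteq> U - {c0}" "\<exists>c\<in>A. l c \<noteq> 0"
      and sum: "\<And>m. (\<Sum>c\<in>A. l c * Poly_Mapping.lookup (b' c) m) = 0"
      using insert.IH[of "U - {c0}" b'] by blast
    define l' where "l' c = (if c = c0 then - (\<Sum>c\<in>A. l c * r c) else l c)" for c
    have "(\<Sum>c\<in>insert c0 A. l' c * Poly_Mapping.lookup (b c) m) = 0" for m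
    proof -
      have "c0 \<notin> A" using A by auto
      then have "(\<Sum>c\<in>insert c0 A. l' c * Poly_Mapping.lookup (b c) m) =
          - (\<Sum>c\<in>A. l c * r c) * Poly_Mapping.lookup (b c0) m
          + (\<Sum>c\<in>A. l' c * Poly_Mapping.lookup (b c) m)"
        using A by (simp add: l'_def)
      also have "(\<Sum>c\<in>A. l' c * Poly_Mapping.lookup (b c) m) =
          (\<Sum>c\<in>A. l c * Poly_Mapping.lookup (b c) m)"
        using \<open>c0 \<notin> A\<close> by (intro sum.cong) (auto simp: l'_def)
      also have "- (\<Sum>c\<in>A. l c * r c) * Poly_Mapping.lookup (b c0) m + \<dots> =
          (\<Sum>c\<in>A. l c * Poly_Mapping.lookup (b' c) m)"
        by (simp add: b' sum_distrib_right right_diff_distrib sum_subtractf mult.assoc)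
      finally show ?thesis by (simp add: sum)
    qed
    moreover have "\<exists>c\<in>insert c0 A. l' c \<noteq> 0" using A by (auto simp: l'_def)
    ultimately show ?thesis using A c0
      by (intro exI[of _ "insert c0 A"] exI[of _ l']) auto
  qed
qed

lemma uncountable_fibre:
  assumes "uncountable A" "countable (f ` A)"
  obtains y where "uncountable {x \<in> A. f x = y}"
proof (rule ccontr)
  assume "\<not> thesis"
  then have "countable {x \<in> A. f x = y}" for y using that by blast
  then have "countable (\<Union>y\<in>f ` A. {x \<in> A. f x = y})" using assms(2) by blast
  moreover have "A = (\<Union>y\<in>f ` A. {x \<in> A. f x = y})" by auto
  ultimately show False using assms(1) by simp
qed

text \<open>\<open>M\<close> is the contraction of a maximal ideal of the localisation at \<open>H\<close>; invertibility of \<open>a\<close>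
  in the residue field of the localisation reads \<open>a b \<equiv> H^k\<close>.\<close>

lemma exists_maximal_ideal_avoiding_powers:
  fixes I :: "'a::comm_ring_1 set"
  assumes I: "is_ideal I" and H: "\<And>k::nat. H ^ k \<notin> I"
  obtains M where "is_ideal M" "I \<subseteq> M" "\<And>k::nat. H ^ k \<notin> M"
    "\<And>a. a \<notin> M \<Longrightarrow> \<exists>k b. a * b - H ^ k \<in> M"
    "\<And>a b. a * b \<in> M \<Longrightarrow> a \<in> M \<or> b \<in> M"
proof -
  let ?\<A> = "{J. is_ideal J \<and> I \<subseteq> J \<and> (\<forall>k::nat. H ^ k \<notin> J)}"
  have "\<exists>M\<in>?\<A>. \<forall>X\<in>?\<A>. M \<subseteq> X \<longrightarrow> X = M"
  proof (rule subset_Zorn_nonempty)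
    show "?\<A> \<noteq> {}" using I H by auto
  next
    fix \<C> assume C: "\<C> \<noteq> {}" "subset.chain ?\<A> \<C>"
    then have sub: "\<C> \<subseteq> ?\<A>" and chain: "\<And>x y. x \<in> \<C> \<Longrightarrow> y \<in> \<C> \<Longrightarrow> x \<subseteq> y \<or> y \<subseteq> x"
      by (auto simp: subset.chain_def)
    have "is_ideal (\<Union>\<C>)"
      unfolding is_ideal_iff
    proof (intro conjI ballI allI)
      obtain J where J: "J \<in> \<C>" using C by auto
      then have "is_ideal J" using sub by auto
      with J show "0 \<in> \<Union>\<C>" using ideal_zero by auto
    next
      fix x y assume "x \<in> \<Union>\<C>" "y \<in> \<Union>\<C>"
      then obtain J where "J \<in> \<C>" "x \<in> J" "y \<in> J" using chain by blast
      moreover from this have "is_ideal J" using sub by auto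
      ultimately show "x + y \<in> \<Union>\<C>" using ideal_add by blast
    next
      fix c x assume "x \<in> \<Union>\<C>"
      then obtain J where "J \<in> \<C>" "x \<in> J" by blast
      moreover from this have "is_ideal J" using sub by auto
      ultimately show "c * x \<in> \<Union>\<C>" using ideal_mult_left by blast
    qed
    then show "\<Union>\<C> \<in> ?\<A>" using sub C by blast
  qed
  then obtain M where M: "is_ideal M" "I \<subseteq> M" "\<And>k::nat. H ^ k \<notin> M"
    and max: "\<And>X. is_ideal X \<Longrightarrow> I \<subseteq> X \<Longrightarrow> (\<forall>k::nat. H ^ k \<notin> X) \<Longrightarrow> M \<subseteq> X \<Longrightarrow> X = M"
    by auto
  have inv: "\<exists>k b. a * b - H ^ k \<in> M" if "a \<notin> M" for a
  proof -
    let ?X = "{x + c * a | x c. x \<in> M}"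
    have X: "is_ideal ?X" by (rule is_ideal_plus_principal) fact
    have "M \<subseteq> ?X"
    proof
      fix x assume "x \<in> M"
      then show "x \<in> ?X" by (intro CollectI exI[of _ x] exI[of _ 0]) auto
    qed
    have "a \<in> ?X" using ideal_zero[OF M(1)] by (intro CollectI exI[of _ 0] exI[of _ 1]) auto
    have "\<not> (\<forall>k::nat. H ^ k \<notin> ?X)"
    proof
      assume "\<forall>k::nat. H ^ k \<notin> ?X"
      from max[OF X subset_trans[OF M(2) \<open>M \<subseteq> ?X\<close>] this \<open>M \<subseteq> ?X\<close>] have "?X = M" .
      with \<open>a \<in> ?X\<close> have "a \<in> M" by blast
      with that show False by blast
    qed
    then obtain k x c where xc: "x \<in> M" "H ^ k = x + c * a" by auto
    then have "a * c - H ^ k = - x" by (simp add: mult.commute)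
    then show ?thesis using ideal_uminus[OF M(1) xc(1)] by (intro exI[of _ k] exI[of _ c]) simp
  qed
  have prime: "a \<in> M \<or> b \<in> M" if ab: "a * b \<in> M" for a b
  proof (rule ccontr)
    assume "\<not> ?thesis"
    with inv obtain k c l d where 1: "a * c - H ^ k \<in> M" and 2: "b * d - H ^ l \<in> M" by meson
    have "c * d * (a * b) - (b * d * (a * c - H ^ k) + H ^ k * (b * d - H ^ l)) \<in> M"
      by (intro ideal_diff[OF M(1)] ideal_add[OF M(1)] ideal_mult_left[OF M(1), of "a * b"]
          ideal_mult_left[OF M(1) 1] ideal_mult_left[OF M(1) 2] ab)
    also have "c * d * (a * b) - (b * d * (a * c - H ^ k) + H ^ k * (b * d - H ^ l)) = H ^ (k + l)"
      by (simp add: algebra_simps power_add)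
    finally show False using M(3) by blast
  qed
  show ?thesis using M inv prime by (rule that)
qed

text \<open>Over an algebraically closed field \<open>p\<close> is a product of linear factors, and the prime ideal \<open>M\<close>
  contains the value of one of them.\<close>

lemma residue_scalar_of_polynomial_relation:
  fixes a :: "'k::alg_closed_field sym_vir"
  assumes M: "is_ideal M" "1 \<notin> M" and prime: "\<And>a b. a * b \<in> M \<Longrightarrow> a \<in> M \<or> b \<in> M"
    and "p \<noteq> 0" "poly (map_poly sym_const p) a \<in> M"
  shows "\<exists>r. a - sym_const r \<in> M"
  using assms(4,5)
proof (induction "degree p" arbitrary: p)
  case 0
  then obtain c where c: "p = [:c:]" by (metis degree_eq_zeroE)
  with 0 have "c \<noteq> 0" "sym_const c \<in> M" by (auto simp: map_poly_pCons)
  then have "sym_const (inverse c) * sym_const c \<in> M" "c \<noteq> 0"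
    using ideal_mult_left[OF M(1)] by auto
  then have "1 \<in> M" by (simp add: sym_const_mult[symmetric])
  with M show ?case by simp
next
  case (Suc n)
  then obtain r where "poly p r = 0" using alg_closed_imp_poly_has_root[of p] by auto
  then obtain s where s: "p = [:- r, 1:] * s" by (meson dvdE poly_eq_0_iff_dvd)
  interpret map_poly_comm_ring_hom sym_const ..
  have "poly (map_poly sym_const p) a = (a - sym_const r) * poly (map_poly sym_const s) a"
    unfolding s hom_mult poly_mult by (simp add: sym_const.hom_uminus)
  with Suc prime have "a - sym_const r \<in> M \<or> poly (map_poly sym_const s) a \<in> M" by metis
  moreover have "s \<noteq> 0" using Suc s by auto
  moreover have "degree p = degree [:- r, 1:] + degree s"
    unfolding s using \<open>s \<noteq> 0\<close> by (intro degree_mult_eq) auto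
  then have "degree s = n" using Suc(2) by simp
  ultimately show ?case using Suc(1)[of s] by auto
qed

text \<open>If \<open>a\<close> were not congruent to a scalar, each \<open>a - c\<close> would have an inverse \<open>b c\<close> up to a power of
  \<open>H\<close>. There are uncountably many \<open>c\<close>, but only countably many exponents and finite sets of
  monomials. So infinitely many of the \<open>b c\<close> belong to the same exponent and the same
  finite-dimensional space. A linear dependency between them, with denominators cleared, is a
  polynomial equation for \<open>a\<close> modulo \<open>M\<close>.\<close>

lemma residue_scalar:
  fixes a :: "'k::alg_closed_field sym_vir"
  assumes unc: "uncountable (UNIV :: 'k set)"
    and M: "is_ideal M" "\<And>k::nat. H ^ k \<notin> M" and prime: "\<And>a b. a * b \<in> M \<Longrightarrow> a \<in> M \<or> b \<in> M"
    and inv: "\<And>a. a \<notin> M \<Longrightarrow> \<exists>k b. a * b - H ^ k \<in> M"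
  shows "\<exists>c. a - sym_const c \<in> M"
proof (rule ccontr)
  assume none: "\<nexists>c. a - sym_const c \<in> M"
  then have "\<forall>c. \<exists>k b. (a - sym_const c) * b - H ^ k \<in> M" using inv by blast
  then obtain k b where kb: "\<And>c. (a - sym_const c) * b c - H ^ k c \<in> M" by metis
  let ?f = "\<lambda>c. (k c, Poly_Mapping.keys (b c))"
  have "countable {A :: (vir_index \<Rightarrow>\<^sub>0 nat) set. finite A}"
    using countable_Collect_finite_subset[OF countable_poly_mapping] by simp
  then have "countable ((UNIV :: nat set) \<times> {A :: (vir_index \<Rightarrow>\<^sub>0 nat) set. finite A})"
    by (intro countable_SIGMA) auto
  then have "countable (range ?f)" by (rule countable_subset[rotated]) auto
  then obtain y where "uncountable {c \<in> UNIV. ?f c = y}" by (rule uncountable_fibre[OF unc])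
  then obtain n K where U: "uncountable {c. k c = n \<and> Poly_Mapping.keys (b c) = K}"
    by (cases y) auto
  define U where "U = {c. k c = n \<and> Poly_Mapping.keys (b c) = K}"
  have "infinite U" using U by (auto simp: U_def dest: countable_finite)
  then obtain c where "c \<in> U" by fastforce
  then have "finite K" by (auto simp: U_def)
  with \<open>infinite U\<close> obtain A l c0 where A: "finite A" "A \<subseteq> U" "c0 \<in> A" "l c0 \<noteq> 0"
    and dep: "\<And>m. (\<Sum>c\<in>A. l c * Poly_Mapping.lookup (b c) m) = 0"
    using finite_support_dependent[of K U b] unfolding U_def by blast
  have dep: "(\<Sum>c\<in>A. sym_const (l c) * b c) = 0"
    by (intro poly_mapping_eqI) (simp add: lookup_sum sym_const_def lookup_const_mult dep)
  \<comment> \<open>\<open>p\<close> is the numerator of \<open>\<Sum>c. l c / (T - c)\<close>; its value at \<open>c0\<close> shows \<open>p \<noteq> 0\<close>.\<close>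
  define p where "p = (\<Sum>c\<in>A. Polynomial.smult (l c) (\<Prod>j\<in>A - {c}. [:- j, 1:]))"
  have "poly p c0 = (\<Sum>c\<in>A. if c = c0 then l c0 * (\<Prod>j\<in>A - {c0}. c0 - j) else 0)"
    unfolding p_def poly_sum
    by (intro sum.cong refl) (use A in \<open>auto simp: poly_prod intro!: prod_zero bexI[of _ c0]\<close>)
  also have "\<dots> = l c0 * (\<Prod>j\<in>A - {c0}. c0 - j)" using A by simp
  also have "\<dots> \<noteq> 0" using A by (auto simp: prod_zero_iff)
  finally have "p \<noteq> 0" by auto
  let ?Q = "\<lambda>B. \<Prod>j\<in>B. a - sym_const j"
  interpret mp: map_poly_comm_ring_hom "sym_const :: 'k \<Rightarrow> 'k sym_vir" ..
  have "poly (map_poly sym_const p) a = (\<Sum>c\<in>A. sym_const (l c) * ?Q (A - {c}))"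
    by (simp add: p_def mp.hom_sum mp.hom_prod poly_sum poly_prod sym_const.map_poly_hom_smult
        sym_const.hom_uminus)
  moreover have "H ^ n * (\<Sum>c\<in>A. sym_const (l c) * ?Q (A - {c})) =
      ?Q A * (\<Sum>c\<in>A. sym_const (l c) * b c)
      - (\<Sum>c\<in>A. sym_const (l c) * ?Q (A - {c}) * ((a - sym_const c) * b c - H ^ n))"
  proof -
    have "?Q A = (a - sym_const c) * ?Q (A - {c})" if "c \<in> A" for c
      using that A by (simp add: prod.remove)
    then have "?Q A * (sym_const (l c) * b c) =
        sym_const (l c) * ?Q (A - {c}) * ((a - sym_const c) * b c)" if "c \<in> A" for c
      using that by (simp add: mult_ac)
    then have "?Q A * (\<Sum>c\<in>A. sym_const (l c) * b c) =
        (\<Sum>c\<in>A. sym_const (l c) * ?Q (A - {c}) * ((a - sym_const c) * b c))"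
      unfolding sum_distrib_left by (intro sum.cong) auto
    then show ?thesis
      by (simp add: right_diff_distrib sum_subtractf sum_distrib_left mult_ac)
  qed
  moreover have "sym_const (l c) * ?Q (A - {c}) * ((a - sym_const c) * b c - H ^ n) \<in> M"
    if "c \<in> A" for c
    using kb[of c] A(2) that by (intro ideal_mult_left[OF M(1)]) (auto simp: U_def)
  then have "?Q A * (\<Sum>c\<in>A. sym_const (l c) * b c)
      - (\<Sum>c\<in>A. sym_const (l c) * ?Q (A - {c}) * ((a - sym_const c) * b c - H ^ n)) \<in> M"
    unfolding dep mult_zero_right by (intro ideal_diff ideal_sum ideal_zero M(1)) auto
  ultimately have "H ^ n * poly (map_poly sym_const p) a \<in> M" by simp
  then have "poly (map_poly sym_const p) a \<in> M" using prime M(2) by blast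
  moreover have "1 \<notin> M" using M(2)[of 0] by simp
  ultimately have "\<exists>c. a - sym_const c \<in> M"
    using residue_scalar_of_polynomial_relation[OF M(1) _ prime \<open>p \<noteq> 0\<close>] by blast
  with none show False by blast
qed

text \<open>For \<open>H = 1\<close> this says that a proper ideal has a point; the general case says that a function
  vanishing at all points has a power in the ideal.\<close>

lemma nullstellensatz:
  fixes I :: "'k::alg_closed_field sym_vir set"
  assumes unc: "uncountable (UNIV :: 'k set)" and I: "is_ideal I" and H: "\<And>k::nat. H ^ k \<notin> I"
  obtains \<chi> where "vir_linear \<chi>" "I \<subseteq> max_ideal_at \<chi>" "sym_lift \<chi> H \<noteq> 0"
proof -
  obtain M where M: "is_ideal M" "I \<subseteq> M" "\<And>k::nat. H ^ k \<notin> M"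
    "\<And>a. a \<notin> M \<Longrightarrow> \<exists>k b. a * b - H ^ k \<in> M" "\<And>a b. a * b \<in> M \<Longrightarrow> a \<in> M \<or> b \<in> M"
    by (rule exists_maximal_ideal_avoiding_powers[OF I H], blast)
  have one: "1 \<notin> M" using M(3)[of 0] by simp
  have "\<exists>c. a - sym_const c \<in> M" for a
    by (rule residue_scalar[OF unc M(1,3,5,4)])
  then obtain h where h: "\<And>a. a - sym_const (h a) \<in> M" by metis
  have uniq: "h a = c" if "a - sym_const c \<in> M" for a c
  proof (rule ccontr)
    assume "h a \<noteq> c"
    have "(a - sym_const c) - (a - sym_const (h a)) \<in> M" by (intro ideal_diff M(1) that h)
    then have "sym_const (inverse (h a - c)) * (sym_const (h a) - sym_const c) \<in> M"
      by (intro ideal_mult_left M(1)) simp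
    then show False
      using one \<open>h a \<noteq> c\<close> by (simp add: sym_const.hom_minus[symmetric] sym_const_mult[symmetric])
  qed
  have add: "h (p + q) = h p + h q" for p q
    by (rule uniq) (use ideal_add[OF M(1) h[of p] h[of q]] in \<open>simp add: sym_const_add algebra_simps\<close>)
  have mult: "h (p * q) = h p * h q" for p q
  proof (rule uniq)
    have "q * (p - sym_const (h p)) + sym_const (h p) * (q - sym_const (h q)) \<in> M"
      by (intro ideal_add ideal_mult_left M(1) h)
    then show "p * q - sym_const (h p * h q) \<in> M" by (simp add: sym_const_mult algebra_simps)
  qed
  have const: "h (sym_const c) = c" for c
    by (rule uniq) (simp add: ideal_zero[OF M(1)])
  define \<chi> where "\<chi> u = h (sym_incl u)" for u
  have lin: "vir_linear \<chi>"
    unfolding vir_linear_def \<chi>_def by (simp add: sym_incl_add sym_incl_scale add mult const)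
  have lift: "h = sym_lift \<chi>"
    by (rule sym_lift_unique[OF lin add mult const]) (simp add: \<chi>_def)
  have mem: "a \<in> M \<longleftrightarrow> h a = 0" for a
    using h[of a] uniq[of a 0] by auto
  show ?thesis
  proof (rule that)
    show "vir_linear \<chi>" by fact
    show "I \<subseteq> max_ideal_at \<chi>" using M(2) mem by (auto simp: max_ideal_at_def lift)
    show "sym_lift \<chi> H \<noteq> 0" using M(3)[of 1] mem by (simp add: lift)
  qed
qed

section \<open>Order of vanishing and coadjoint stabilisers\<close>

lemma vir_linear_add: "vir_linear \<chi> \<Longrightarrow> \<chi> (u + v) = \<chi> u + \<chi> v"
  and vir_linear_scale: "vir_linear \<chi> \<Longrightarrow> \<chi> (vir_scale c u) = c * \<chi> u"
  unfolding vir_linear_def by blast+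

lemma vir_linear_0: "vir_linear \<chi> \<Longrightarrow> \<chi> 0 = 0"
  using vir_linear_scale[of \<chi> 0 0] by (simp add: vir_scale_def zero_prod_def)

lemma vir_linear_sum:
  assumes "vir_linear \<chi>" "finite A"
  shows "\<chi> (\<Sum>n\<in>A. vir_scale (c n) (v n)) = (\<Sum>n\<in>A. c n * \<chi> (v n))"
  using assms(2) by (induction A rule: finite_induct)
    (simp_all add: vir_linear_0 vir_linear_add vir_linear_scale assms(1))

lemma vir_linear_bracket:
  assumes "vir_linear \<chi>"
  shows "vir_linear (\<lambda>v. \<chi> (vir_bracket u v))" "vir_linear (\<lambda>u. \<chi> (vir_bracket u v))"
  unfolding vir_linear_def vir_bracket_add_left vir_bracket_add_right
      vir_bracket_scale_left vir_bracket_scale_right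
  by (simp_all only: vir_linear_add[OF assms] vir_linear_scale[OF assms] simp_thms)

text \<open>The coefficientwise form shows that in characteristic \<open>0\<close> a polynomial with vanishing partial
  derivatives is constant.\<close>

lemma lookup_sym_pderiv:
  "Poly_Mapping.lookup (sym_pderiv x p) m =
    of_nat (Poly_Mapping.lookup m x + 1) * Poly_Mapping.lookup p (m + Poly_Mapping.single x 1)"
proof (induction p rule: pm_induct)
  case zero
  then show ?case by simp
next
  case (add p n a)
  let ?e = "Poly_Mapping.single x (1 :: nat)"
  have "Poly_Mapping.lookup (sym_pderiv x (Poly_Mapping.single n a)) m =
      of_nat (Poly_Mapping.lookup m x + 1) * Poly_Mapping.lookup (Poly_Mapping.single n a) (m + ?e)"
  proof (cases "n = m + ?e")
    case True
    then show ?thesis by (simp add: sym_pderiv_single lookup_add)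
  next
    case False
    have "Poly_Mapping.lookup n x = 0" if "n - ?e = m"
    proof (rule ccontr)
      assume "Poly_Mapping.lookup n x \<noteq> 0"
      then have "n = (n - ?e) + ?e"
        by (intro poly_mapping_eqI) (auto simp: lookup_add lookup_minus lookup_single when_def)
      with that False show False by simp
    qed
    with False show ?thesis
      by (auto simp: sym_pderiv_single lookup_single when_def)
  qed
  with add show ?case by (simp add: sym_pderiv_add lookup_add algebra_simps)
qed

lemma sym_vars_iff: "x \<in> sym_vars p \<longleftrightarrow>
  (\<exists>m. Poly_Mapping.lookup p m \<noteq> 0 \<and> Poly_Mapping.lookup m x \<noteq> 0)"
  by (auto simp: sym_vars_def in_keys_iff)

lemma sym_vars_pderiv: "sym_vars (sym_pderiv x p) \<subseteq> sym_vars p"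
proof
  fix y assume "y \<in> sym_vars (sym_pderiv x p)"
  then obtain m where "Poly_Mapping.lookup p (m + Poly_Mapping.single x 1) \<noteq> 0"
    "Poly_Mapping.lookup m y \<noteq> 0"
    unfolding sym_vars_iff lookup_sym_pderiv by (metis mult_zero_right)
  then show "y \<in> sym_vars p"
    unfolding sym_vars_iff by (intro exI[of _ "m + Poly_Mapping.single x 1"]) (auto simp: lookup_add)
qed

text \<open>The polynomials whose partial derivatives of order less than \<open>d\<close> vanish at \<open>\<chi>\<close>; in
  characteristic \<open>0\<close> this is the \<open>d\<close>-th power of the maximal ideal at \<open>\<chi>\<close>.\<close>

primrec vanishing_order :: "('k::comm_ring_1 vir \<Rightarrow> 'k) \<Rightarrow> nat \<Rightarrow> 'k sym_vir set" where
  "vanishing_order \<chi> 0 = UNIV"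
| "vanishing_order \<chi> (Suc d) = {p. sym_lift \<chi> p = 0 \<and> (\<forall>x. sym_pderiv x p \<in> vanishing_order \<chi> d)}"

lemma vanishing_order_Suc: "p \<in> vanishing_order \<chi> (Suc d) \<Longrightarrow> p \<in> vanishing_order \<chi> d"
  by (induction d arbitrary: p) auto

lemma is_ideal_vanishing_order: "is_ideal (vanishing_order \<chi> d)"
proof (induction d)
  case 0
  then show ?case by (simp add: is_ideal_iff)
next
  case (Suc d)
  have "c * p \<in> vanishing_order \<chi> (Suc d)" if p: "p \<in> vanishing_order \<chi> (Suc d)" for c p
  proof -
    have "sym_pderiv x c * p + c * sym_pderiv x p \<in> vanishing_order \<chi> d" for x
      using p vanishing_order_Suc[OF p] by (intro ideal_add ideal_mult_left Suc) auto
    then show ?thesis using p by (simp add: sym_lift.hom_mult sym_pderiv_mult)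
  qed
  then show ?case
    unfolding is_ideal_iff
    using ideal_zero[OF Suc] ideal_add[OF Suc] by (auto simp: sym_pderiv_add sym_lift.hom_add)
qed

lemma vanishing_order_mult_point:
  assumes "p \<in> vanishing_order \<chi> d" "sym_lift \<chi> r = 0"
  shows "p * r \<in> vanishing_order \<chi> (Suc d)"
  using assms
proof (induction d arbitrary: p)
  case 0
  then show ?case by (simp add: sym_lift.hom_mult)
next
  case (Suc d)
  have "sym_pderiv x (p * r) \<in> vanishing_order \<chi> (Suc d)" for x
  proof -
    have "sym_pderiv x p * r \<in> vanishing_order \<chi> (Suc d)" using Suc by simp
    moreover have "p * sym_pderiv x r \<in> vanishing_order \<chi> (Suc d)"
      using Suc.prems by (intro ideal_mult_right is_ideal_vanishing_order)
    ultimately show ?thesis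
      unfolding sym_pderiv_mult by (intro ideal_add is_ideal_vanishing_order)
  qed
  moreover have "sym_lift \<chi> (p * r) = 0" using Suc.prems by (simp add: sym_lift.hom_mult)
  ultimately show ?case by simp
qed

lemma poisson_vanishing_order:
  assumes "p \<in> vanishing_order \<chi> (Suc d)"
  shows "poisson p r \<in> vanishing_order \<chi> d"
  unfolding poisson_pderiv_left[of "sym_vars p" p, OF finite_sym_vars subset_refl]
  using assms by (intro ideal_sum ideal_mult_right is_ideal_vanishing_order) auto

text \<open>Taylor expansion: a polynomial that vanishes to all orders has partial derivatives with the same
  property and of smaller degree, so by induction it is constant, and its value at \<open>\<chi>\<close> is \<open>0\<close>.\<close>

lemma exists_not_vanishing_order:
  fixes q :: "'k::{comm_ring_1, ring_char_0, semiring_no_zero_divisors} sym_vir"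
  assumes "q \<noteq> 0"
  shows "\<exists>d. q \<notin> vanishing_order \<chi> d"
proof -
  define D where "D m = (\<Sum>x\<in>Poly_Mapping.keys m. Poly_Mapping.lookup m x)"
    for m :: "vir_index \<Rightarrow>\<^sub>0 nat"
  have D_add: "D (m + n) = D m + D n" for m n
    unfolding D_def by (rule pm_sum_add) auto
  have D_single: "D (Poly_Mapping.single x 1) = 1" for x
    by (simp add: D_def)
  have const: "m = 0 \<or> (\<exists>n x. m = n + Poly_Mapping.single x 1)" for m :: "vir_index \<Rightarrow>\<^sub>0 nat"
  proof (rule disjCI)
    assume "\<nexists>n x. m = n + Poly_Mapping.single x 1"
    moreover have "m = (m - Poly_Mapping.single x 1) + Poly_Mapping.single x 1"
      if "Poly_Mapping.lookup m x \<noteq> 0" for x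
      using that
      by (intro poly_mapping_eqI) (auto simp: lookup_add lookup_minus lookup_single when_def)
    ultimately show "m = 0" by (intro poly_mapping_eqI) auto
  qed
  have main: "q = 0" if "\<And>d. q \<in> vanishing_order \<chi> d"
    "\<And>m. m \<in> Poly_Mapping.keys q \<Longrightarrow> D m < n" for n and q :: "'k sym_vir"
    using that
  proof (induction n arbitrary: q)
    case 0
    then have "Poly_Mapping.keys q = {}" by blast
    then show ?case by simp
  next
    case (Suc n)
    have "sym_pderiv x q = 0" for x
    proof (rule Suc.IH)
      show "sym_pderiv x q \<in> vanishing_order \<chi> d" for d
        using Suc.prems(1)[of "Suc d"] by simp
      fix m assume "m \<in> Poly_Mapping.keys (sym_pderiv x q)"
      then have "m + Poly_Mapping.single x 1 \<in> Poly_Mapping.keys q"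
        by (auto simp: in_keys_iff lookup_sym_pderiv)
      from Suc.prems(2)[OF this] show "D m < n" by (simp add: D_add D_single[unfolded One_nat_def])
    qed
    then have "Poly_Mapping.lookup (sym_pderiv x q) m = 0" for x m by simp
    then have high: "Poly_Mapping.lookup q (m + Poly_Mapping.single x 1) = 0" for x m
      unfolding lookup_sym_pderiv using of_nat_neq_0 mult_eq_0_iff
      by (metis Suc_eq_plus1)
    then have "q = sym_const (Poly_Mapping.lookup q 0)"
      unfolding sym_const_def
    proof (intro poly_mapping_eqI)
      fix m show "Poly_Mapping.lookup q m =
          Poly_Mapping.lookup (Poly_Mapping.single 0 (Poly_Mapping.lookup q 0)) m"
      proof (cases "m = 0")
        case False
        then show ?thesis using const[of m] high by (auto simp: lookup_single when_def)
      qed simp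
    qed
    moreover have "sym_lift \<chi> q = 0" using Suc.prems(1)[of "Suc 0"] by simp
    ultimately show ?case by (metis sym_lift_const sym_const_0)
  qed
  have "\<exists>n. \<forall>m\<in>Poly_Mapping.keys q. D m < n"
  proof (intro exI ballI)
    fix m assume "m \<in> Poly_Mapping.keys q"
    then show "D m < Suc (\<Sum>m\<in>Poly_Mapping.keys q. D m)"
      by (simp add: le_imp_less_Suc member_le_sum)
  qed
  with main assms show ?thesis by blast
qed

lemma exact_vanishing_order:
  fixes q :: "'k::{comm_ring_1, ring_char_0, semiring_no_zero_divisors} sym_vir"
  assumes "q \<noteq> 0"
  obtains d where "q \<in> vanishing_order \<chi> d" "q \<notin> vanishing_order \<chi> (Suc d)"
proof -
  define n where "n = (LEAST d. q \<notin> vanishing_order \<chi> d)"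
  have n: "q \<notin> vanishing_order \<chi> n"
    unfolding n_def using exists_not_vanishing_order[OF assms] by (rule LeastI_ex)
  then obtain d where "n = Suc d" by (cases n) auto
  moreover from this have "q \<in> vanishing_order \<chi> d"
    using not_less_Least[of d "\<lambda>d. q \<notin> vanishing_order \<chi> d"] by (auto simp: n_def)
  ultimately show ?thesis using that n by blast
qed

text \<open>Linearly independent functionals admit a dual system. In the induction step, \<open>v\<close> is a vector on which
  \<open>l k\<close> differs from the combination of the old functionals that agrees with it on the old dual
  vectors.\<close>

lemma dual_vectors:
  fixes l :: "'n \<Rightarrow> 'k::field vir \<Rightarrow> 'k"
  assumes "finite F" "\<And>n. n \<in> F \<Longrightarrow> vir_linear (l n)"
    and "\<And>c. (\<forall>v. (\<Sum>n\<in>F. c n * l n v) = 0) \<Longrightarrow> \<forall>n\<in>F. c n = 0"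
  shows "\<exists>u. \<forall>m\<in>F. \<forall>n\<in>F. l m (u n) = (if m = n then 1 else 0)"
  using assms
proof (induction F rule: finite_induct)
  case empty
  then show ?case by simp
next
  case (insert k F)
  have lin_add: "l n (v + w) = l n v + l n w" and lin_scale: "l n (vir_scale c v) = c * l n v"
    if "n \<in> insert k F" for n v w c
    using insert.prems(1)[OF that] unfolding vir_linear_def by blast+
  have lin_sum: "l n (\<Sum>m\<in>A. vir_scale (c m) (v m)) = (\<Sum>m\<in>A. c m * l n (v m))"
    if "n \<in> insert k F" "finite A" for n A and c :: "'n \<Rightarrow> 'k" and v
    using insert.prems(1)[OF that(1)] that(2) by (rule vir_linear_sum)
  have "\<exists>u. \<forall>m\<in>F. \<forall>n\<in>F. l m (u n) = (if m = n then 1 else 0)"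
  proof (rule insert.IH)
    show "vir_linear (l n)" if "n \<in> F" for n using insert.prems that by auto
    fix c assume c: "\<forall>v. (\<Sum>n\<in>F. c n * l n v) = 0"
    have "(\<Sum>n\<in>insert k F. (c(k := 0)) n * l n v) = (\<Sum>n\<in>F. c n * l n v)" for v
      using insert.hyps by (simp, intro sum.cong) auto
    then have "\<forall>n\<in>insert k F. (c(k := 0)) n = 0" using insert.prems(2)[of "c(k := 0)"] c by presburger
    then show "\<forall>n\<in>F. c n = 0" using insert.hyps by (metis fun_upd_other insertI2)
  qed
  then obtain u where u: "\<And>m n. m \<in> F \<Longrightarrow> n \<in> F \<Longrightarrow> l m (u n) = (if m = n then 1 else 0)" by blast
  have "\<exists>v. (\<Sum>n\<in>insert k F. (if n = k then 1 else - l k (u n)) * l n v) \<noteq> 0"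
  proof (rule ccontr)
    assume "\<not> ?thesis"
    then have "\<forall>n\<in>insert k F. (if n = k then 1 else - l k (u n)) = 0"
      by (intro insert.prems(2)) simp
    then show False by auto
  qed
  then obtain v where "(\<Sum>n\<in>insert k F. (if n = k then 1 else - l k (u n)) * l n v) \<noteq> 0" by blast
  moreover have "(\<Sum>n\<in>insert k F. (if n = k then 1 else - l k (u n)) * l n v) =
      l k v - (\<Sum>n\<in>F. l k (u n) * l n v)"
    using insert.hyps by (simp add: sum_negf[symmetric], intro sum.cong) auto
  ultimately have nz: "l k v - (\<Sum>n\<in>F. l k (u n) * l n v) \<noteq> 0" (is "?d \<noteq> 0") by simp
  define w where "w = v + (\<Sum>n\<in>F. vir_scale (- l n v) (u n))"
  have w: "l m w = (if m = k then ?d else 0)" if "m \<in> insert k F" for m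
  proof -
    have "l m w = l m v - (\<Sum>n\<in>F. l n v * l m (u n))"
      using that insert.hyps by (simp add: w_def lin_add lin_sum sum_negf)
    moreover have "(\<Sum>n\<in>F. l n v * l m (u n)) = l m v" if "m \<in> F"
    proof -
      have "(\<Sum>n\<in>F. l n v * l m (u n)) = (\<Sum>n\<in>F. if n = m then l n v else 0)"
        using that u by (intro sum.cong) auto
      then show ?thesis using that insert.hyps by simp
    qed
    ultimately show ?thesis using that insert.hyps by (auto simp: mult.commute)
  qed
  define u' where "u' n = (if n = k then vir_scale (inverse ?d) w
     else u n + vir_scale (- l k (u n) / ?d) w)" for n
  have "l m (u' n) = (if m = n then 1 else 0)" if "m \<in> insert k F" "n \<in> insert k F" for m n
  proof (cases "n = k")
    case True
    then show ?thesis using that nz by (simp add: u'_def lin_scale w)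
  next
    case False
    then show ?thesis using that nz u[of m n] insert.hyps
      by (auto simp: u'_def lin_scale lin_add w)
  qed
  then show ?case by blast
qed

text \<open>Modulo higher order at \<open>\<chi>\<close>, the bracket with \<open>u x\<close> is the partial derivative by \<open>x\<close> on polynomials in
  the variables \<open>F\<close>. Applying the right partial derivatives to the lowest order part of \<open>q\<close> produces
  elements of \<open>I\<close> of lower and lower order, and finally one with nonzero value at \<open>\<chi>\<close>. A bracket
  leaves the polynomials in the variables \<open>F\<close>, which is why the induction is about sums \<open>r + w\<close> with a
  remainder \<open>w\<close> of higher order.\<close>

lemma poisson_ideal_full_of_nondegenerate:
  fixes I :: "'k::field_char_0 sym_vir set"
  assumes I: "poisson_ideal I" and q: "q \<in> I" "q \<noteq> 0" "sym_vars q \<subseteq> F"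
    and u: "\<And>x y. x \<in> F \<Longrightarrow> y \<in> F \<Longrightarrow>
      sym_lift \<chi> (poisson (sym_var x) (u y)) = (if x = y then 1 else 0)"
  shows "\<not> I \<subseteq> max_ideal_at \<chi>"
proof -
  have main: "\<exists>p\<in>I. sym_lift \<chi> p \<noteq> 0"
    if "r \<in> vanishing_order \<chi> d" "r \<notin> vanishing_order \<chi> (Suc d)" "sym_vars r \<subseteq> F"
      "w \<in> vanishing_order \<chi> (Suc d)" "r + w \<in> I" for r w d
    using that
  proof (induction d arbitrary: r w)
    case 0
    then have "sym_lift \<chi> r \<noteq> 0" "sym_lift \<chi> w = 0" by auto
    with 0 show ?case by (metis sym_lift.hom_add add.right_neutral)
  next
    case (Suc d)
    then obtain x where x: "sym_pderiv x r \<notin> vanishing_order \<chi> (Suc d)" by auto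
    then have "sym_pderiv x r \<noteq> 0" using ideal_zero[OF is_ideal_vanishing_order] by metis
    then have "x \<in> F" using sym_pderiv_not_var[of x r] Suc.prems(3) by auto
    define w' where "w' = (\<Sum>y\<in>sym_vars r. sym_pderiv y r *
        (poisson (sym_var y) (u x) - (if y = x then 1 else 0))) + poisson w (u x)"
    have "poisson (r + w) (u x) =
        (\<Sum>y\<in>sym_vars r. sym_pderiv y r * poisson (sym_var y) (u x)) + poisson w (u x)"
      by (simp add: poisson_add_left poisson_pderiv_left[of "sym_vars r" r])
    moreover have "(\<Sum>y\<in>sym_vars r. sym_pderiv y r * (if y = x then 1 else 0)) = sym_pderiv x r"
      using sym_pderiv_not_var[of x r] by (simp add: if_distrib[of "(*) _"] sum.delta cong: if_cong)
    ultimately have "poisson (r + w) (u x) = sym_pderiv x r + w'"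
      by (simp add: w'_def right_diff_distrib sum_subtractf)
    then have "sym_pderiv x r + w' \<in> I" using I Suc.prems(5) by (metis poisson_ideal_def)
    moreover have "w' \<in> vanishing_order \<chi> (Suc d)"
      unfolding w'_def
    proof (intro ideal_add ideal_sum is_ideal_vanishing_order vanishing_order_mult_point)
      fix y assume "y \<in> sym_vars r"
      then show "sym_lift \<chi> (poisson (sym_var y) (u x) - (if y = x then 1 else 0)) = 0"
        using u[of y x] Suc.prems(3) \<open>x \<in> F\<close> by (auto simp: sym_lift.hom_minus)
      show "sym_pderiv y r \<in> vanishing_order \<chi> d" using Suc.prems(1) by simp
    next
      show "poisson w (u x) \<in> vanishing_order \<chi> (Suc d)"
        using Suc.prems(4) by (rule poisson_vanishing_order)
    qed
    moreover have "sym_pderiv x r \<in> vanishing_order \<chi> d" using Suc.prems(1) by simp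
    moreover have "sym_vars (sym_pderiv x r) \<subseteq> F"
      using sym_vars_pderiv[of x r] Suc.prems(3) by blast
    ultimately show ?case using Suc.IH[of "sym_pderiv x r" w'] x by blast
  qed
  obtain d where "q \<in> vanishing_order \<chi> d" "q \<notin> vanishing_order \<chi> (Suc d)"
    by (rule exact_vanishing_order[OF q(2)])
  then have "\<exists>p\<in>I. sym_lift \<chi> p \<noteq> 0"
    using main[of q d 0] q ideal_zero[OF is_ideal_vanishing_order] by auto
  then show ?thesis by (auto simp: max_ideal_at_def)
qed

text \<open>The vector field \<open>f \<partial>\<close> annihilates \<open>\<chi>\<close> in the coadjoint representation.\<close>

definition stabilises :: "'k::comm_ring_1 laurent \<Rightarrow> ('k vir \<Rightarrow> 'k) \<Rightarrow> bool" where
  "stabilises f \<chi> \<longleftrightarrow> (\<forall>v. \<chi> (vir_bracket (f, 0) v) = 0)"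

text \<open>If no such \<open>f\<close> existed, the functionals \<open>v \<mapsto> \<chi> [t^n \<partial>, v]\<close> with \<open>n \<in> F\<close> would be linearly
  independent, and a system dual to them would make the tangent space of the orbit of \<open>\<chi>\<close> surject
  onto the coordinates \<open>F\<close>.\<close>

theorem exists_stabiliser:
  fixes I :: "'k::field_char_0 sym_vir set"
  assumes I: "poisson_ideal I" "I \<subseteq> max_ideal_at \<chi>" and \<chi>: "vir_linear \<chi>"
    and q: "q \<in> I" "q \<noteq> 0" "sym_vars q \<subseteq> Del ` F" and F: "finite F"
  obtains f where "f \<noteq> 0" "Poly_Mapping.keys f \<subseteq> F" "stabilises f \<chi>"
proof (rule ccontr)
  assume none: "\<not> thesis"
  define l where "l n v = \<chi> (vir_bracket (vir_basis (Del n)) v)" for n v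
  have "\<exists>u. \<forall>m\<in>F. \<forall>n\<in>F. l m (u n) = (if m = n then 1 else 0)"
  proof (rule dual_vectors[OF F])
    show "vir_linear (l n)" for n unfolding l_def by (rule vir_linear_bracket[OF \<chi>])
    fix c assume c: "\<forall>v. (\<Sum>n\<in>F. c n * l n v) = 0"
    define f where "f = (\<Sum>n\<in>F. Poly_Mapping.single n (c n))"
    have f: "Poly_Mapping.lookup f n = (if n \<in> F then c n else 0)" for n
      unfolding f_def lookup_sum using F
      by (simp add: lookup_single when_def)
    have "(f, 0) = (\<Sum>n\<in>F. vir_scale (c n) (vir_basis (Del n)))"
      by (simp add: f_def vir_scale_def mult_single prod_eq_iff fst_sum snd_sum)
    then have "\<chi> (vir_bracket (f, 0) v) = (\<Sum>n\<in>F. c n * l n v)" for v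
      using vir_linear_sum[OF vir_linear_bracket(2)[OF \<chi>] F] by (simp add: l_def)
    then have "stabilises f \<chi>" using c by (simp add: stabilises_def)
    moreover have "Poly_Mapping.keys f \<subseteq> F" by (auto simp: in_keys_iff f split: if_splits)
    ultimately have "f = 0" using none that by blast
    then show "\<forall>n\<in>F. c n = 0" using f by (metis lookup_zero)
  qed
  then obtain u where u: "\<And>m n. m \<in> F \<Longrightarrow> n \<in> F \<Longrightarrow> l m (u n) = (if m = n then 1 else 0)" by blast
  have "\<not> I \<subseteq> max_ideal_at \<chi>"
  proof (rule poisson_ideal_full_of_nondegenerate[OF I(1) q])
    fix x y assume "x \<in> Del ` F" "y \<in> Del ` F"
    then obtain m n where "x = Del m" "y = Del n" "m \<in> F" "n \<in> F" by auto
    then show "sym_lift \<chi> (poisson (sym_var x) (sym_incl (u (case y of Del n \<Rightarrow> n | Cen \<Rightarrow> 0)))) =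
        (if x = y then 1 else 0)"
      using u[of m n] by (simp add: sym_incl_basis[symmetric] poisson_incl sym_lift_incl[OF \<chi>] l_def
          del: vir_basis.simps)
  qed
  with I(2) show False by blast
qed

section \<open>Laurent polynomials\<close>

lemma laurent_deriv_mult:
  "laurent_deriv (f * g) = laurent_deriv f * g + f * laurent_deriv (g :: 'k::comm_ring_1 laurent)"
proof (induction f rule: pm_induct)
  case zero
  then show ?case by simp
next
  case (add f m a)
  have "laurent_deriv (Poly_Mapping.single m a * g) =
      laurent_deriv (Poly_Mapping.single m a) * g + Poly_Mapping.single m a * laurent_deriv g"
  proof (induction g rule: pm_induct)
    case zero
    then show ?case by simp
  next
    case (add g n b)
    have "laurent_deriv (Poly_Mapping.single m a * Poly_Mapping.single n b) =
        laurent_deriv (Poly_Mapping.single m a) * Poly_Mapping.single n b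
          + Poly_Mapping.single m a * laurent_deriv (Poly_Mapping.single n b)"
      by (simp add: mult_single laurent_deriv_single single_add[symmetric] algebra_simps)
    with add show ?case by (simp add: laurent_deriv_add distrib_left distrib_right)
  qed
  with add show ?case by (simp add: laurent_deriv_add distrib_left distrib_right)
qed

lemma laurent_res_deriv: "laurent_res (laurent_deriv f) = 0"
  by (simp add: laurent_res_def lookup_laurent_deriv)

lemma laurent_antiderivative:
  fixes g :: "'k::field_char_0 laurent"
  obtains h where "g = Poly_Mapping.single (-1) (laurent_res g) + laurent_deriv h"
proof -
  have "\<exists>h. g = Poly_Mapping.single (-1) (laurent_res g) + laurent_deriv h"
  proof (induction g rule: pm_induct)
    case zero
    show ?case by (rule exI[of _ 0]) simp
  next
    case (add g n a)
    then obtain h where h: "g = Poly_Mapping.single (-1) (laurent_res g) + laurent_deriv h" by blast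
    define e where "e = (if n = -1 then 0 else Poly_Mapping.single (n + 1) (a / of_int (n + 1)))"
    have "(of_int (n + 1) :: 'k) \<noteq> 0" if "n \<noteq> -1"
      using that by (subst of_int_eq_0_iff) auto
    then have e: "Poly_Mapping.single n a =
        Poly_Mapping.single (-1) (laurent_res (Poly_Mapping.single n a)) + laurent_deriv e"
      by (auto simp: e_def laurent_res_def laurent_deriv_single lookup_single when_def)
    have eq: "g + Poly_Mapping.single n a =
        (Poly_Mapping.single (-1) (laurent_res g) + laurent_deriv h) +
        (Poly_Mapping.single (-1) (laurent_res (Poly_Mapping.single n a)) + laurent_deriv e)"
      using h e by metis
    show ?case
      unfolding laurent_res_add single_add
      by (rule exI[of _ "h + e"], rule trans[OF eq]) (simp only: laurent_deriv_add add_ac)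
  qed
  with that show ?thesis by blast
qed

text \<open>The residue pairing is nondegenerate: multiplication by \<open>t^(-1-n)\<close> extracts the coefficient of
  \<open>t^n\<close>.\<close>

lemma laurent_eqI_res:
  fixes f :: "'k::comm_ring_1 laurent"
  assumes "\<And>h. laurent_res (f * h) = laurent_res (g * h)"
  shows "f = g"
proof (rule poly_mapping_eqI)
  have "laurent_res (f * Poly_Mapping.single (- 1 - n) 1) = Poly_Mapping.lookup f n"
    for f :: "'k laurent" and n
  proof (induction f rule: pm_induct)
    case (add f m a)
    have "laurent_res (Poly_Mapping.single m a * Poly_Mapping.single (- 1 - n) 1) =
        Poly_Mapping.lookup (Poly_Mapping.single m a) n"
      by (auto simp: laurent_res_def mult_single lookup_single when_def)
    with add show ?case by (simp add: distrib_right laurent_res_add lookup_add)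
  qed simp
  then show "Poly_Mapping.lookup f n = Poly_Mapping.lookup g n" for n using assms by metis
qed

lemma lookup_single_mult:
  "Poly_Mapping.lookup (Poly_Mapping.single m 1 * f) n = Poly_Mapping.lookup f (n - m)"
  for f :: "'k::comm_ring_1 laurent"
proof (induction f rule: pm_induct)
  case (add f k a)
  have "Poly_Mapping.lookup (Poly_Mapping.single m 1 * Poly_Mapping.single k a) n =
      Poly_Mapping.lookup (Poly_Mapping.single k a) (n - m)"
    by (auto simp: mult_single lookup_single when_def)
  with add show ?case by (simp add: distrib_left lookup_add)
qed simp

text \<open>Stabilising fields far out have only positive exponents. Treating them as elements of \<open>'k poly\<close>
  makes degrees, derivatives and factorisation available.\<close>

definition laurent_of_poly :: "'k::comm_ring_1 poly \<Rightarrow> 'k laurent" where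
  "laurent_of_poly p = (\<Sum>i\<le>degree p. Poly_Mapping.single (int i) (coeff p i))"

lemma lookup_laurent_of_poly:
  "Poly_Mapping.lookup (laurent_of_poly p) n = (if n \<ge> 0 then coeff p (nat n) else 0)"
proof -
  have "Poly_Mapping.lookup (laurent_of_poly p) n =
      (\<Sum>i\<le>degree p. if i = nat n then (if n \<ge> 0 then coeff p i else 0) else 0)"
    unfolding laurent_of_poly_def lookup_sum
    by (intro sum.cong) (auto simp: lookup_single when_def)
  then show ?thesis by (simp add: coeff_eq_0)
qed

lemma laurent_of_poly_0 [simp]: "laurent_of_poly 0 = 0"
  by (simp add: laurent_of_poly_def)

lemma laurent_of_poly_add: "laurent_of_poly (p + q) = laurent_of_poly p + laurent_of_poly q"
  by (intro poly_mapping_eqI) (simp add: lookup_laurent_of_poly lookup_add)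

lemma laurent_of_poly_smult:
  "laurent_of_poly (Polynomial.smult c p) = Poly_Mapping.single 0 c * laurent_of_poly p"
  by (intro poly_mapping_eqI) (simp add: lookup_laurent_of_poly lookup_const_mult)

lemma laurent_of_poly_monom: "laurent_of_poly (Polynomial.monom c n) = Poly_Mapping.single (int n) c"
  by (intro poly_mapping_eqI) (auto simp: lookup_laurent_of_poly lookup_single when_def)

lemma laurent_of_poly_const: "laurent_of_poly [:c:] = Poly_Mapping.single 0 c"
  using laurent_of_poly_monom[of c 0] by (simp add: monom_0)

lemma laurent_of_poly_pCons:
  "laurent_of_poly (pCons c p) = Poly_Mapping.single 0 c + Poly_Mapping.single 1 1 * laurent_of_poly p"
proof -
  have "laurent_of_poly (pCons 0 p) = Poly_Mapping.single 1 1 * laurent_of_poly p"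
    by (intro poly_mapping_eqI)
      (auto simp: lookup_laurent_of_poly lookup_single_mult coeff_pCons nat_diff_distrib split: nat.splits)
  then show ?thesis
    using laurent_of_poly_add[of "[:c:]" "pCons 0 p"] by (simp add: laurent_of_poly_const)
qed

lemma laurent_of_poly_mult: "laurent_of_poly (p * q) = laurent_of_poly p * laurent_of_poly q"
proof (induction p)
  case (pCons a p)
  have "laurent_of_poly (pCons a p * q) =
      Poly_Mapping.single 0 a * laurent_of_poly q
      + Poly_Mapping.single 1 1 * (laurent_of_poly p * laurent_of_poly q)"
    using laurent_of_poly_pCons[of 0 "p * q"]
    by (simp add: laurent_of_poly_add laurent_of_poly_smult pCons)
  then show ?case by (simp add: laurent_of_poly_pCons[of a p] distrib_right mult.assoc)
qed simp

lemma comm_ring_hom_laurent_of_poly: "comm_ring_hom laurent_of_poly"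
  by unfold_locales (auto simp: laurent_of_poly_add laurent_of_poly_mult
      laurent_of_poly_const[of 1, folded one_pCons])

interpretation laurent_of_poly: comm_ring_hom laurent_of_poly
  by (rule comm_ring_hom_laurent_of_poly)

lemma laurent_of_poly_inject [simp]: "laurent_of_poly p = laurent_of_poly q \<longleftrightarrow> p = q"
proof
  assume eq: "laurent_of_poly p = laurent_of_poly q"
  show "p = q"
  proof (rule poly_eqI)
    fix n show "coeff p n = coeff q n"
      using arg_cong[OF eq, of "\<lambda>f. Poly_Mapping.lookup f (int n)"] by (simp add: lookup_laurent_of_poly)
  qed
qed auto

lemma laurent_deriv_of_poly: "laurent_deriv (laurent_of_poly p) = laurent_of_poly (pderiv p)"
proof (rule poly_mapping_eqI)
  fix n :: int
  consider "n \<ge> 0" | "n = -1" | "n < -1" by linarith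
  then show "Poly_Mapping.lookup (laurent_deriv (laurent_of_poly p)) n =
      Poly_Mapping.lookup (laurent_of_poly (pderiv p)) n"
  proof cases
    case 1
    then have "n + 1 = int (Suc (nat n))" by simp
    with 1 show ?thesis
      unfolding lookup_laurent_deriv lookup_laurent_of_poly coeff_pderiv
      by (metis nat_int of_int_of_nat_eq of_nat_0_le_iff)
  qed (simp_all add: lookup_laurent_deriv lookup_laurent_of_poly)
qed

lemma exists_laurent_of_poly:
  assumes "Poly_Mapping.keys f \<subseteq> {0..}"
  obtains p where "f = laurent_of_poly p"
proof
  have "Poly_Mapping.lookup (\<Sum>n\<in>Poly_Mapping.keys f.
      Poly_Mapping.single n (Poly_Mapping.lookup f n)) m = Poly_Mapping.lookup f m" for m
    by (simp add: lookup_sum lookup_single when_def in_keys_iff)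
  then have "f = (\<Sum>n\<in>Poly_Mapping.keys f. Poly_Mapping.single n (Poly_Mapping.lookup f n))"
    by (intro poly_mapping_eqI) simp
  also have "\<dots> = laurent_of_poly
      (\<Sum>n\<in>Poly_Mapping.keys f. Polynomial.monom (Poly_Mapping.lookup f n) (nat n))"
    unfolding laurent_of_poly.hom_sum using assms
    by (intro sum.cong) (auto simp: laurent_of_poly_monom)
  finally show "f = \<dots>" .
qed

section \<open>Stabilisers and differential equations\<close>

text \<open>If \<open>\<chi>\<close> is the residue pairing with \<open>u\<close> and \<open>\<zeta> = \<chi>(z)\<close>, then \<open>f \<partial>\<close> stabilises \<open>\<chi>\<close> exactly when
  \<open>f u' + 2 f' u = 2 \<zeta> f'''\<close>. Multiplied by \<open>f\<close>, this equation becomes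
  \<open>(f\<^sup>2 u)' = \<zeta> (2 f f'' - f'\<^sup>2)'\<close>.\<close>

definition hill :: "'k::comm_ring_1 laurent \<Rightarrow> 'k laurent" where
  "hill f = 2 * f * laurent_deriv (laurent_deriv f) - laurent_deriv f * laurent_deriv f"

text \<open>The weak form of the integrated equation: test the stabiliser condition on the field \<open>f h \<partial>\<close>.\<close>

lemma stabiliser_derivative:
  assumes \<chi>: "vir_linear \<chi>" and f: "stabilises f \<chi>"
  shows "\<chi> (f * f * laurent_deriv h, 0) = \<chi> (0, 1) * laurent_res (hill f * laurent_deriv h)"
proof -
  let ?D = laurent_deriv
  \<comment> \<open>The cocycle of \<open>f\<close> and \<open>f h\<close> equals \<open>- hill f h'\<close> up to the total derivative \<open>(f f' h')'\<close>.\<close>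
  have "laurent_res (?D f * ?D (?D (f * h)) - ?D (?D f) * ?D (f * h) + hill f * ?D h) =
      laurent_res (?D (f * ?D f * ?D h))"
    by (rule arg_cong[of _ _ laurent_res])
      (simp add: laurent_deriv_mult laurent_deriv_add hill_def algebra_simps)
  then have res: "laurent_res (?D f * ?D (?D (f * h)) - ?D (?D f) * ?D (f * h)) =
      - laurent_res (hill f * ?D h)"
    by (simp add: laurent_res_add laurent_res_deriv eq_neg_iff_add_eq_0)
  have "vir_bracket (f, 0) (f * h, 0) = (f * f * ?D h, - laurent_res (hill f * ?D h))"
    using res by (simp add: vir_bracket_def Let_def laurent_deriv_mult algebra_simps)
  also have "\<dots> = (f * f * ?D h, 0) + vir_scale (- laurent_res (hill f * ?D h)) (0, 1)"
    by (simp add: vir_scale_def)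
  finally have "0 = \<chi> (f * f * ?D h, 0) + (- laurent_res (hill f * ?D h)) * \<chi> (0, 1)"
    using f unfolding stabilises_def by (metis vir_linear_add[OF \<chi>] vir_linear_scale[OF \<chi>])
  then show ?thesis by (simp add: algebra_simps)
qed

text \<open>A functional that kills all derivatives is a multiple of the residue; \<open>c\<close> is the constant of
  integration, read off at \<open>t^(-1)\<close>.\<close>

lemma stabiliser_square:
  fixes \<chi> :: "'k::field_char_0 vir \<Rightarrow> 'k"
  assumes \<chi>: "vir_linear \<chi>" and f: "stabilises f \<chi>"
  obtains c where "\<And>g. \<chi> (f * f * g, 0) = laurent_res
    ((Poly_Mapping.single 0 (\<chi> (0, 1)) * hill f + Poly_Mapping.single 0 c) * g)"
proof
  let ?T = "Poly_Mapping.single (-1) 1"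
  define c where "c = \<chi> (f * f * ?T, 0) - \<chi> (0, 1) * laurent_res (hill f * ?T)"
  fix g :: "'k laurent"
  obtain h where h: "g = Poly_Mapping.single (-1) (laurent_res g) + laurent_deriv h"
    by (rule laurent_antiderivative[of g])
  define r where "r = laurent_res g"
  have g: "g = Poly_Mapping.single 0 r * ?T + laurent_deriv h"
    using h by (simp add: r_def mult_single)
  have "(f * f * g, 0) = vir_scale r (f * f * ?T, 0) + (f * f * laurent_deriv h, 0)"
    unfolding g by (simp add: vir_scale_def algebra_simps)
  then have "\<chi> (f * f * g, 0) = r * \<chi> (f * f * ?T, 0) + \<chi> (f * f * laurent_deriv h, 0)"
    by (simp only: vir_linear_add[OF \<chi>] vir_linear_scale[OF \<chi>])
  also have "\<dots> = r * \<chi> (f * f * ?T, 0) + \<chi> (0, 1) * laurent_res (hill f * laurent_deriv h)"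
    by (simp add: stabiliser_derivative[OF assms])
  also have "laurent_res (hill f * laurent_deriv h) =
      laurent_res (hill f * g) - r * laurent_res (hill f * ?T)"
  proof -
    have "hill f * laurent_deriv h = hill f * g - Poly_Mapping.single 0 r * (hill f * ?T)"
      using g by (simp add: algebra_simps)
    then show ?thesis by (simp only: laurent_res_diff laurent_res_scale)
  qed
  finally have "\<chi> (f * f * g, 0) = \<chi> (0, 1) * laurent_res (hill f * g) + c * laurent_res g"
    by (simp add: c_def r_def algebra_simps)
  then show "\<chi> (f * f * g, 0) = laurent_res
    ((Poly_Mapping.single 0 (\<chi> (0, 1)) * hill f + Poly_Mapping.single 0 c) * g)"
    by (simp only: distrib_right mult.assoc laurent_res_add laurent_res_scale)
qed

lemma coeff_mult_top:
  assumes "degree p \<le> m" "degree q \<le> n"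
  shows "coeff (p * q) (m + n) = coeff p m * coeff q n"
proof -
  have "coeff p i * coeff q (m + n - i) = 0" if "i \<noteq> m" "i \<le> m + n" for i
    using that assms by (cases "i < m") (auto simp: coeff_eq_0)
  then have "coeff (p * q) (m + n) = (\<Sum>i\<le>m + n. if i = m then coeff p m * coeff q n else 0)"
    unfolding coeff_mult by (intro sum.cong) auto
  then show ?thesis by simp
qed

text \<open>Evaluate \<open>p\<^sup>2 q\<^sup>2 \<chi>\<close> by \<open>stabiliser_square\<close> for \<open>p\<close> and for \<open>q\<close>. For a polynomial of degree \<open>n\<close>
  the leading coefficient of \<open>2 f f'' - f'\<^sup>2\<close> is \<open>n (n - 2)\<close> times the square of the leading coefficient
  of \<open>f\<close>. This number increases strictly for \<open>n \<ge> 2\<close>, which forces \<open>\<zeta> = 0\<close>. The remaining equation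
  \<open>c q\<^sup>2 = d p\<^sup>2\<close> has sides of different degree, so \<open>c = 0\<close>.\<close>

lemma two_stabilisers:
  fixes \<chi> :: "'k::field_char_0 vir \<Rightarrow> 'k"
  assumes \<chi>: "vir_linear \<chi>"
    and stab: "stabilises (laurent_of_poly p) \<chi>" "stabilises (laurent_of_poly q) \<chi>"
    and deg: "2 \<le> degree p" "degree p < degree q"
  shows "\<chi> (0, 1) = 0" "\<chi> (laurent_of_poly (p * p) * g, 0) = 0"
proof -
  let ?L = "laurent_of_poly :: 'k poly \<Rightarrow> 'k laurent"
  define \<zeta> where "\<zeta> = \<chi> (0, 1)"
  define h where "h p = 2 * p * pderiv (pderiv p) - pderiv p * pderiv p" for p :: "'k poly"
  have hill: "hill (?L p) = ?L (h p)" for p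
    by (simp add: hill_def h_def laurent_deriv_of_poly laurent_of_poly.hom_minus laurent_of_poly.hom_mult
        laurent_of_poly.hom_numeral)
  obtain c where c: "\<And>g. \<chi> (?L p * ?L p * g, 0) = laurent_res (?L (Polynomial.smult \<zeta> (h p) + [:c:]) * g)"
    using stabiliser_square[OF \<chi> stab(1)] unfolding hill
    by (auto simp: \<zeta>_def laurent_of_poly_add laurent_of_poly_smult laurent_of_poly_const)
  obtain d where d: "\<And>g. \<chi> (?L q * ?L q * g, 0) = laurent_res (?L (Polynomial.smult \<zeta> (h q) + [:d:]) * g)"
    using stabiliser_square[OF \<chi> stab(2)] unfolding hill
    by (auto simp: \<zeta>_def laurent_of_poly_add laurent_of_poly_smult laurent_of_poly_const)
  have "?L ((Polynomial.smult \<zeta> (h p) + [:c:]) * (q * q)) = ?L ((Polynomial.smult \<zeta> (h q) + [:d:]) * (p * p))"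
    unfolding laurent_of_poly_mult
  proof (rule laurent_eqI_res)
    fix g
    have "?L p * ?L p * (?L q * ?L q * g) = ?L q * ?L q * (?L p * ?L p * g)"
      by (simp add: mult_ac)
    have "laurent_res (?L (Polynomial.smult \<zeta> (h p) + [:c:]) * (?L q * ?L q) * g) =
        \<chi> (?L p * ?L p * (?L q * ?L q * g), 0)"
      using c[of "?L q * ?L q * g"] by (simp only: mult.assoc)
    also have "\<dots> = \<chi> (?L q * ?L q * (?L p * ?L p * g), 0)"
      by (simp only: \<open>?L p * ?L p * (?L q * ?L q * g) = ?L q * ?L q * (?L p * ?L p * g)\<close>)
    also have "\<dots> = laurent_res (?L (Polynomial.smult \<zeta> (h q) + [:d:]) * (?L p * ?L p) * g)"
      using d[of "?L p * ?L p * g"] by (simp only: mult.assoc)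
    finally show "laurent_res (?L (Polynomial.smult \<zeta> (h p) + [:c:]) * (?L q * ?L q) * g) =
        laurent_res (?L (Polynomial.smult \<zeta> (h q) + [:d:]) * (?L p * ?L p) * g)" .
  qed
  then have eq: "(Polynomial.smult \<zeta> (h p) + [:c:]) * (q * q) = (Polynomial.smult \<zeta> (h q) + [:d:]) * (p * p)"
    by simp
  define a where "a = degree p - 2"
  define b where "b = degree q - 2"
  have ab: "degree p = a + 2" "degree q = b + 2" "a < b" using deg by (auto simp: a_def b_def)
  have deg_h: "degree (h r) \<le> n + n + 2"
    and coeff_h: "coeff (h r) (n + n + 2) = lead_coeff r * lead_coeff r * of_nat ((n + 2) * n)"
    if r: "degree r = n + 2" for r n
  proof -
    have d1: "degree (pderiv r) = n + 1" "degree (pderiv (pderiv r)) = n"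
      using r by (simp_all add: degree_pderiv)
    have "degree (2 * r * pderiv (pderiv r)) \<le> (n + 2) + n"
      using degree_mult_le[of "2 * r" "pderiv (pderiv r)"] degree_mult_le[of 2 r] r d1
      by simp
    moreover have "degree (pderiv r * pderiv r) \<le> (n + 1) + (n + 1)"
      using degree_mult_le[of "pderiv r" "pderiv r"] d1 by simp
    ultimately show "degree (h r) \<le> n + n + 2"
      unfolding h_def by (intro degree_diff_le) auto
    have "coeff (2 * (r * pderiv (pderiv r))) ((n + 2) + n) =
        2 * (coeff r (n + 2) * coeff (pderiv (pderiv r)) n)"
      using coeff_mult_top[of r "n + 2" "pderiv (pderiv r)" n] r d1
      by (simp add: numeral_poly)
    moreover have "coeff (pderiv r * pderiv r) ((n + 1) + (n + 1)) =
        coeff (pderiv r) (n + 1) * coeff (pderiv r) (n + 1)"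
      using d1 by (intro coeff_mult_top) auto
    ultimately show "coeff (h r) (n + n + 2) = lead_coeff r * lead_coeff r * of_nat ((n + 2) * n)"
      by (simp add: h_def coeff_pderiv r mult.assoc algebra_simps)
  qed
  have "coeff ((Polynomial.smult \<zeta> (h p) + [:c:]) * (q * q)) ((a + a + 2) + ((b + 2) + (b + 2))) =
      coeff (Polynomial.smult \<zeta> (h p) + [:c:]) (a + a + 2) * (lead_coeff q * lead_coeff q)"
    using deg_h[OF ab(1)] ab degree_mult_le[of q q] coeff_mult_top[of q "b + 2" q "b + 2"]
    by (subst coeff_mult_top) (auto intro!: degree_add_le intro: order_trans[OF degree_smult_le])
  moreover have "coeff ((Polynomial.smult \<zeta> (h q) + [:d:]) * (p * p)) ((b + b + 2) + ((a + 2) + (a + 2))) =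
      coeff (Polynomial.smult \<zeta> (h q) + [:d:]) (b + b + 2) * (lead_coeff p * lead_coeff p)"
    using deg_h[OF ab(2)] ab degree_mult_le[of p p] coeff_mult_top[of p "a + 2" p "a + 2"]
    by (subst coeff_mult_top) (auto intro!: degree_add_le intro: order_trans[OF degree_smult_le])
  moreover have "(a + a + 2) + ((b + 2) + (b + 2)) = (b + b + 2) + ((a + 2) + (a + 2))" by simp
  ultimately have "coeff (Polynomial.smult \<zeta> (h p) + [:c:]) (a + a + 2) * (lead_coeff q * lead_coeff q) =
      coeff (Polynomial.smult \<zeta> (h q) + [:d:]) (b + b + 2) * (lead_coeff p * lead_coeff p)"
    using eq by metis
  then have "\<zeta> * of_nat ((a + 2) * a) * (lead_coeff p * lead_coeff p * lead_coeff q * lead_coeff q) =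
      \<zeta> * of_nat ((b + 2) * b) * (lead_coeff p * lead_coeff p * lead_coeff q * lead_coeff q)"
    using coeff_h[OF ab(1)] coeff_h[OF ab(2)] by (simp add: mult_ac)
  moreover have lead: "lead_coeff p \<noteq> 0" "lead_coeff q \<noteq> 0" using deg by auto
  then have "lead_coeff p * lead_coeff p * lead_coeff q * lead_coeff q \<noteq> 0" by simp
  ultimately have "\<zeta> * of_nat ((a + 2) * a) = \<zeta> * of_nat ((b + 2) * b)" by simp
  moreover have "(a + 2) * a < (b + 2) * b" using ab by (intro mult_strict_mono) auto
  then have "of_nat ((a + 2) * a) \<noteq> (of_nat ((b + 2) * b) :: 'k)" unfolding of_nat_eq_iff by simp
  ultimately have "\<zeta> = 0" by auto
  then show "\<chi> (0, 1) = 0" by (simp add: \<zeta>_def)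
  have "coeff (Polynomial.smult c (q * q)) ((b + 2) + (b + 2)) = coeff (Polynomial.smult d (p * p)) ((b + 2) + (b + 2))"
    using eq \<open>\<zeta> = 0\<close> by simp
  then have "c * (lead_coeff q * lead_coeff q) = 0"
    using ab coeff_mult_top[of q "b + 2" q "b + 2"] coeff_mult_top[of p "b + 2" p "b + 2"]
    by (simp add: coeff_eq_0)
  then have "c = 0" using lead by auto
  then show "\<chi> (laurent_of_poly (p * p) * g, 0) = 0"
    using c[of g] \<open>\<zeta> = 0\<close> by (simp add: laurent_of_poly_mult)
qed

section \<open>Relations in far away variables\<close>

lemma sym_vars_0 [simp]: "sym_vars 0 = {}"
  by (simp add: sym_vars_def)

lemma sym_vars_const [simp]: "sym_vars (sym_const c) = {}"
  by (auto simp: sym_vars_def sym_const_def)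

lemma sym_vars_1 [simp]: "sym_vars (1 :: 'k::zero_neq_one sym_vir) = {}"
  by (simp add: sym_vars_def)

lemma sym_vars_var: "sym_vars (sym_var x) \<subseteq> {x}"
  by (auto simp: sym_vars_def sym_var_def)

lemma sym_vars_add: "sym_vars (p + q) \<subseteq> sym_vars p \<union> sym_vars q"
  unfolding sym_vars_def using keys_add[of p q] by blast

lemma sym_vars_mult: "sym_vars (p * q) \<subseteq> sym_vars p \<union> sym_vars q"
proof
  fix x assume "x \<in> sym_vars (p * q)"
  then obtain m where "m \<in> Poly_Mapping.keys (p * q)" "x \<in> Poly_Mapping.keys m"
    by (auto simp: sym_vars_def)
  moreover from this obtain a b where
    "m = a + b" "a \<in> Poly_Mapping.keys p" "b \<in> Poly_Mapping.keys q"
    using keys_mult[of p q] by blast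
  ultimately show "x \<in> sym_vars p \<union> sym_vars q"
    using keys_add[of a b] by (auto simp: sym_vars_def)
qed

lemma sym_vars_sum: "(\<And>a. a \<in> A \<Longrightarrow> sym_vars (f a) \<subseteq> X) \<Longrightarrow> sym_vars (sum f A) \<subseteq> X"
proof (induction A rule: infinite_finite_induct)
  case (insert a A)
  then show ?case using sym_vars_add[of "f a" "sum f A"] by fastforce
qed auto

lemma sym_vars_prod: "(\<And>a. a \<in> A \<Longrightarrow> sym_vars (f a) \<subseteq> X) \<Longrightarrow> sym_vars (prod f A) \<subseteq> X"
proof (induction A rule: infinite_finite_induct)
  case (insert a A)
  then show ?case using sym_vars_mult[of "f a" "prod f A"] by fastforce
qed auto

lemma sym_vars_power: "sym_vars (p ^ k) \<subseteq> sym_vars p"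
proof (induction k)
  case (Suc k)
  then show ?case using sym_vars_mult[of p "p ^ k"] by auto
qed simp

text \<open>Consecutive rows are shifted by \<open>N\<close>, so all entries are different variables and the determinant is
  the generic one.\<close>

definition window_matrix :: "int \<Rightarrow> nat \<Rightarrow> 'k::comm_ring_1 sym_vir mat" where
  "window_matrix M N = mat N N (\<lambda>(i, j). sym_var (Del (M + int (i * N + j))))"

lemma sym_vars_det_window: "sym_vars (det (window_matrix M N)) \<subseteq> Del ` {M..<M + int (N * N)}"
proof -
  let ?X = "Del ` {M..<M + int (N * N)}"
  have entry: "sym_vars (window_matrix M N $$ (i, j) :: 'a sym_vir) \<subseteq> ?X" if "i < N" "j < N" for i j
  proof -
    have "i * N + j < (i + 1) * N" using that by simp
    also have "\<dots> \<le> N * N" using that by (intro mult_right_mono) auto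
    finally have "M + int (i * N + j) \<in> {M..<M + int (N * N)}" by (simp del: of_nat_mult of_nat_add)
    then show ?thesis
      using sym_vars_var[of "Del (M + int (i * N + j))"] that by (auto simp: window_matrix_def)
  qed
  have carrier: "window_matrix M N \<in> carrier_mat N N" by (simp add: window_matrix_def)
  have sign: "sym_vars (signof p :: 'a sym_vir) \<subseteq> ?X" for p :: "nat \<Rightarrow> nat"
  proof -
    have "(signof p :: 'a sym_vir) = sym_const (signof p)"
      by (simp add: sign_def sym_const.hom_uminus)
    then show ?thesis by (metis sym_vars_const empty_subsetI)
  qed
  show ?thesis
    unfolding det_def'[OF carrier]
  proof (intro sym_vars_sum)
    fix p assume "p \<in> {p. p permutes {0..<N}}"
    then have "sym_vars (\<Prod>i = 0..<N. window_matrix M N $$ (i, p i) :: 'a sym_vir) \<subseteq> ?X"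
      by (intro sym_vars_prod entry) (auto dest: permutes_in_image)
    then show "sym_vars (signof p * (\<Prod>i = 0..<N. window_matrix M N $$ (i, p i)) :: 'a sym_vir) \<subseteq> ?X"
      using sym_vars_mult[of "signof p :: 'a sym_vir" "\<Prod>i = 0..<N. window_matrix M N $$ (i, p i)"]
        sign[of p] by blast
  qed
qed

text \<open>Specialise the variables so that the matrix becomes the identity.\<close>

lemma det_window_power_nonzero: "det (window_matrix M N) ^ k \<noteq> (0 :: 'k::comm_ring_1 sym_vir)"
proof
  define \<phi> :: "vir_index \<Rightarrow> 'k" where
    "\<phi> x = (if \<exists>i<N. x = Del (M + int (i * N + i)) then 1 else 0)" for x
  have "comm_ring_hom (id :: 'k \<Rightarrow> 'k)" by unfold_locales auto
  then interpret h: comm_ring_hom "sym_hom id \<phi>" by (rule comm_ring_hom_sym_hom)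
  have "\<phi> (Del (M + int (i * N + j))) = (if i = j then 1 else 0)" if "i < N" "j < N" for i j
  proof -
    have "i = l \<and> j = l" if "i * N + j = l * N + l" "l < N" for l
      using arg_cong[OF that(1), of "\<lambda>x. x div N"] arg_cong[OF that(1), of "\<lambda>x. x mod N"]
        that(2) \<open>j < N\<close> by auto
    then show ?thesis using that by (auto simp: \<phi>_def simp del: of_nat_mult of_nat_add)
  qed
  then have "map_mat (sym_hom id \<phi>) (window_matrix M N) = 1\<^sub>m N"
    by (intro eq_matI) (auto simp: window_matrix_def sym_hom_var simp del: of_nat_mult of_nat_add)
  then have "sym_hom id \<phi> (det (window_matrix M N)) = 1"
    by (metis h.hom_det det_one)
  moreover assume "det (window_matrix M N) ^ k = (0 :: 'k sym_vir)"
  ultimately show False by (metis h.hom_power h.hom_zero power_one zero_neq_one)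
qed

lemma keys_mult_bound:
  fixes f g :: "'k::comm_ring_1 laurent"
  assumes "Poly_Mapping.keys f \<subseteq> {-a..b}" "Poly_Mapping.keys g \<subseteq> {-c..d}"
  shows "Poly_Mapping.keys (f * g) \<subseteq> {-(a + c)..b + d}"
  using keys_mult[of f g] assms by fastforce

lemma keys_deriv_bound:
  assumes "Poly_Mapping.keys f \<subseteq> {-a..b}"
  shows "Poly_Mapping.keys (laurent_deriv f) \<subseteq> {-(a + 1)..b}"
proof
  fix n assume "n \<in> Poly_Mapping.keys (laurent_deriv f)"
  then have "n + 1 \<in> Poly_Mapping.keys f"
    by (auto simp: in_keys_iff lookup_laurent_deriv)
  then show "n \<in> {-(a + 1)..b}" using assms by auto
qed

text \<open>The Laurent polynomial in \<open>stabiliser_square\<close> has its exponents between \<open>- 2 B - 2\<close> and \<open>2 B\<close>, so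
  its residue pairing with \<open>t^n\<close> vanishes for larger \<open>n\<close>.\<close>

lemma stabilised_recurrence:
  fixes \<chi> :: "'k::field_char_0 vir \<Rightarrow> 'k"
  assumes \<chi>: "vir_linear \<chi>" and f: "stabilises f \<chi>"
    and keys: "Poly_Mapping.keys f \<subseteq> {- int B..int B}" and n: "n > 2 * int B + 1"
  shows "\<chi> (f * f * Poly_Mapping.single n 1, 0) = 0"
proof -
  obtain c where c: "\<And>g. \<chi> (f * f * g, 0) = laurent_res
    ((Poly_Mapping.single 0 (\<chi> (0, 1)) * hill f + Poly_Mapping.single 0 c) * g)"
    using stabiliser_square[OF \<chi> f] by blast
  let ?D = "laurent_deriv f"
  have k1: "Poly_Mapping.keys ?D \<subseteq> {-(int B + 1)..int B}" by (rule keys_deriv_bound[OF keys])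
  have k2: "Poly_Mapping.keys (laurent_deriv ?D) \<subseteq> {-(int B + 1 + 1)..int B}"
    by (rule keys_deriv_bound[OF k1])
  have "Poly_Mapping.keys (?D * ?D) \<subseteq> {-(2 * int B + 2)..2 * int B}"
    using keys_mult_bound[OF k1 k1] by (simp add: algebra_simps)
  moreover have "Poly_Mapping.keys (f * laurent_deriv ?D) \<subseteq> {-(2 * int B + 2)..2 * int B}"
    using keys_mult_bound[OF keys k2] by (simp add: algebra_simps)
  moreover have "- 1 - n \<notin> {-(2 * int B + 2)..2 * int B}" using n by auto
  ultimately have "Poly_Mapping.lookup (?D * ?D) (- 1 - n) = 0"
    "Poly_Mapping.lookup (f * laurent_deriv ?D) (- 1 - n) = 0"
    by (metis in_keys_iff subsetD)+
  moreover have "hill f = (f * laurent_deriv ?D + f * laurent_deriv ?D) - ?D * ?D"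
    by (simp only: hill_def mult.assoc mult_2 distrib_right)
  ultimately have "Poly_Mapping.lookup (hill f) (- 1 - n) = 0"
    by (simp only: lookup_add lookup_minus) simp
  then show ?thesis
    unfolding c using n
    by (simp add: laurent_res_def mult.commute[of _ "Poly_Mapping.single n 1"] lookup_single_mult
        lookup_add lookup_const_mult lookup_single when_def)
qed

text \<open>The coefficients of \<open>f\<^sup>2\<close>, whose exponents lie between \<open>- 2 B\<close> and \<open>2 B\<close>, form a kernel vector of the
  window matrix evaluated at \<open>\<chi>\<close>.\<close>

lemma det_window_vanishes:
  fixes \<chi> :: "'k::field_char_0 vir \<Rightarrow> 'k"
  assumes \<chi>: "vir_linear \<chi>" and f: "stabilises f \<chi>" "f \<noteq> 0"
    and keys: "Poly_Mapping.keys f \<subseteq> {- int B..int B}" and M: "M \<ge> 2"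
  shows "sym_lift \<chi> (det (window_matrix M (4 * B + 1))) = 0"
proof -
  define N where "N = 4 * B + 1"
  define v where "v = vec N (\<lambda>j. Poly_Mapping.lookup (f * f) (int j - 2 * int B))"
  define A where "A = map_mat (sym_lift \<chi>) (window_matrix M N)"
  have A: "A \<in> carrier_mat N N" by (simp add: A_def window_matrix_def)
  have ff: "Poly_Mapping.keys (f * f) \<subseteq> {-(2 * int B)..2 * int B}"
    using keys_mult_bound[OF keys keys] by simp
  have "v \<noteq> 0\<^sub>v N"
  proof
    assume v0: "v = 0\<^sub>v N"
    have "Poly_Mapping.lookup (f * f) m = 0" for m
    proof (cases "m \<in> {-(2 * int B)..2 * int B}")
      case True
      then have "nat (m + 2 * int B) < N" by (auto simp: N_def)
      from arg_cong[OF v0, of "\<lambda>w. w $ nat (m + 2 * int B)"] this True show ?thesis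
        by (simp add: v_def)
    next
      case False
      then show ?thesis using ff by (meson in_keys_iff subsetD)
    qed
    then have "f * f = 0" by (intro poly_mapping_eqI) simp
    then show False using f by simp
  qed
  moreover have "A *\<^sub>v v = 0\<^sub>v N"
  proof (rule eq_vecI)
    fix i assume "i < dim_vec (0\<^sub>v N)"
    then have i: "i < N" by simp
    define n where "n = M + int (i * N) + 2 * int B"
    have "(A *\<^sub>v v) $ i = (\<Sum>j<N. \<chi> (vir_basis (Del (M + int (i * N + j)))) *
        Poly_Mapping.lookup (f * f) (int j - 2 * int B))"
      using i A by (simp add: v_def A_def window_matrix_def scalar_prod_def sym_lift_var
          lessThan_atLeast0 del: vir_basis.simps of_nat_add)
    also have "\<dots> = \<chi> (\<Sum>j<N. vir_scale (Poly_Mapping.lookup (f * f) (int j - 2 * int B))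
        (vir_basis (Del (M + int (i * N + j)))))"
      by (subst vir_linear_sum[OF \<chi>]) (simp_all add: mult.commute)
    also have "(\<Sum>j<N. vir_scale (Poly_Mapping.lookup (f * f) (int j - 2 * int B))
        (vir_basis (Del (M + int (i * N + j))))) = (f * f * Poly_Mapping.single n 1, 0)"
    proof -
      have "Poly_Mapping.lookup (\<Sum>j<N. Poly_Mapping.single (M + int (i * N + j))
          (Poly_Mapping.lookup (f * f) (int j - 2 * int B))) m =
          Poly_Mapping.lookup (f * f * Poly_Mapping.single n 1) m" for m
      proof -
        have "Poly_Mapping.lookup (\<Sum>j<N. Poly_Mapping.single (M + int (i * N + j))
            (Poly_Mapping.lookup (f * f) (int j - 2 * int B))) m =
            (\<Sum>j<N. if int j = m - M - int (i * N) then Poly_Mapping.lookup (f * f) (m - n) else 0)"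
          unfolding lookup_sum
          by (intro sum.cong refl) (auto simp: lookup_single when_def n_def algebra_simps)
        also have "\<dots> = Poly_Mapping.lookup (f * f) (m - n)"
        proof (cases "m - n \<in> {-(2 * int B)..2 * int B}")
          case True
          define j0 where "j0 = nat (m - M - int (i * N))"
          have j0: "int j0 = m - M - int (i * N)" "j0 < N"
            using True by (auto simp: j0_def n_def N_def)
          have "(\<Sum>j<N. if int j = m - M - int (i * N) then Poly_Mapping.lookup (f * f) (m - n) else 0) =
              (\<Sum>j<N. if j = j0 then Poly_Mapping.lookup (f * f) (m - n) else 0)"
            unfolding j0(1)[symmetric] of_nat_eq_iff ..
          then show ?thesis using j0(2) by simp
        next
          case False
          then have "Poly_Mapping.lookup (f * f) (m - n) = 0" using ff by (meson in_keys_iff subsetD)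
          then show ?thesis by (auto intro!: sum.neutral)
        qed
        finally show ?thesis
          by (simp add: mult.commute[of _ "Poly_Mapping.single n 1"] lookup_single_mult)
      qed
      then show ?thesis
        by (simp add: vir_scale_def mult_single prod_eq_iff fst_sum snd_sum poly_mapping_eqI
            del: of_nat_add)
    qed
    also have "\<chi> \<dots> = 0"
      using M by (intro stabilised_recurrence[OF \<chi> f(1) keys]) (simp add: n_def del: of_nat_mult)
    finally show "(A *\<^sub>v v) $ i = 0\<^sub>v N $ i" using i by simp
  qed (use A in auto)
  moreover have "v \<in> carrier_vec N" by (simp add: v_def)
  ultimately have "det A = 0" using det_0_iff_vec_prod_zero[OF A] by blast
  then show ?thesis by (simp add: A_def N_def)
qed

text \<open>A relation in a finite window of variables bounds the exponents of stabilising fields uniformly, so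
  that one and the same determinant vanishes at all points of \<open>I\<close>; by the Nullstellensatz a power of it lies in
  \<open>I\<close>.\<close>

lemma exists_far_relation:
  fixes I :: "'k::{alg_closed_field, field_char_0} sym_vir set"
  assumes unc: "uncountable (UNIV :: 'k set)" and I: "poisson_ideal I"
    and q: "q \<in> I" "q \<noteq> 0" "Cen \<notin> sym_vars q" and M: "M \<ge> 2"
  obtains r K where "r \<in> I" "r \<noteq> 0" "sym_vars r \<subseteq> Del ` {M..<K}"
proof -
  define F where "F = {n. Del n \<in> sym_vars q}"
  have "finite F"
    unfolding F_def by (rule finite_imageD[of Del]) (auto intro: finite_subset[OF _ finite_sym_vars[of q]] inj_onI)
  have F: "sym_vars q \<subseteq> Del ` F"
  proof
    fix x assume "x \<in> sym_vars q"
    then show "x \<in> Del ` F" using q(3) by (cases x) (auto simp: F_def)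
  qed
  obtain B where B: "F \<subseteq> {- int B..int B}"
  proof
    have "\<bar>n\<bar> \<le> (\<Sum>n\<in>F. \<bar>n\<bar>)" if "n \<in> F" for n
      using that \<open>finite F\<close> by (intro member_le_sum) auto
    then show "F \<subseteq> {- int (nat (\<Sum>n\<in>F. \<bar>n\<bar>))..int (nat (\<Sum>n\<in>F. \<bar>n\<bar>))}"
      by (fastforce simp: sum_nonneg)
  qed
  define H where "H = (det (window_matrix M (4 * B + 1)) :: 'k sym_vir)"
  have "\<exists>k. H ^ k \<in> I"
  proof (rule ccontr)
    assume "\<nexists>k. H ^ k \<in> I"
    then have "\<And>k. H ^ k \<notin> I" by blast
    moreover have "is_ideal I" using I by (simp add: poisson_ideal_def)
    ultimately obtain \<chi> where \<chi>: "vir_linear \<chi>" "I \<subseteq> max_ideal_at \<chi>" "sym_lift \<chi> H \<noteq> 0"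
      using nullstellensatz[OF unc] by blast
    obtain f where "f \<noteq> 0" "Poly_Mapping.keys f \<subseteq> F" "stabilises f \<chi>"
      using exists_stabiliser[OF I \<chi>(2,1) q(1,2) F \<open>finite F\<close>] by blast
    then have "sym_lift \<chi> H = 0"
      unfolding H_def using B M by (intro det_window_vanishes[OF \<chi>(1)]) auto
    with \<chi>(3) show False by simp
  qed
  then obtain k where "H ^ k \<in> I" by blast
  moreover have "H ^ k \<noteq> 0" unfolding H_def by (rule det_window_power_nonzero)
  moreover have "sym_vars (H ^ k) \<subseteq> Del ` {M..<M + int ((4 * B + 1) * (4 * B + 1))}"
    using sym_vars_power[of H k] sym_vars_det_window[of M "4 * B + 1"] unfolding H_def by blast
  ultimately show ?thesis using that by blast
qed

text \<open>Apply \<open>exists_stabiliser\<close> to relations in two disjoint windows; this yields stabilising fields of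
  different degrees.\<close>

theorem points_are_local:
  fixes I :: "'k::{alg_closed_field, field_char_0} sym_vir set"
  assumes unc: "uncountable (UNIV :: 'k set)" and I: "poisson_ideal I"
    and q: "q \<in> I" "q \<noteq> 0" "Cen \<notin> sym_vars q"
    and \<chi>: "vir_linear \<chi>" "I \<subseteq> max_ideal_at \<chi>"
  shows "\<chi> (0, 1) = 0" "\<exists>p. p \<noteq> 0 \<and> (\<forall>g. \<chi> (laurent_of_poly p * g, 0) = 0)"
proof -
  have stab: "\<exists>p K. p \<noteq> 0 \<and> stabilises (laurent_of_poly p) \<chi> \<and>
      Poly_Mapping.keys (laurent_of_poly p) \<subseteq> {M..<K}" if M: "M \<ge> 2" for M
  proof -
    obtain r K where r: "r \<in> I" "r \<noteq> 0" "sym_vars r \<subseteq> Del ` {M..<K}"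
      using exists_far_relation[OF unc I q M] by blast
    obtain f where f: "f \<noteq> 0" "Poly_Mapping.keys f \<subseteq> {M..<K}" "stabilises f \<chi>"
      using exists_stabiliser[OF I \<chi>(2,1) r] by blast
    moreover from this obtain p where "f = laurent_of_poly p"
      using M exists_laurent_of_poly[of f] by fastforce
    ultimately show ?thesis by (intro exI[of _ p] exI[of _ K]) auto
  qed
  have deg: "M \<le> int (degree p)" "int (degree p) < K"
    if "p \<noteq> 0" "Poly_Mapping.keys (laurent_of_poly p) \<subseteq> {M..<K}" for p :: "'k poly" and M K
  proof -
    have "int (degree p) \<in> Poly_Mapping.keys (laurent_of_poly p)"
      using that by (simp add: in_keys_iff lookup_laurent_of_poly)
    then show "M \<le> int (degree p)" "int (degree p) < K" using that by auto
  qed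
  obtain p K where p: "p \<noteq> 0" "stabilises (laurent_of_poly p) \<chi>"
    "Poly_Mapping.keys (laurent_of_poly p) \<subseteq> {2..<K}" using stab[of 2] by auto
  obtain r L where r: "r \<noteq> 0" "stabilises (laurent_of_poly r) \<chi>"
    "Poly_Mapping.keys (laurent_of_poly r) \<subseteq> {max 2 K..<L}" using stab[of "max 2 K"] by auto
  have "2 \<le> degree p" "degree p < degree r" using deg[OF p(1,3)] deg[OF r(1,3)] by auto
  note * = two_stabilisers[OF \<chi>(1) p(2) r(2) this]
  show "\<chi> (0, 1) = 0" by (rule *)
  show "\<exists>p. p \<noteq> 0 \<and> (\<forall>g. \<chi> (laurent_of_poly p * g, 0) = 0)"
    using *(2) p(1) by (intro exI[of _ "p * p"]) auto
qed

section \<open>Arcs along coadjoint orbits\<close>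

text \<open>Both sides are derivations along \<open>sym_hom fps_const \<phi>\<close>, so it suffices to compare them on
  variables.\<close>

lemma fps_const_flow_deriv:
  fixes \<phi> :: "vir_index \<Rightarrow> 'k::comm_ring_1 fps"
  assumes flow: "\<And>x. fps_deriv (\<phi> x) = a * sym_hom fps_const \<phi> (poisson (sym_var x) w)"
  shows "fps_deriv (sym_hom fps_const \<phi> q) = a * sym_hom fps_const \<phi> (poisson q w)"
proof -
  interpret \<Phi>: comm_ring_hom "sym_hom fps_const \<phi>"
    by (rule comm_ring_hom_sym_hom[OF comm_ring_hom_fps_const])
  show ?thesis
  proof (induction q rule: sym_induct)
    case (const c)
    then show ?case by (simp add: sym_hom_const poisson_const_left)
  next
    case (var x)
    then show ?case by (simp add: sym_hom_var flow)
  next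
    case (add p q)
    then show ?case by (simp add: \<Phi>.hom_add poisson_add_left distrib_left)
  next
    case (mult p q)
    then show ?case by (simp add: \<Phi>.hom_add \<Phi>.hom_mult poisson_mult_left algebra_simps)
  qed
qed

text \<open>An arc that is tangent to coadjoint orbits and starts at a point of \<open>I\<close> stays among the points of
  \<open>I\<close>: the differential equation expresses each power series coefficient of \<open>q\<close> along the arc by
  lower coefficients of \<open>{q, w}\<close>, which is again in \<open>I\<close>.\<close>

lemma flow_vanishes:
  fixes \<phi> :: "vir_index \<Rightarrow> 'k::field_char_0 fps"
  assumes I: "poisson_ideal I"
    and flow: "\<And>x. fps_deriv (\<phi> x) = a * sym_hom fps_const \<phi> (poisson (sym_var x) w)"
    and start: "\<And>q. q \<in> I \<Longrightarrow> fps_nth (sym_hom fps_const \<phi> q) 0 = 0"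
    and q: "q \<in> I"
  shows "sym_hom fps_const \<phi> q = 0"
proof -
  let ?\<Phi> = "sym_hom fps_const \<phi>"
  have "fps_nth (?\<Phi> q) n = 0" if "q \<in> I" for q n
    using that
  proof (induction n arbitrary: q rule: less_induct)
    case (less n)
    show ?case
    proof (cases n)
      case 0
      then show ?thesis using start less.prems by simp
    next
      case (Suc m)
      have "poisson q w \<in> I" using I less.prems by (simp add: poisson_ideal_def)
      then have "fps_nth (a * ?\<Phi> (poisson q w)) m = 0"
        unfolding fps_mult_nth using less.IH Suc by (intro sum.neutral) auto
      then have "of_nat (Suc m) * fps_nth (?\<Phi> q) (Suc m) = 0"
        using fps_const_flow_deriv[OF flow, of q] by (metis fps_deriv_nth Suc_eq_plus1)
      then show ?thesis using Suc by (metis mult_eq_0_iff of_nat_neq_0)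
    qed
  qed
  with q show ?thesis by (intro fps_ext) simp
qed

text \<open>\<open>F\<close> is the expansion at \<open>0\<close> of a rational function that is regular at \<open>s\<close> and has the value \<open>v\<close>
  there.\<close>

definition rational_value :: "'k::field \<Rightarrow> 'k fps \<Rightarrow> 'k \<Rightarrow> bool" where
  "rational_value s F v \<longleftrightarrow>
    (\<exists>D P. poly D s \<noteq> 0 \<and> fps_of_poly D * F = fps_of_poly P \<and> poly P s = poly D s * v)"

lemma rational_value_of_poly: "rational_value s (fps_of_poly P) (poly P s)"
  unfolding rational_value_def by (intro exI[of _ 1] exI[of _ P]) simp

lemma rational_value_const: "rational_value s (fps_const c) c"
  using rational_value_of_poly[of s "[:c:]"] by (simp add: fps_of_poly_const)

lemma rational_value_add:
  assumes "rational_value s F u" "rational_value s G v"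
  shows "rational_value s (F + G) (u + v)"
proof -
  obtain D P E Q where
    "poly D s \<noteq> 0" "fps_of_poly D * F = fps_of_poly P" "poly P s = poly D s * u"
    "poly E s \<noteq> 0" "fps_of_poly E * G = fps_of_poly Q" "poly Q s = poly E s * v"
    using assms by (auto simp: rational_value_def)
  moreover from this have "fps_of_poly (D * E) * (F + G) = fps_of_poly (E * P + D * Q)"
    by (simp add: fps_of_poly_mult fps_of_poly_add distrib_left mult_ac)
  ultimately show ?thesis unfolding rational_value_def
    by (intro exI[of _ "D * E"] exI[of _ "E * P + D * Q"]) (auto simp: algebra_simps)
qed

lemma rational_value_mult:
  assumes "rational_value s F u" "rational_value s G v"
  shows "rational_value s (F * G) (u * v)"
proof -
  obtain D P E Q where
    "poly D s \<noteq> 0" "fps_of_poly D * F = fps_of_poly P" "poly P s = poly D s * u"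
    "poly E s \<noteq> 0" "fps_of_poly E * G = fps_of_poly Q" "poly Q s = poly E s * v"
    using assms by (auto simp: rational_value_def)
  moreover have "fps_of_poly (D * E) * (F * G) = (fps_of_poly D * F) * (fps_of_poly E * G)"
    by (simp only: fps_of_poly_mult mult_ac)
  ultimately have "poly (D * E) s \<noteq> 0" "fps_of_poly (D * E) * (F * G) = fps_of_poly (P * Q)"
    "poly (P * Q) s = poly (D * E) s * (u * v)"
    by (simp_all add: fps_of_poly_mult)
  then show ?thesis unfolding rational_value_def by blast
qed

lemma rational_value_cancel:
  assumes "rational_value s (fps_of_poly e * F) (poly e s * v)" "poly e s \<noteq> 0"
  shows "rational_value s F v"
proof -
  obtain D P where "poly D s \<noteq> 0" "fps_of_poly D * (fps_of_poly e * F) = fps_of_poly P"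
    "poly P s = poly D s * (poly e s * v)"
    using assms(1) by (auto simp: rational_value_def)
  then show ?thesis using assms(2) unfolding rational_value_def
    by (intro exI[of _ "D * e"] exI[of _ P]) (auto simp: fps_of_poly_mult mult.assoc)
qed

lemma rational_value_zero: "rational_value s 0 v \<Longrightarrow> v = 0"
  by (auto simp: rational_value_def)

text \<open>By \<open>flow_vanishes\<close> an element of \<open>I\<close> vanishes identically along the arc, hence also at the parameter
  \<open>s\<close>, far from the formal neighbourhood of \<open>0\<close> in which the arc was defined.\<close>

lemma degeneration:
  fixes \<phi> :: "vir_index \<Rightarrow> 'k::field_char_0 fps"
  assumes I: "poisson_ideal I" "I \<subseteq> max_ideal_at \<chi>"
    and flow: "\<And>x. fps_deriv (\<phi> x) = a * sym_hom fps_const \<phi> (poisson (sym_var x) w)"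
    and start: "\<And>x. fps_nth (\<phi> x) 0 = \<chi> (vir_basis x)"
    and limit: "\<And>x. rational_value s (\<phi> x) (\<psi> (vir_basis x))"
  shows "I \<subseteq> max_ideal_at \<psi>"
proof
  fix q assume "q \<in> I"
  interpret \<Phi>: comm_ring_hom "sym_hom fps_const \<phi>"
    by (rule comm_ring_hom_sym_hom[OF comm_ring_hom_fps_const])
  have nth: "fps_nth (sym_hom fps_const \<phi> q) 0 = sym_lift \<chi> q" for q
    by (induction q rule: sym_induct)
      (simp_all add: sym_hom_const sym_hom_var sym_lift_const sym_lift_var start
        \<Phi>.hom_add \<Phi>.hom_mult sym_lift.hom_add sym_lift.hom_mult del: vir_basis.simps)
  have val: "rational_value s (sym_hom fps_const \<phi> q) (sym_lift \<psi> q)" for q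
    by (induction q rule: sym_induct)
      (simp_all add: sym_hom_const sym_hom_var sym_lift_const sym_lift_var limit
        \<Phi>.hom_add \<Phi>.hom_mult sym_lift.hom_add sym_lift.hom_mult
        rational_value_const rational_value_add rational_value_mult del: vir_basis.simps)
  have "sym_hom fps_const \<phi> q = 0"
    using I(2) nth \<open>q \<in> I\<close>
    by (intro flow_vanishes[OF I(1) flow]) (auto simp: max_ideal_at_def)
  then have "sym_lift \<psi> q = 0" using val[of q] rational_value_zero by metis
  then show "q \<in> max_ideal_at \<psi>" by (simp add: max_ideal_at_def)
qed

section \<open>Adding a point evaluation\<close>

lemma laurent_eval_single: "laurent_eval (Poly_Mapping.single n c) x = c * x powi n"
  by (simp add: laurent_eval_def)

lemma laurent_eval_add: "laurent_eval (f + g) x = laurent_eval f x + laurent_eval g x"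
  unfolding laurent_eval_def
  by (rule pm_sum_add[of "\<lambda>n a. a * x powi n"]) (simp_all add: distrib_right)

lemma laurent_eval_0 [simp]: "laurent_eval 0 x = 0"
  by (simp add: laurent_eval_def)

lemma laurent_eval_mult:
  assumes "x \<noteq> 0"
  shows "laurent_eval (f * g) x = laurent_eval f x * laurent_eval g x"
proof (induction f rule: pm_induct)
  case (add f m a)
  have "laurent_eval (Poly_Mapping.single m a * Poly_Mapping.single n b) x =
      laurent_eval (Poly_Mapping.single m a) x * laurent_eval (Poly_Mapping.single n b) x" for n b
    unfolding mult_single laurent_eval_single by (simp add: power_int_add assms)
  then have "laurent_eval (Poly_Mapping.single m a * g) x =
      laurent_eval (Poly_Mapping.single m a) x * laurent_eval g x"
    by (induction g rule: pm_induct) (simp_all add: distrib_left laurent_eval_add)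
  with add show ?case by (simp add: distrib_right laurent_eval_add)
qed simp

lemma laurent_eval_diff: "laurent_eval (f - g) x = laurent_eval f x - laurent_eval g x"
  using laurent_eval_add[of "f - g" g x] by simp

lemma laurent_eval_1 [simp]: "laurent_eval 1 x = 1"
  using laurent_eval_single[of 0 1 x] by simp

lemma laurent_eval_of_poly:
  assumes "x \<noteq> 0"
  shows "laurent_eval (laurent_of_poly p) x = poly p x"
  by (induction p) (simp_all add: laurent_of_poly_pCons laurent_eval_add laurent_eval_single
      laurent_eval_mult assms)

lemma vir_linear_eval: "x \<noteq> 0 \<Longrightarrow> vir_linear (\<lambda>u. laurent_eval (fst u) x)"
  unfolding vir_linear_def
  by (simp add: laurent_eval_add vir_scale_def laurent_eval_mult laurent_eval_single)

lemma sym_hom_affine_line: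
  fixes \<alpha> \<beta> :: "'k::comm_ring_1 vir \<Rightarrow> 'k"
  assumes \<alpha>: "vir_linear \<alpha>" and \<beta>: "vir_linear \<beta>"
    and \<phi>: "\<And>y. \<phi> y = fps_const (\<alpha> (vir_basis y)) + fps_X * fps_const (\<beta> (vir_basis y))"
  shows "sym_hom fps_const \<phi> (sym_incl u) = fps_const (\<alpha> u) + fps_X * fps_const (\<beta> u)"
proof -
  interpret \<Phi>: comm_ring_hom "sym_hom fps_const \<phi>"
    by (rule comm_ring_hom_sym_hom[OF comm_ring_hom_fps_const])
  show ?thesis
  proof (induction u rule: vir_induct)
    case (basis c x)
    have "sym_hom fps_const \<phi> (sym_incl (vir_scale c (vir_basis x))) = fps_const c * \<phi> x"
      by (simp add: sym_incl_scale sym_incl_basis \<Phi>.hom_mult sym_hom_const sym_hom_var)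
    also have "\<dots> = fps_const (c * \<alpha> (vir_basis x)) + fps_X * fps_const (c * \<beta> (vir_basis x))"
      by (simp add: \<phi> distrib_left mult.left_commute fps_const_mult[symmetric] del: fps_const_mult)
    finally show ?case by (simp only: vir_linear_scale[OF \<alpha>] vir_linear_scale[OF \<beta>])
  next
    case (add u v)
    then have "sym_hom fps_const \<phi> (sym_incl (u + v)) =
        fps_const (\<alpha> u + \<alpha> v) + fps_X * fps_const (\<beta> u + \<beta> v)"
      by (simp add: sym_incl_add \<Phi>.hom_add distrib_left fps_const_add[symmetric] del: fps_const_add)
    then show ?case by (simp only: vir_linear_add[OF \<alpha>] vir_linear_add[OF \<beta>])
  qed
qed

text \<open>The arc is the line \<open>\<chi> + X \<epsilon>\<close> with \<open>\<epsilon>\<close> the evaluation at \<open>x\<close>, so its tangent vector \<open>\<epsilon>\<close> has to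
  come from the coadjoint action of some \<open>a \<partial>\<close>. Let \<open>f = (t - x)^m f2\<close> with \<open>f2(x) \<noteq> 0\<close>. By minimality
  of \<open>f\<close> the functional \<open>(f / (t - x)) \<chi>\<close> is a nonzero multiple of \<open>\<epsilon>\<close>. For \<open>a = f f2\<close> the derivative
  \<open>a'\<close> is congruent to \<open>m f2 f / (t - x)\<close> modulo \<open>f\<close>, so \<open>a \<partial>\<close> moves \<open>\<chi>\<close> by \<open>\<theta> \<epsilon>\<close> with \<open>\<theta> \<noteq> 0\<close>. It
  moves \<open>\<epsilon>\<close> itself by \<open>a'(x) \<epsilon>\<close>; rescaling by the unit \<open>\<theta> + X a'(x)\<close> gives the required tangent
  vector.\<close>

lemma translate_by_support_point:
  fixes I :: "'k::{alg_closed_field, field_char_0} sym_vir set"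
  assumes I: "poisson_ideal I" "I \<subseteq> max_ideal_at \<chi>"
    and \<chi>: "vir_linear \<chi>" "\<chi> (0, 1) = 0"
    and f: "f \<noteq> 0" "\<And>g. \<chi> (laurent_of_poly f * g, 0) = 0"
    and minimal: "\<And>p. p \<noteq> 0 \<Longrightarrow> (\<And>g. \<chi> (laurent_of_poly p * g, 0) = 0) \<Longrightarrow> degree f \<le> degree p"
    and x: "poly f x = 0" "x \<noteq> 0"
  shows "I \<subseteq> max_ideal_at (\<lambda>u. \<chi> u + s * laurent_eval (fst u) x)"
proof -
  let ?L = "laurent_of_poly :: 'k poly \<Rightarrow> 'k laurent"
  define u where "u = [:- x, 1:]"
  have u: "degree u = 1" "u \<noteq> 0" "pderiv u = 1"
    by (simp_all add: u_def pderiv_pCons)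
  have \<chi>_fst: "\<chi> (g, c) = \<chi> (g, 0)" for g c
  proof -
    have "(g, c) = (g, 0) + vir_scale c (0, 1)" by (simp add: vir_scale_def)
    then have "\<chi> (g, c) = \<chi> (g, 0) + c * \<chi> (0, 1)"
      by (simp only: vir_linear_add[OF \<chi>(1)] vir_linear_scale[OF \<chi>(1)])
    then show ?thesis by (simp add: \<chi>(2))
  qed
  have \<chi>_add: "\<chi> (g + h, 0) = \<chi> (g, 0) + \<chi> (h, 0)" for g h
    using vir_linear_add[OF \<chi>(1), of "(g, 0)" "(h, 0)"] by simp
  have \<chi>_diff: "\<chi> (g - h, 0) = \<chi> (g, 0) - \<chi> (h, 0)" for g h
    using \<chi>_add[of "g - h" h] by simp
  have \<chi>_scale: "\<chi> (Poly_Mapping.single 0 c * g, 0) = c * \<chi> (g, 0)" for c g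
    using vir_linear_scale[OF \<chi>(1), of c "(g, 0)"] by (simp add: vir_scale_def)
  define m where "m = order x f"
  have "m \<noteq> 0" using x f by (simp add: m_def order_root)
  obtain f2 where f2: "f = u ^ m * f2" "\<not> u dvd f2"
    using order_decomp[OF f(1), of x] by (auto simp: m_def u_def)
  have f2x: "poly f2 x \<noteq> 0" using f2(2) by (simp add: poly_eq_0_iff_dvd u_def)
  define f1 where "f1 = u ^ (m - 1) * f2"
  have um: "u ^ m = u * u ^ (m - 1)"
    by (simp only: power_eq_if[of u m] \<open>m \<noteq> 0\<close> if_False)
  have f_f1: "f = u * f1"
    by (simp only: f2(1) f1_def um mult.assoc)
  have "f1 \<noteq> 0" using f f_f1 by auto
  have "degree f = degree u + degree f1"
    unfolding f_f1 by (rule degree_mult_eq) (use \<open>f1 \<noteq> 0\<close> u in auto)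
  then have "degree f1 < degree f" using u(1) by simp
  define \<kappa> where "\<kappa> = \<chi> (?L f1, 0)"
  have shift: "\<chi> (?L f1 * Poly_Mapping.single (n + 1) 1, 0) = x * \<chi> (?L f1 * Poly_Mapping.single n 1, 0)" for n
  proof -
    have Lu: "?L u = Poly_Mapping.single 1 1 - Poly_Mapping.single 0 x"
      by (simp add: u_def laurent_of_poly_pCons single_uminus)
    have "?L f1 * Poly_Mapping.single (n + 1) 1 - Poly_Mapping.single 0 x * (?L f1 * Poly_Mapping.single n 1)
        = ?L f * Poly_Mapping.single n 1"
    proof -
      have "(Poly_Mapping.single (n + 1) 1 :: 'k laurent) = Poly_Mapping.single 1 1 * Poly_Mapping.single n 1"
        by (simp add: mult_single add.commute)
      then show ?thesis
        unfolding f_f1 laurent_of_poly_mult Lu by (simp add: algebra_simps)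
    qed
    then have "\<chi> (?L f1 * Poly_Mapping.single (n + 1) 1, 0)
        - \<chi> (Poly_Mapping.single 0 x * (?L f1 * Poly_Mapping.single n 1), 0) = 0"
      using f(2)[of "Poly_Mapping.single n 1"] \<chi>_diff by metis
    then show ?thesis by (simp only: \<chi>_scale right_minus_eq)
  qed
  have pow: "\<chi> (?L f1 * Poly_Mapping.single n 1, 0) = \<kappa> * x powi n" for n
  proof (induction n rule: int_induct[where k = 0])
    case base
    then show ?case by (simp add: \<kappa>_def)
  next
    case (step1 i)
    then show ?case unfolding shift using x(2) by (simp add: power_int_add)
  next
    case (step2 i)
    have "x * \<chi> (?L f1 * Poly_Mapping.single (i - 1) 1, 0) = x * (\<kappa> * x powi (i - 1))"
      using shift[of "i - 1"] step2 x(2) by (simp add: power_int_diff)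
    then show ?case using x(2) by simp
  qed
  have eval: "\<chi> (?L f1 * g, 0) = \<kappa> * laurent_eval g x" for g
  proof (induction g rule: pm_induct)
    case zero
    then show ?case using \<chi>_diff[of 0 0] by simp
  next
    case (add g n a)
    have "?L f1 * Poly_Mapping.single n a = Poly_Mapping.single 0 a * (?L f1 * Poly_Mapping.single n 1)"
      by (simp add: mult.left_commute mult_single)
    then have "\<chi> (?L f1 * Poly_Mapping.single n a, 0) = a * (\<kappa> * x powi n)"
      by (simp only: \<chi>_scale pow)
    with add show ?case by (simp add: distrib_left \<chi>_add laurent_eval_add laurent_eval_single algebra_simps)
  qed
  have "\<kappa> \<noteq> 0"
  proof
    assume "\<kappa> = 0"
    then have "degree f \<le> degree f1" using eval by (intro minimal[OF \<open>f1 \<noteq> 0\<close>]) simp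
    with \<open>degree f1 < degree f\<close> show False by simp
  qed
  define a where "a = f * f2"
  define \<theta> where "\<theta> = \<kappa> * of_nat m * poly f2 x"
  define \<theta>' where "\<theta>' = poly (pderiv a) x"
  have "\<theta> \<noteq> 0" using \<open>\<kappa> \<noteq> 0\<close> f2x \<open>m \<noteq> 0\<close> by (simp add: \<theta>_def)
  have "pderiv a = f1 * (Polynomial.smult (of_nat m) f2) + f * (pderiv f2 + pderiv f2)"
  proof -
    have "pderiv (u ^ m) = Polynomial.smult (of_nat m) (u ^ (m - 1))"
      using \<open>m \<noteq> 0\<close> u(3) by (cases m) (simp_all add: pderiv_power_Suc del: power_Suc)
    moreover have "a = u ^ m * (f2 * f2)" by (simp only: a_def f2(1) mult.assoc)
    ultimately have "pderiv a =
        u ^ m * (f2 * (pderiv f2 + pderiv f2)) + f2 * f2 * Polynomial.smult (of_nat m) (u ^ (m - 1))"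
      by (simp only: pderiv_mult distrib_left)
    also have "u ^ m * (f2 * (pderiv f2 + pderiv f2)) = f * (pderiv f2 + pderiv f2)"
      by (simp only: f2(1) mult.assoc)
    also have "f2 * f2 * Polynomial.smult (of_nat m) (u ^ (m - 1)) =
        f1 * (Polynomial.smult (of_nat m) f2)"
      by (simp add: f1_def mult_ac)
    finally show ?thesis by (simp only: add.commute)
  qed
  then have La: "?L (pderiv a) = ?L f1 * ?L (Polynomial.smult (of_nat m) f2) + ?L f * ?L (pderiv f2 + pderiv f2)"
    by (simp only: laurent_of_poly_add laurent_of_poly_mult)
  have act: "\<chi> (g * ?L (pderiv a) - laurent_deriv g * ?L a, 0) = \<theta> * laurent_eval g x" for g
  proof -
    have "g * ?L (pderiv a) - laurent_deriv g * ?L a =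
        ?L f1 * (?L (Polynomial.smult (of_nat m) f2) * g)
        + ?L f * (?L (pderiv f2 + pderiv f2) * g - ?L f2 * laurent_deriv g)"
      unfolding La by (simp add: a_def laurent_of_poly_mult algebra_simps)
    then have "\<chi> (g * ?L (pderiv a) - laurent_deriv g * ?L a, 0) =
        \<kappa> * (poly (Polynomial.smult (of_nat m) f2) x * laurent_eval g x)"
      by (simp only: \<chi>_add f(2) eval laurent_eval_mult[OF x(2)] laurent_eval_of_poly[OF x(2)] add_0_right)
    then show ?thesis by (simp add: \<theta>_def mult_ac)
  qed
  have act': "laurent_eval (g * ?L (pderiv a) - laurent_deriv g * ?L a) x = \<theta>' * laurent_eval g x" for g
    using x by (simp add: laurent_eval_diff laurent_eval_mult laurent_eval_of_poly \<theta>'_def a_def mult.commute)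
  define \<beta> where "\<beta> u = laurent_eval (fst u) x" for u :: "'k vir"
  have \<beta>: "vir_linear \<beta>" unfolding \<beta>_def by (rule vir_linear_eval[OF x(2)])
  define \<phi> where "\<phi> y = fps_const (\<chi> (vir_basis y)) + fps_X * fps_const (\<beta> (vir_basis y))" for y
  define T where "T = fps_const \<theta> + fps_X * fps_const \<theta>'"
  show ?thesis
  proof (rule degeneration[OF I])
    fix y
    have "fps_nth T 0 \<noteq> 0" using \<open>\<theta> \<noteq> 0\<close> by (simp add: T_def)
    then have T: "inverse T * T = 1" by (rule inverse_mult_eq_1)
    have "sym_hom fps_const \<phi> (poisson (sym_var y) (sym_incl (?L a, 0))) =
        fps_const (\<beta> (vir_basis y)) * T"
    proof (cases y)
      case Cen
      have "poisson (sym_var y) (sym_incl (?L a, 0)) = 0" by (simp only: Cen poisson_Cen_left)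
      then show ?thesis using sym_hom_const[of fps_const \<phi> 0] by (simp add: Cen \<beta>_def)
    next
      case (Del n)
      let ?g = "Poly_Mapping.single n 1 :: 'k laurent"
      define v where "v = vir_bracket (vir_basis y) (?L a, 0)"
      have v: "fst v = ?g * ?L (pderiv a) - laurent_deriv ?g * ?L a"
        by (simp add: v_def Del vir_bracket_def Let_def laurent_deriv_of_poly)
      have "\<chi> v = \<chi> (fst v, 0)" using \<chi>_fst[of "fst v" "snd v"] by simp
      then have "\<chi> v = \<theta> * x powi n"
        using act[of ?g] by (simp add: v laurent_eval_single)
      moreover have "\<beta> v = \<theta>' * x powi n"
        using act'[of ?g] by (simp add: \<beta>_def v laurent_eval_single)
      moreover have "poisson (sym_var y) (sym_incl (?L a, 0)) = sym_incl v"
        by (simp only: v_def sym_incl_basis[symmetric] poisson_incl)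
      ultimately have "sym_hom fps_const \<phi> (poisson (sym_var y) (sym_incl (?L a, 0))) =
          fps_const (\<theta> * x powi n) + fps_X * fps_const (\<theta>' * x powi n)"
        using sym_hom_affine_line[OF \<chi>(1) \<beta> \<phi>_def, of v] by simp
      moreover have "\<beta> (vir_basis y) = x powi n" by (simp add: \<beta>_def Del laurent_eval_single)
      ultimately show ?thesis
        by (simp add: T_def distrib_left fps_const_mult[symmetric] mult_ac del: fps_const_mult)
    qed
    moreover have "fps_deriv (\<phi> y) = fps_const (\<beta> (vir_basis y))" by (simp add: \<phi>_def)
    ultimately show "fps_deriv (\<phi> y) =
        inverse T * sym_hom fps_const \<phi> (poisson (sym_var y) (sym_incl (?L a, 0)))"
      using T by (simp add: mult.left_commute)
    show "fps_nth (\<phi> y) 0 = \<chi> (vir_basis y)" by (simp add: \<phi>_def)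
    have "\<phi> y = fps_of_poly [:\<chi> (vir_basis y), \<beta> (vir_basis y):]"
      by (simp add: \<phi>_def fps_of_poly_pCons mult.commute)
    then have "rational_value s (\<phi> y) (poly [:\<chi> (vir_basis y), \<beta> (vir_basis y):] s)"
      using rational_value_of_poly by metis
    then show "rational_value s (\<phi> y) (\<chi> (vir_basis y) + s * laurent_eval (fst (vir_basis y)) x)"
      by (simp add: \<beta>_def)
  qed
qed

text \<open>Let \<open>f\<close> be an annihilator of minimal degree. It has a root unless \<open>\<chi>\<close> vanishes on all vector
  fields, and a minimal annihilator is not divisible by the unit \<open>t\<close>, so the root is nonzero.
  Evaluating \<open>\<partial>\<close> at the root gives \<open>1\<close>, hence the multiple \<open>- \<chi>(\<partial>)\<close> of this evaluation does the
  job. The polynomial \<open>f\<close> still annihilates the new functional.\<close>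

lemma exists_point_killing_translation:
  fixes I :: "'k::{alg_closed_field, field_char_0} sym_vir set"
  assumes I: "poisson_ideal I" "I \<subseteq> max_ideal_at \<chi>"
    and \<chi>: "vir_linear \<chi>" "\<chi> (0, 1) = 0"
    and p: "p \<noteq> 0" "\<And>g. \<chi> (laurent_of_poly p * g, 0) = 0"
  shows "\<exists>\<psi> f. I \<subseteq> max_ideal_at \<psi> \<and> vir_linear \<psi> \<and> \<psi> (0, 1) = 0 \<and> \<psi> (1, 0) = 0 \<and>
    f \<noteq> 0 \<and> (\<forall>g. \<psi> (laurent_of_poly f * g, 0) = 0)"
proof -
  define ann where "ann f \<longleftrightarrow> f \<noteq> 0 \<and> (\<forall>g. \<chi> (laurent_of_poly f * g, 0) = 0)" for f
  have "ann p" using p by (simp add: ann_def)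
  then obtain f where f: "ann f" and min: "\<And>q. ann q \<Longrightarrow> degree f \<le> degree q"
    using ex_has_least_nat[of ann p degree] by blast
  show ?thesis
  proof (cases "degree f = 0")
    case True
    then obtain c where "f = [:c:]" by (metis degree_eq_zeroE)
    with f have "c \<noteq> 0" "\<And>g. \<chi> (Poly_Mapping.single 0 c * g, 0) = 0"
      by (auto simp: ann_def laurent_of_poly_const)
    from this(2)[of "Poly_Mapping.single 0 (inverse c)"] this(1) have "\<chi> (1, 0) = 0"
      by (simp add: mult_single)
    with I \<chi> p show ?thesis by blast
  next
    case False
    then obtain x where x: "poly f x = 0" using alg_closed_imp_poly_has_root[of f] by auto
    have "x \<noteq> 0"
    proof
      assume "x = 0"
      with x obtain r where r: "f = [:0, 1:] * r" by (metis poly_eq_0_iff_dvd dvdE minus_zero)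
      have "ann r"
        unfolding ann_def
      proof (intro conjI allI)
        show "r \<noteq> 0" using f r by (auto simp: ann_def)
        fix g
        have "laurent_of_poly r * g = laurent_of_poly f * (Poly_Mapping.single (-1) 1 * g)"
        proof -
          have "laurent_of_poly f = Poly_Mapping.single 1 1 * laurent_of_poly r"
            unfolding r laurent_of_poly_mult by (simp add: laurent_of_poly_pCons)
          moreover have "Poly_Mapping.single 1 1 * Poly_Mapping.single (-1) 1 = (1 :: 'k laurent)"
            by (simp add: mult_single)
          ultimately show ?thesis
            by (metis (no_types, opaque_lifting) mult.assoc mult.commute mult.right_neutral)
        qed
        then show "\<chi> (laurent_of_poly r * g, 0) = 0" using f unfolding ann_def by metis
      qed
      from min[OF this] r f show False
        by (auto simp: ann_def degree_mult_eq)
    qed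
    define \<psi> where "\<psi> u = \<chi> u + (- \<chi> (1, 0)) * laurent_eval (fst u) x" for u
    have "I \<subseteq> max_ideal_at \<psi>"
      unfolding \<psi>_def
      by (rule translate_by_support_point[OF I \<chi>, of f])
        (use f min x \<open>x \<noteq> 0\<close> in \<open>auto simp: ann_def\<close>)
    moreover have "vir_linear \<psi>"
      using vir_linear_eval[OF \<open>x \<noteq> 0\<close>] \<chi>(1) unfolding vir_linear_def \<psi>_def
      by (simp add: algebra_simps)
    moreover have "\<psi> (laurent_of_poly f * g, 0) = 0" for g
      using f x \<open>x \<noteq> 0\<close> by (simp add: \<psi>_def ann_def laurent_eval_mult laurent_eval_of_poly)
    ultimately show ?thesis
      using f \<chi>(2) by (intro exI[of _ \<psi>] exI[of _ f]) (auto simp: \<psi>_def ann_def)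
  qed
qed

section \<open>Dilations\<close>

text \<open>The value of \<open>\<mu>\<close> at the \<open>n\<close>-th power of \<open>y = t + X (t - 1) = 1 + (1 + X) (t - 1)\<close>, expanded in \<open>X\<close>:
  the image of \<open>t^n\<close> under the dilation about \<open>1\<close> with factor \<open>1 + X\<close>. The binomial series makes
  sense of negative powers.\<close>

definition dilate :: "('k::field_char_0 laurent \<Rightarrow> 'k) \<Rightarrow> int \<Rightarrow> 'k fps" where
  "dilate \<mu> n = Abs_fps (\<lambda>j. (of_int n gchoose j) *
     \<mu> (Poly_Mapping.single (n - int j) 1 * (Poly_Mapping.single 1 1 - 1) ^ j))"

definition laurent_linear :: "('k::comm_ring_1 laurent \<Rightarrow> 'k) \<Rightarrow> bool" where
  "laurent_linear \<mu> \<longleftrightarrow> (\<forall>f g. \<mu> (f + g) = \<mu> f + \<mu> g) \<and>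
     (\<forall>c f. \<mu> (Poly_Mapping.single 0 c * f) = c * \<mu> f)"

lemma laurent_linear_add: "laurent_linear \<mu> \<Longrightarrow> \<mu> (f + g) = \<mu> f + \<mu> g"
  and laurent_linear_scale: "laurent_linear \<mu> \<Longrightarrow> \<mu> (Poly_Mapping.single 0 c * f) = c * \<mu> f"
  by (auto simp: laurent_linear_def)

lemma laurent_linear_diff: "laurent_linear \<mu> \<Longrightarrow> \<mu> (f - g) = \<mu> f - \<mu> g"
  using laurent_linear_add[of \<mu> "f - g" g] by simp

lemma laurent_linear_mult: "laurent_linear \<mu> \<Longrightarrow> laurent_linear (\<lambda>g. \<mu> (h * g))"
  by (auto simp: laurent_linear_def distrib_left mult.left_commute[of h])

lemma nth_one_plus_X_mult:
  "fps_nth ((1 + fps_X) * F) j = fps_nth F j + (if j = 0 then 0 else fps_nth F (j - 1))"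
  for F :: "'k::comm_ring_1 fps"
  by (simp add: distrib_right fps_X_mult_nth)

text \<open>All monomials that occur in comparing coefficients of \<open>y^n\<close>, \<open>y^(n+1)\<close> and \<open>y^(n-1)\<close> are expressed by the
  single one \<open>D\<close>.\<close>

lemma laurent_dilation_monomials:
  fixes n :: int and i :: nat
  defines "t \<equiv> Poly_Mapping.single 1 1 :: 'k::comm_ring_1 laurent"
  defines "D \<equiv> Poly_Mapping.single (n - 1 - int i) 1 * (t - 1) ^ i"
  shows "Poly_Mapping.single (n - int i) 1 * (t - 1) ^ i = t * D"
    and "Poly_Mapping.single (n - int (Suc i)) 1 * (t - 1) ^ Suc i = t * D - D"
    and "Poly_Mapping.single (n + 1 - int i) 1 * (t - 1) ^ i = t * (t * D)"
    and "Poly_Mapping.single (n + 1 - int (Suc i)) 1 * (t - 1) ^ Suc i = t * (t * D) - t * D"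
proof -
  have s: "Poly_Mapping.single (m + 1) 1 = t * Poly_Mapping.single m (1 :: 'k)" for m :: int
    by (simp add: t_def mult_single add.commute)
  have e: "n - int i = (n - 1 - int i) + 1" "n - int (Suc i) = n - 1 - int i"
    "n + 1 - int i = ((n - 1 - int i) + 1) + 1" "n + 1 - int (Suc i) = (n - 1 - int i) + 1"
    by simp_all
  show "Poly_Mapping.single (n - int i) 1 * (t - 1) ^ i = t * D"
    unfolding e(1) s D_def by (simp add: mult.assoc)
  show "Poly_Mapping.single (n - int (Suc i)) 1 * (t - 1) ^ Suc i = t * D - D"
    unfolding e(2) D_def by (simp add: algebra_simps)
  show "Poly_Mapping.single (n + 1 - int i) 1 * (t - 1) ^ i = t * (t * D)"
    unfolding e(3) s D_def by (simp add: mult.assoc)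
  show "Poly_Mapping.single (n + 1 - int (Suc i)) 1 * (t - 1) ^ Suc i = t * (t * D) - t * D"
    unfolding e(4) s D_def by (simp add: algebra_simps)
qed

text \<open>This is \<open>\<mu>\<close> applied to \<open>(1 + X) t y^n = y^(n+1) + X y^n\<close>.\<close>

lemma dilate_shift:
  assumes \<mu>: "laurent_linear \<mu>"
  shows "(1 + fps_X) * dilate (\<lambda>g. \<mu> (Poly_Mapping.single 1 1 * g)) n =
    dilate \<mu> (n + 1) + fps_X * dilate \<mu> n"
proof (rule fps_ext)
  let ?t = "Poly_Mapping.single 1 1 :: 'a laurent"
  fix j
  show "fps_nth ((1 + fps_X) * dilate (\<lambda>g. \<mu> (?t * g)) n) j =
      fps_nth (dilate \<mu> (n + 1) + fps_X * dilate \<mu> n) j"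
  proof (cases j)
    case 0
    have "?t * Poly_Mapping.single n 1 = Poly_Mapping.single (n + 1) 1"
      by (simp add: mult_single add.commute)
    then show ?thesis by (simp only: nth_one_plus_X_mult) (simp add: 0 dilate_def)
  next
    case (Suc i)
    define D where "D = Poly_Mapping.single (n - 1 - int i) 1 * (?t - 1) ^ i"
    note m = laurent_dilation_monomials[of n i, where ?'k = 'a, folded D_def]
    have pascal: "((of_int n + 1) gchoose Suc i) = (of_int n gchoose i) + (of_int n gchoose Suc i :: 'a)"
      by (rule gbinomial_Suc_Suc)
    have "fps_nth ((1 + fps_X) * dilate (\<lambda>g. \<mu> (?t * g)) n) j =
        (of_int n gchoose Suc i) * \<mu> (?t * (?t * D - D)) + (of_int n gchoose i) * \<mu> (?t * (?t * D))"
      unfolding nth_one_plus_X_mult by (simp add: Suc dilate_def m del: power_Suc of_nat_Suc)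
    also have "\<dots> = ((of_int n + 1) gchoose Suc i) * \<mu> (?t * (?t * D) - ?t * D) + (of_int n gchoose i) * \<mu> (?t * D)"
      unfolding pascal right_diff_distrib laurent_linear_diff[OF \<mu>] by (simp add: algebra_simps)
    also have "\<dots> = fps_nth (dilate \<mu> (n + 1) + fps_X * dilate \<mu> n) j"
      by (simp add: Suc dilate_def m del: power_Suc of_nat_Suc)
    finally show ?thesis .
  qed
qed

text \<open>Here \<open>y' = t - 1\<close>, so that \<open>(1 + X) y' = y - 1\<close> and \<open>(1 + X) (y^n)' = n y^n - n y^(n-1)\<close>.\<close>

lemma dilate_deriv:
  assumes \<mu>: "laurent_linear \<mu>"
  shows "(1 + fps_X) * fps_deriv (dilate \<mu> n) = of_int n * dilate \<mu> n - of_int n * dilate \<mu> (n - 1)"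
proof (rule fps_ext)
  let ?t = "Poly_Mapping.single 1 1 :: 'a laurent"
  fix i
  define D where "D = Poly_Mapping.single (n - 1 - int i) 1 * (?t - 1) ^ i"
  note m = laurent_dilation_monomials[of n i, where ?'k = 'a, folded D_def]
  let ?c = "of_int n gchoose i :: 'a"
  have c1: "of_nat (Suc i) * (of_int n gchoose Suc i :: 'a) = (of_int n - of_nat i) * ?c"
    using gbinomial_mult_1[of "of_int n :: 'a" i] by (simp add: algebra_simps)
  have c2: "of_int n * ((of_int n - 1) gchoose i :: 'a) = (of_int n - of_nat i) * ?c"
    using gbinomial_absorption[of i "of_int n :: 'a"] c1 by simp
  have "fps_nth ((1 + fps_X) * fps_deriv (dilate \<mu> n)) i =
      of_nat (Suc i) * fps_nth (dilate \<mu> n) (Suc i) + of_nat i * fps_nth (dilate \<mu> n) i"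
    by (cases i) (simp_all add: nth_one_plus_X_mult del: of_nat_Suc)
  also have "\<dots> = of_nat (Suc i) * (of_int n gchoose Suc i) * \<mu> (?t * D - D) + of_nat i * ?c * \<mu> (?t * D)"
    by (simp add: dilate_def m del: power_Suc of_nat_Suc)
  also have "\<dots> = of_int n * ?c * \<mu> (?t * D) - of_int n * ((of_int n - 1) gchoose i) * \<mu> D"
    unfolding c1 c2 laurent_linear_diff[OF \<mu>] by (simp add: algebra_simps)
  also have "\<dots> = of_int n * fps_nth (dilate \<mu> n) i - of_int n * fps_nth (dilate \<mu> (n - 1)) i"
    by (simp add: dilate_def m D_def[symmetric])
  also have "\<dots> = fps_nth (of_int n * dilate \<mu> n - of_int n * dilate \<mu> (n - 1)) i"
    by (simp add: fps_of_int[symmetric])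
  finally show "fps_nth ((1 + fps_X) * fps_deriv (dilate \<mu> n)) i =
      fps_nth (of_int n * dilate \<mu> n - of_int n * dilate \<mu> (n - 1)) i" .
qed

lemma dilate_zero_index: "dilate \<mu> 0 = fps_const (\<mu> 1)"
  by (rule fps_ext) (auto simp: dilate_def gbinomial_0_left)

text \<open>A root \<open>x\<close> of an annihilator is carried by the dilation to \<open>1 + (1 + X) (x - 1) = x + X (x - 1)\<close>.\<close>

lemma dilate_factor:
  assumes \<mu>: "laurent_linear \<mu>"
  shows "dilate \<mu> (n + 1) = (1 + fps_X) * dilate (\<lambda>g. \<mu> (laurent_of_poly [:- x, 1:] * g)) n
    + fps_of_poly [:x, x - 1:] * dilate \<mu> n"
proof -
  let ?t = "Poly_Mapping.single 1 1 :: 'a laurent"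
  have "\<mu> (laurent_of_poly [:- x, 1:] * g) = \<mu> (?t * g) - x * \<mu> g" for g
  proof -
    have "laurent_of_poly [:- x, 1:] * g = ?t * g - Poly_Mapping.single 0 x * g"
      by (simp add: laurent_of_poly_pCons single_uminus algebra_simps)
    then show ?thesis by (simp only: laurent_linear_diff[OF \<mu>] laurent_linear_scale[OF \<mu>])
  qed
  then have "dilate (\<lambda>g. \<mu> (laurent_of_poly [:- x, 1:] * g)) n =
      dilate (\<lambda>g. \<mu> (?t * g)) n - fps_const x * dilate \<mu> n"
    by (intro fps_ext) (simp add: dilate_def right_diff_distrib mult.left_commute[of x])
  then have "(1 + fps_X) * dilate (\<lambda>g. \<mu> (laurent_of_poly [:- x, 1:] * g)) n =
      dilate \<mu> (n + 1) + fps_X * dilate \<mu> n - (1 + fps_X) * fps_const x * dilate \<mu> n"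
    by (simp add: right_diff_distrib dilate_shift[OF \<mu>] mult.assoc)
  moreover have e: "fps_of_poly [:x, x - 1:] = (1 + fps_X) * fps_const x - fps_X"
    by (simp add: fps_of_poly_pCons fps_const_sub[symmetric] algebra_simps del: fps_const_sub)
  ultimately show ?thesis unfolding e by (simp add: algebra_simps)
qed

lemma fps_of_poly_one_plus_X: "fps_of_poly [:1, 1 :: 'k::field:] = 1 + fps_X"
  by (simp add: fps_of_poly_pCons)

lemma rational_value_diff:
  assumes "rational_value s F u" "rational_value s G v"
  shows "rational_value s (F - G) (u - v)"
  using rational_value_add[OF assms(1) rational_value_mult[OF rational_value_const[of s "- 1"] assms(2)]]
  by (simp add: fps_const_neg[symmetric] del: fps_const_neg)

text \<open>The parameter \<open>X = -1\<close> is the dilation factor \<open>0\<close>, where \<open>y = 1\<close>. Induction on the degree of the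
  annihilator: splitting off a root \<open>x\<close>, \<open>dilate_factor\<close> becomes a recursion in \<open>n\<close> which can be run in
  both directions from \<open>n = 0\<close>, since the factor \<open>x + X (x - 1)\<close> takes the value \<open>1\<close> at \<open>X = -1\<close>.\<close>

lemma dilate_rational_value:
  fixes \<mu> :: "'k::{alg_closed_field, field_char_0} laurent \<Rightarrow> 'k"
  assumes "laurent_linear \<mu>" "p \<noteq> 0" "\<And>g. \<mu> (laurent_of_poly p * g) = 0"
  shows "rational_value (- 1) (dilate \<mu> n) (\<mu> 1)"
  using assms
proof (induction "degree p" arbitrary: \<mu> p n)
  case 0
  then obtain c where c: "p = [:c:]" by (metis degree_eq_zeroE)
  have "\<mu> g = 0" for g
  proof -
    have "laurent_of_poly p * (Poly_Mapping.single 0 (inverse c) * g) = g"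
      using 0 c by (simp add: laurent_of_poly_const mult.assoc[symmetric] mult_single)
    then show ?thesis using 0(4) by metis
  qed
  then have "dilate \<mu> n = fps_const 0" by (intro fps_ext) (simp add: dilate_def)
  then show ?case using \<open>\<mu> 1 = 0\<close> rational_value_const[of "- 1" 0] by simp
next
  case (Suc d)
  then obtain x where "poly p x = 0" using alg_closed_imp_poly_has_root[of p] by auto
  then obtain r where r: "p = [:- x, 1:] * r" by (meson dvdE poly_eq_0_iff_dvd)
  then have "r \<noteq> 0" using Suc by auto
  have "degree p = degree [:- x, 1:] + degree r"
    unfolding r using \<open>r \<noteq> 0\<close> by (intro degree_mult_eq) auto
  then have "d = degree r" using Suc(2) by simp
  define \<nu> where "\<nu> g = \<mu> (laurent_of_poly [:- x, 1:] * g)" for g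
  have \<nu>: "rational_value (- 1) (dilate \<nu> n) (\<nu> 1)" for n
  proof (rule Suc(1)[OF \<open>d = degree r\<close> _ \<open>r \<noteq> 0\<close>])
    show "laurent_linear \<nu>" unfolding \<nu>_def by (rule laurent_linear_mult) fact
    show "\<nu> (laurent_of_poly r * g) = 0" for g
      using Suc(5)[of g] by (simp add: \<nu>_def r laurent_of_poly.hom_mult mult.assoc del: mult_pCons_left)
  qed
  let ?e = "[:x, x - 1:]"
  have e: "poly ?e (- 1) = 1" by simp
  have step: "dilate \<mu> (n + 1) = fps_of_poly [:1, 1:] * dilate \<nu> n + fps_of_poly ?e * dilate \<mu> n" for n
    unfolding \<nu>_def fps_of_poly_one_plus_X by (rule dilate_factor) fact
  have first: "rational_value (- 1) (fps_of_poly [:1, 1:] * dilate \<nu> n) 0" for n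
    using rational_value_mult[OF rational_value_of_poly[of "- 1" "[:1, 1:]"] \<nu>[of n]] by simp
  show ?case
  proof (induction n rule: int_induct[where k = 0])
    case base
    show ?case unfolding dilate_zero_index by (rule rational_value_const)
  next
    case (step1 i)
    show ?case unfolding step
      using rational_value_add[OF first[of i]
          rational_value_mult[OF rational_value_of_poly[of "- 1" ?e] step1(2)]]
      unfolding e by simp
  next
    case (step2 i)
    have "fps_of_poly ?e * dilate \<mu> (i - 1) = dilate \<mu> i - fps_of_poly [:1, 1:] * dilate \<nu> (i - 1)"
      using step[of "i - 1"] by simp
    then have "rational_value (- 1) (fps_of_poly ?e * dilate \<mu> (i - 1)) (poly ?e (- 1) * \<mu> 1)"
      using rational_value_diff[OF step2(2) first[of "i - 1"]] unfolding e by simp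
    then show ?case by (rule rational_value_cancel) (use e in simp)
  qed
qed

lemma vir_scale_basis:
  "vir_scale a (vir_basis (Del k)) = (Poly_Mapping.single k a, 0)"
  "vir_scale a (vir_basis Cen) = (0, a)"
  by (simp_all add: vir_scale_def mult_single)

lemma chi_one_basis: "chi_one \<gamma> (vir_basis (Del n)) = \<gamma> * of_int n" "chi_one \<gamma> (vir_basis Cen) = 0"
  by (simp_all add: chi_one_def laurent_deriv_single laurent_eval_single)

text \<open>The dilation with factor \<open>l = 1 + X\<close> sends \<open>\<chi>\<close> to the functional \<open>t^n \<partial> \<mapsto> \<chi>(y^n \<partial>) / l\<close> and is
  generated by the field \<open>(t - 1) \<partial>\<close>. Near \<open>l = 0\<close> one has \<open>y^n = 1 + n l (t - 1) + O(l\<^sup>2)\<close>, so the pole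
  cancels because of \<open>\<chi>(\<partial>) = 0\<close>, and the limit is \<open>n \<chi>((t - 1) \<partial>) = n \<chi>(t \<partial>)\<close>.\<close>

lemma dilation_limit:
  fixes I :: "'k::{alg_closed_field, field_char_0} sym_vir set"
  assumes I: "poisson_ideal I" "I \<subseteq> max_ideal_at \<chi>"
    and \<chi>: "vir_linear \<chi>" "\<chi> (0, 1) = 0" "\<chi> (1, 0) = 0"
    and p: "p \<noteq> 0" "\<And>g. \<chi> (laurent_of_poly p * g, 0) = 0"
  shows "I \<subseteq> max_ideal_at (chi_one (\<chi> (Poly_Mapping.single 1 1, 0)))"
proof -
  define \<gamma> where "\<gamma> = \<chi> (Poly_Mapping.single 1 1, 0)"
  define \<mu> where "\<mu> g = \<chi> (g, 0)" for g
  have \<mu>: "laurent_linear \<mu>"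
    unfolding laurent_linear_def \<mu>_def
    using vir_linear_add[OF \<chi>(1), of "(_, 0)" "(_, 0)"] vir_linear_scale[OF \<chi>(1), of _ "(_, 0)"]
    by (simp add: vir_scale_def)
  define l where "l = (1 + fps_X :: 'k fps)"
  have "fps_nth l 0 \<noteq> 0" by (simp add: l_def)
  then have inv: "inverse l * l = 1" by (rule inverse_mult_eq_1)
  define \<phi> where "\<phi> y = (case y of Del n \<Rightarrow> inverse l * dilate \<mu> n | Cen \<Rightarrow> 0)" for y
  have \<phi>_simps: "\<phi> (Del n) = inverse l * dilate \<mu> n" "\<phi> Cen = 0" for n
    by (simp_all add: \<phi>_def)
  have l\<phi>: "l * \<phi> (Del n) = dilate \<mu> n" for n
    using inv by (simp add: \<phi>_simps mult.left_commute[of l] mult.assoc[symmetric] mult.commute[of l])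
  interpret \<Phi>: comm_ring_hom "sym_hom fps_const \<phi>"
    by (rule comm_ring_hom_sym_hom[OF comm_ring_hom_fps_const])
  let ?w = "sym_incl (Poly_Mapping.single 1 1 - 1, 0) :: 'k sym_vir"
  have bracket: "sym_hom fps_const \<phi> (poisson (sym_var (Del n)) ?w) =
      fps_const (1 - of_int n) * \<phi> (Del n) + fps_const (of_int n) * \<phi> (Del (n - 1))" for n
  proof -
    define c where "c = snd (vir_bracket (vir_basis (Del n)) (Poly_Mapping.single 1 1 - 1, 0) :: 'k vir)"
    have "Poly_Mapping.single 1 1 - (1 :: 'k laurent) = laurent_of_poly [:- 1, 1:]"
      by (simp add: laurent_of_poly_pCons single_uminus)
    then have "laurent_deriv (Poly_Mapping.single 1 1 - 1 :: 'k laurent) = 1"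
      by (simp add: laurent_deriv_of_poly pderiv_pCons laurent_of_poly_const)
    then have "vir_bracket (vir_basis (Del n)) (Poly_Mapping.single 1 1 - 1, 0) =
        (Poly_Mapping.single n 1 - Poly_Mapping.single (n - 1) (of_int n) * (Poly_Mapping.single 1 1 - 1), c)"
      unfolding c_def by (simp add: vir_bracket_def Let_def laurent_deriv_single)
    also have "\<dots> = vir_scale (1 - of_int n) (vir_basis (Del n)) +
        vir_scale (of_int n) (vir_basis (Del (n - 1))) + vir_scale c (vir_basis Cen)"
      unfolding vir_scale_basis by (simp add: mult_single right_diff_distrib single_diff)
    finally have "poisson (sym_var (Del n)) ?w = sym_const (1 - of_int n) * sym_var (Del n) +
        sym_const (of_int n) * sym_var (Del (n - 1)) + sym_const c * sym_var Cen"
      by (simp only: sym_incl_basis[symmetric] poisson_incl sym_incl_add sym_incl_scale)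
    then show ?thesis
      by (simp add: \<Phi>.hom_add \<Phi>.hom_mult sym_hom_const sym_hom_var \<phi>_simps(2))
  qed
  have "I \<subseteq> max_ideal_at (chi_one \<gamma>)"
  proof (rule degeneration[OF I])
    fix y
    show "fps_deriv (\<phi> y) = - inverse l * sym_hom fps_const \<phi> (poisson (sym_var y) ?w)"
    proof (cases y)
      case Cen
      then show ?thesis by (simp add: poisson_Cen_left \<phi>_simps)
    next
      case (Del n)
      let ?d = "fps_deriv (\<phi> (Del n))"
      have "\<phi> (Del n) + l * ?d = fps_deriv (dilate \<mu> n)"
        unfolding l\<phi>[symmetric] by (simp add: l_def)
      then have "l * (l * ?d) = l * fps_deriv (dilate \<mu> n) - dilate \<mu> n"
        using l\<phi>[of n] by (metis add_diff_cancel_left' right_diff_distrib)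
      also have "\<dots> = of_int n * dilate \<mu> n - of_int n * dilate \<mu> (n - 1) - dilate \<mu> n"
        unfolding l_def dilate_deriv[OF \<mu>] ..
      also have "\<dots> = l * - sym_hom fps_const \<phi> (poisson (sym_var (Del n)) ?w)"
        unfolding bracket l\<phi>[symmetric]
        by (simp add: fps_of_int[symmetric] fps_const_sub[symmetric] algebra_simps
            del: fps_const_sub)
      finally have "l * ?d = - sym_hom fps_const \<phi> (poisson (sym_var (Del n)) ?w)"
        using \<open>fps_nth l 0 \<noteq> 0\<close> mult_left_cancel[of l] by fastforce
      then have "inverse l * (l * ?d) =
          - inverse l * sym_hom fps_const \<phi> (poisson (sym_var (Del n)) ?w)" by simp
      then show ?thesis using inv by (simp add: Del mult.assoc[symmetric])
    qed
    show "fps_nth (\<phi> y) 0 = \<chi> (vir_basis y)"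
    proof (cases y)
      case Cen
      then show ?thesis by (simp add: \<phi>_simps \<chi>(2))
    next
      case (Del n)
      then show ?thesis by (simp add: \<phi>_simps dilate_def l_def \<mu>_def)
    qed
    show "rational_value (- 1) (\<phi> y) (chi_one \<gamma> (vir_basis y))"
    proof (cases y)
      case Cen
      then show ?thesis using rational_value_const[of "- 1" "0 :: 'k"] by (simp add: \<phi>_simps chi_one_basis del: vir_basis.simps)
    next
      case (Del n)
      \<comment> \<open>With \<open>x = 1\<close> in \<open>dilate_factor\<close> the recursion can be divided by \<open>l\<close>.\<close>
      define \<nu> where "\<nu> g = \<mu> (laurent_of_poly [:- 1, 1:] * g)" for g
      have "laurent_linear \<nu>" unfolding \<nu>_def by (rule laurent_linear_mult[OF \<mu>])
      moreover have "\<nu> (laurent_of_poly p * g) = 0" for g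
        using p(2)[of "laurent_of_poly [:- 1, 1:] * g"] by (simp add: \<nu>_def \<mu>_def mult.left_commute)
      ultimately have \<nu>: "rational_value (- 1) (dilate \<nu> n) (\<nu> 1)" for n
        by (rule dilate_rational_value[OF _ p(1)])
      have "laurent_of_poly [:- 1, 1:] = Poly_Mapping.single 1 1 - (1 :: 'k laurent)"
        by (simp add: laurent_of_poly_pCons single_uminus)
      then have \<nu>1: "\<nu> 1 = \<gamma>"
        using laurent_linear_diff[OF \<mu>] \<chi>(3) by (simp add: \<nu>_def \<gamma>_def \<mu>_def)
      have step: "\<phi> (Del (n + 1)) = dilate \<nu> n + \<phi> (Del n)" for n
      proof -
        have "dilate \<mu> (n + 1) = l * dilate \<nu> n + dilate \<mu> n"
          using dilate_factor[OF \<mu>, of n 1] by (simp add: l_def \<nu>_def[abs_def] fps_of_poly_pCons)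
        then show ?thesis using inv by (simp add: \<phi>_simps distrib_left mult.assoc[symmetric])
      qed
      have "rational_value (- 1) (\<phi> (Del n)) (\<gamma> * of_int n)"
      proof (induction n rule: int_induct[where k = 0])
        case base
        have "\<phi> (Del 0) = fps_const 0" using \<chi>(3) by (simp add: \<phi>_simps dilate_zero_index \<mu>_def)
        then show ?case using rational_value_const[of "- 1" "0 :: 'k"] by simp
      next
        case (step1 i)
        then show ?case
          using rational_value_add[OF \<nu>[of i] step1(2)] unfolding step \<nu>1
          by (simp add: algebra_simps)
      next
        case (step2 i)
        then show ?case
          using rational_value_diff[OF step2(2) \<nu>[of "i - 1"]] step[of "i - 1"] unfolding \<nu>1
          by (simp add: algebra_simps)
      qed
      then show ?thesis by (simp add: Del chi_one_basis del: vir_basis.simps)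
    qed
  qed
  then show ?thesis by (simp add: \<gamma>_def)
qed

section \<open>Poisson ideals with a central character\<close>

lemma one_notin_max_ideal_at: "1 \<notin> max_ideal_at (\<chi> :: 'k::comm_ring_1 vir \<Rightarrow> 'k)"
  by (simp add: max_ideal_at_def)

text \<open>Substitute \<open>\<zeta>\<close> for \<open>z\<close>.\<close>

lemma reduce_modulo_centre:
  fixes p :: "'k::comm_ring_1 sym_vir"
  shows "\<exists>q. Cen \<notin> sym_vars q \<and> p - q \<in> ideal_gen {sym_var Cen - sym_const \<zeta>}" (is "\<exists>q. _ \<and> _ \<in> ?I")
proof (induction p rule: sym_induct)
  case (const c)
  show ?case
    by (rule exI[of _ "sym_const c"]) (simp add: ideal_zero[OF is_ideal_ideal_gen])
next
  case (var x)
  show ?case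
  proof (cases x)
    case (Del n)
    then show ?thesis using sym_vars_var[of x]
      by (intro exI[of _ "sym_var x"]) (auto simp: ideal_zero[OF is_ideal_ideal_gen])
  next
    case Cen
    have "sym_var Cen - sym_const \<zeta> \<in> ?I" by (rule module.span_base[OF module_mult]) simp
    then show ?thesis by (intro exI[of _ "sym_const \<zeta>"]) (simp add: Cen)
  qed
next
  case (add p q)
  then obtain p' q' where "Cen \<notin> sym_vars p'" "p - p' \<in> ?I" "Cen \<notin> sym_vars q'" "q - q' \<in> ?I" by blast
  moreover from this have "(p - p') + (q - q') \<in> ?I" by (intro ideal_add is_ideal_ideal_gen)
  ultimately show ?case
    using sym_vars_add[of p' q'] by (intro exI[of _ "p' + q'"]) (auto simp: algebra_simps)
next
  case (mult p q)
  then obtain p' q' where "Cen \<notin> sym_vars p'" "p - p' \<in> ?I" "Cen \<notin> sym_vars q'" "q - q' \<in> ?I" by blast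
  moreover from this have "q * (p - p') + p' * (q - q') \<in> ?I"
    by (intro ideal_add ideal_mult_left is_ideal_ideal_gen)
  ultimately show ?case
    using sym_vars_mult[of p' q'] by (intro exI[of _ "p' * q'"]) (auto simp: algebra_simps)
qed

lemma exists_centre_free:
  assumes "is_ideal I" "sym_var Cen - sym_const \<zeta> \<in> I" "\<not> I \<subseteq> ideal_gen {sym_var Cen - sym_const \<zeta>}"
  obtains q where "q \<in> I" "q \<noteq> 0" "Cen \<notin> sym_vars q"
proof -
  have sub: "ideal_gen {sym_var Cen - sym_const \<zeta>} \<subseteq> I"
    using assms(2) by (intro module.span_minimal[OF module_mult] assms(1)) auto
  obtain p where p: "p \<in> I" "p \<notin> ideal_gen {sym_var Cen - sym_const \<zeta>}" using assms(3) by blast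
  obtain q where q: "Cen \<notin> sym_vars q" "p - q \<in> ideal_gen {sym_var Cen - sym_const \<zeta>}"
    using reduce_modulo_centre[of p \<zeta>] by blast
  have "p - (p - q) \<in> I"
    by (rule ideal_diff[OF assms(1) p(1)]) (use q sub in blast)
  moreover have "q \<noteq> 0" using p q by auto
  ultimately show ?thesis using that q by simp
qed

lemma exists_point:
  fixes I :: "'k::alg_closed_field sym_vir set"
  assumes "uncountable (UNIV :: 'k set)" "is_ideal I" "I \<noteq> UNIV"
  obtains \<chi> where "vir_linear \<chi>" "I \<subseteq> max_ideal_at \<chi>"
proof -
  have "1 ^ k \<notin> I" for k :: nat using ideal_UNIV_iff[OF assms(2)] assms(3) by simp
  from nullstellensatz[OF assms(1,2) this] that show ?thesis by blast
qed

theorem poisson_ideal_nonzero_charge: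
  fixes I :: "'k::{alg_closed_field, field_char_0} sym_vir set"
  assumes unc: "uncountable (UNIV :: 'k set)" and I: "poisson_ideal I" "I \<noteq> UNIV"
    and \<zeta>: "sym_var Cen - sym_const \<zeta> \<in> I" "\<zeta> \<noteq> 0"
  shows "I = ideal_gen {sym_var Cen - sym_const \<zeta>}"
proof (rule ccontr)
  assume ne: "I \<noteq> ideal_gen {sym_var Cen - sym_const \<zeta>}"
  have ideal: "is_ideal I" using I by (simp add: poisson_ideal_def)
  have "ideal_gen {sym_var Cen - sym_const \<zeta>} \<subseteq> I"
    using \<zeta> by (intro module.span_minimal[OF module_mult] ideal) auto
  with ne obtain q where q: "q \<in> I" "q \<noteq> 0" "Cen \<notin> sym_vars q"
    using exists_centre_free[OF ideal \<zeta>(1)] by blast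
  obtain \<chi> where \<chi>: "vir_linear \<chi>" "I \<subseteq> max_ideal_at \<chi>" by (rule exists_point[OF unc ideal I(2)])
  have "\<chi> (0, 1) = 0" by (rule points_are_local(1)[OF unc I(1) q \<chi>])
  moreover have "sym_lift \<chi> (sym_var Cen - sym_const \<zeta>) = 0"
    using \<chi>(2) \<zeta>(1) by (auto simp: max_ideal_at_def)
  ultimately show False using \<zeta>(2) by (simp add: sym_lift.hom_minus sym_lift_var sym_lift_const)
qed

lemma chi_one_0: "chi_one 0 = (\<lambda>_. 0)"
  by (simp add: chi_one_def fun_eq_iff)

text \<open>A local point is first moved so that it kills \<open>\<partial>\<close>, and then contracted to \<open>t = 1\<close>.\<close>

theorem poisson_ideal_zero_charge:
  fixes I :: "'k::{alg_closed_field, field_char_0} sym_vir set"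
  assumes unc: "uncountable (UNIV :: 'k set)" and I: "poisson_ideal I" "I \<noteq> UNIV"
    and z: "sym_var Cen \<in> I"
  obtains \<gamma> where "I \<subseteq> max_ideal_at (chi_one \<gamma>)"
proof -
  have ideal: "is_ideal I" using I by (simp add: poisson_ideal_def)
  have z': "sym_var Cen - sym_const 0 \<in> I" using z by simp
  have "\<exists>\<gamma>. I \<subseteq> max_ideal_at (chi_one \<gamma>)"
  proof (cases "I \<subseteq> ideal_gen {sym_var Cen - sym_const 0}")
    case True
    moreover have "ideal_gen {sym_var Cen - sym_const 0} \<subseteq> max_ideal_at (chi_one 0 :: 'k vir \<Rightarrow> 'k)"
      by (intro module.span_minimal[OF module_mult] is_ideal_max_ideal_at)
        (auto simp: max_ideal_at_def sym_lift_var chi_one_0)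
    ultimately show ?thesis by blast
  next
    case False
    then obtain q where q: "q \<in> I" "q \<noteq> 0" "Cen \<notin> sym_vars q"
      using exists_centre_free[OF ideal z'] by blast
    obtain \<chi> where \<chi>: "vir_linear \<chi>" "I \<subseteq> max_ideal_at \<chi>" by (rule exists_point[OF unc ideal I(2)])
    note local = points_are_local[OF unc I(1) q \<chi>]
    obtain p where p: "p \<noteq> 0" "\<And>g. \<chi> (laurent_of_poly p * g, 0) = 0" using local(2) by blast
    obtain \<psi> f where "I \<subseteq> max_ideal_at \<psi>" "vir_linear \<psi>" "\<psi> (0, 1) = 0" "\<psi> (1, 0) = 0"
      "f \<noteq> 0" "\<And>g. \<psi> (laurent_of_poly f * g, 0) = 0"
      using exists_point_killing_translation[OF I(1) \<chi>(2,1) local(1) p] by blast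
    from dilation_limit[OF I(1) this] show ?thesis by blast
  qed
  with that show ?thesis by blast
qed

section \<open>The leaf of \<open>\<chi>\<^bsub>1;0,\<gamma>\<^esub>\<close>\<close>

text \<open>The derivation \<open>\<partial>/\<partial>x\<close> of the ring of polynomials in \<open>p\<close> over the power series in \<open>X = x - 1\<close>;
  \<open>\<partial>/\<partial>p\<close> is \<open>pderiv\<close>.\<close>

definition dx :: "'k::comm_ring_1 fps poly \<Rightarrow> 'k fps poly" where
  "dx = map_poly fps_deriv"

lemma coeff_dx: "coeff (dx P) n = fps_deriv (coeff P n)"
  by (simp add: dx_def coeff_map_poly)

lemma dx_add: "dx (P + Q) = dx P + dx Q"
  by (intro poly_eqI) (simp add: coeff_dx)

lemma dx_mult: "dx (P * Q) = dx P * Q + P * dx Q"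
  by (intro poly_eqI) (simp add: coeff_dx coeff_mult fps_deriv_sum sum.distrib)

text \<open>The powers of \<open>x = 1 + X\<close>, including negative ones.\<close>

definition fps_x :: "int \<Rightarrow> 'k::field_char_0 fps" where
  "fps_x n = fps_binomial (of_int n)"

lemma fps_x_add: "fps_x (m + n) = fps_x m * fps_x n"
  by (simp add: fps_x_def fps_binomial_add_mult)

lemma fps_x_nth_0 [simp]: "fps_nth (fps_x n) 0 = 1"
  by (simp add: fps_x_def)

lemma fps_x_0 [simp]: "fps_x 0 = 1"
  by (simp add: fps_x_def)

lemma fps_deriv_fps_x: "fps_deriv (fps_x n) = of_int n * fps_x (n - 1)"
proof (rule fps_ext)
  fix j
  show "fps_nth (fps_deriv (fps_x n :: 'a fps)) j = fps_nth (of_int n * fps_x (n - 1)) j"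
    using gbinomial_absorption[of j "of_int n :: 'a"]
    by (simp add: fps_x_def fps_of_int[symmetric] algebra_simps)
qed

text \<open>The coadjoint orbit of \<open>\<chi>\<^bsub>1;0,\<gamma>\<^esub>\<close> consists of the functionals \<open>f \<partial> \<mapsto> p f(x) + \<gamma> f'(x)\<close>, with canonical
  coordinates \<open>x \<noteq> 0\<close> and \<open>p\<close>; the base point is \<open>x = 1\<close>, \<open>p = 0\<close>. Functions are expanded in powers of
  \<open>X = x - 1\<close>, which makes \<open>x\<close> invertible.\<close>

definition leaf_coordinate :: "'k::field_char_0 \<Rightarrow> vir_index \<Rightarrow> 'k fps poly" where
  "leaf_coordinate \<gamma> y = (case y of Del n \<Rightarrow> [:fps_const (\<gamma> * of_int n) * fps_x (n - 1), fps_x n:] | Cen \<Rightarrow> 0)"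

definition leaf_map :: "'k::field_char_0 \<Rightarrow> 'k sym_vir \<Rightarrow> 'k fps poly" where
  "leaf_map \<gamma> = sym_hom (\<lambda>c. [:fps_const c:]) (leaf_coordinate \<gamma>)"

lemma comm_ring_hom_leaf_map: "comm_ring_hom (leaf_map \<gamma>)"
  unfolding leaf_map_def
  by (rule comm_ring_hom_sym_hom) (unfold_locales, auto simp: one_pCons)

interpretation leaf_map: comm_ring_hom "leaf_map \<gamma>" for \<gamma> :: "'k::field_char_0"
  by (rule comm_ring_hom_leaf_map)

lemma leaf_map_const: "leaf_map \<gamma> (sym_const c) = [:fps_const c:]"
  by (simp add: leaf_map_def sym_hom_const)

lemma leaf_map_var: "leaf_map \<gamma> (sym_var y) = leaf_coordinate \<gamma> y"
  by (simp add: leaf_map_def sym_hom_var one_pCons)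

lemma vir_bracket_Del:
  "\<exists>c. vir_bracket (vir_basis (Del m)) (vir_basis (Del n)) =
    vir_scale (of_int (n - m)) (vir_basis (Del (m + n - 1))) + vir_scale c (vir_basis Cen :: 'k::comm_ring_1 vir)"
proof -
  have idx: "m + (n - 1) = m + n - 1" "m - 1 + n = m + n - 1" by simp_all
  show ?thesis
    unfolding vir_scale_basis
    by (simp add: vir_bracket_def Let_def laurent_deriv_single mult_single) (simp only: idx single_diff)
qed

text \<open>\<open>leaf_map \<gamma>\<close> is a Poisson homomorphism for the canonical bracket with \<open>{p, x} = 1\<close>. Both sides are
  derivations in \<open>q\<close>, so only brackets of two basis vectors have to be computed.\<close>

lemma leaf_map_poisson:
  "leaf_map \<gamma> (poisson q (sym_var (Del n))) =
    pderiv (leaf_map \<gamma> q) * dx (leaf_coordinate \<gamma> (Del n))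
    - dx (leaf_map \<gamma> q) * pderiv (leaf_coordinate \<gamma> (Del n))"
proof (induction q rule: sym_induct)
  case (const c)
  have "dx [:fps_const c:] = 0" by (intro poly_eqI) (simp add: coeff_dx coeff_pCons split: nat.splits)
  then show ?case by (simp add: poisson_const_left leaf_map_const pderiv_pCons)
next
  case (var y)
  show ?case
  proof (cases y)
    case Cen
    have "dx (0 :: 'a fps poly) = 0" by (simp add: dx_def)
    then show ?thesis by (simp add: Cen poisson_Cen_left leaf_map_var leaf_coordinate_def)
  next
    case (Del m)
    obtain c where c: "vir_bracket (vir_basis (Del m)) (vir_basis (Del n)) =
      vir_scale (of_int (n - m)) (vir_basis (Del (m + n - 1))) + vir_scale c (vir_basis Cen :: 'a vir)"
      using vir_bracket_Del by blast
    have lhs: "leaf_map \<gamma> (poisson (sym_var (Del m)) (sym_var (Del n))) =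
        [:fps_const (of_int (n - m)):] * leaf_coordinate \<gamma> (Del (m + n - 1))"
      unfolding poisson_var c sym_incl_add sym_incl_scale sym_incl_basis
      by (simp add: leaf_map.hom_add leaf_map.hom_mult leaf_map_const leaf_map_var)
        (simp add: leaf_coordinate_def)
    have dx: "dx (leaf_coordinate \<gamma> (Del k)) =
        [:fps_const (\<gamma> * of_int k * of_int (k - 1)) * fps_x (k - 2), of_int k * fps_x (k - 1):]" for k
      by (intro poly_eqI)
        (simp add: coeff_dx coeff_pCons leaf_coordinate_def fps_deriv_fps_x fps_of_int[symmetric]
          mult_ac split: nat.splits)
    have pd: "pderiv (leaf_coordinate \<gamma> (Del k)) = [:fps_x k:]" for k
      by (simp add: leaf_coordinate_def pderiv_pCons)
    have x1: "fps_x m * fps_x (n - 2) = (fps_x (m + n - 2) :: 'a fps)"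
      "fps_x (m - 2) * fps_x n = (fps_x (m + n - 2) :: 'a fps)"
      "fps_x m * fps_x (n - 1) = (fps_x (m + n - 1) :: 'a fps)"
      "fps_x (m - 1) * fps_x n = (fps_x (m + n - 1) :: 'a fps)"
      by (simp_all add: fps_x_add[symmetric] algebra_simps)
    have "pderiv (leaf_coordinate \<gamma> (Del m)) * dx (leaf_coordinate \<gamma> (Del n))
        - dx (leaf_coordinate \<gamma> (Del m)) * pderiv (leaf_coordinate \<gamma> (Del n)) =
        [:fps_const (\<gamma> * of_int n * of_int (n - 1)) * (fps_x m * fps_x (n - 2))
          - fps_const (\<gamma> * of_int m * of_int (m - 1)) * (fps_x (m - 2) * fps_x n),
          of_int n * (fps_x m * fps_x (n - 1)) - of_int m * (fps_x (m - 1) * fps_x n):]"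
      unfolding dx pd by (simp add: mult_ac)
    also have "\<dots> = [:fps_const (\<gamma> * of_int n * of_int (n - 1) - \<gamma> * of_int m * of_int (m - 1)) * fps_x (m + n - 2),
        fps_const (of_int (n - m)) * fps_x (m + n - 1):]"
      unfolding x1 by (simp add: left_diff_distrib fps_of_int[symmetric] fps_const_sub[symmetric] del: fps_const_sub)
    also have "\<gamma> * of_int n * of_int (n - 1) - \<gamma> * of_int m * of_int (m - 1) =
        of_int (n - m) * (\<gamma> * of_int (m + n - 1))"
      by (simp add: algebra_simps)
    also have "[:fps_const (of_int (n - m) * (\<gamma> * of_int (m + n - 1))) * fps_x (m + n - 2),
        fps_const (of_int (n - m)) * fps_x (m + n - 1):] =
        [:fps_const (of_int (n - m)):] * leaf_coordinate \<gamma> (Del (m + n - 1))"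
      by (simp add: leaf_coordinate_def mult.assoc[symmetric])
    finally show ?thesis using lhs by (simp add: Del leaf_map_var)
  qed
next
  case (add p q)
  then show ?case
    by (simp add: poisson_add_left leaf_map.hom_add pderiv_add dx_add algebra_simps)
next
  case (mult p q)
  show ?case
    unfolding poisson_mult_left leaf_map.hom_add leaf_map.hom_mult mult pderiv_mult dx_mult
    by (simp add: algebra_simps)
qed

lemma leaf_kernel_poisson: "poisson_ideal {q. leaf_map \<gamma> q = 0}"
proof (rule poisson_idealI)
  show "is_ideal {q. leaf_map \<gamma> q = 0}"
    by (auto simp: is_ideal_iff leaf_map.hom_add leaf_map.hom_mult)
  fix q x assume "q \<in> {q. leaf_map \<gamma> q = 0}"
  then show "poisson q (sym_var x) \<in> {q. leaf_map \<gamma> q = 0}"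
  proof (cases x)
    case (Del n)
    have "dx (0 :: 'a fps poly) = 0" by (simp add: dx_def)
    with \<open>q \<in> _\<close> show ?thesis by (simp add: Del leaf_map_poisson)
  next
    case Cen
    have "poisson q (sym_var Cen) = 0" by (subst poisson_antisym) (simp add: poisson_Cen_left)
    then show ?thesis by (simp add: Cen)
  qed
qed

lemma leaf_kernel_at_point: "fps_nth (poly (leaf_map \<gamma> q) 0) 0 = sym_lift (chi_one \<gamma>) q"
proof (induction q rule: sym_induct)
  case (var x)
  then show ?case
    by (cases x) (simp_all add: leaf_map_var leaf_coordinate_def sym_lift_var chi_one_basis del: vir_basis.simps)
qed (simp_all add: leaf_map_const sym_lift_const leaf_map.hom_add leaf_map.hom_mult sym_lift.hom_add
    sym_lift.hom_mult)

text \<open>Let \<open>e n = x^n p + n \<gamma> x^(n-1)\<close> be the coordinate of \<open>t^n \<partial>\<close> on the orbit. Then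
  \<open>e 1 e 2 - e 0 e 3 = 2 \<gamma>\<^sup>2 x\<close>, and the relation is \<open>2 \<gamma>\<^sup>2\<close> times \<open>e 1 - x e 0 = \<gamma>\<close>. Being
  of odd degree in \<open>\<gamma>\<close> it tells \<open>\<gamma>\<close> from \<open>- \<gamma>\<close>, in contrast to \<open>(e 1)\<^sup>2 - e 0 e 2 = \<gamma>\<^sup>2\<close>.\<close>

definition leaf_relation :: "'k::field_char_0 \<Rightarrow> 'k sym_vir" where
  "leaf_relation \<gamma> = sym_const (2 * \<gamma>\<^sup>2) * sym_var (Del 1)
    - (sym_var (Del 1) * sym_var (Del 2) - sym_var (Del 0) * sym_var (Del 3)) * sym_var (Del 0)
    - sym_const (2 * \<gamma> ^ 3)"

lemma leaf_relation_vanishes: "leaf_map \<gamma> (leaf_relation \<gamma>) = 0"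
proof -
  define x where "x = [:fps_x 1 :: 'a fps:]"
  define p where "p = [:0, 1 :: 'a fps:]"
  define g where "g = [:fps_const \<gamma>:]"
  have x: "fps_x 2 = fps_x 1 * (fps_x 1 :: 'a fps)" "fps_x 3 = fps_x 1 * (fps_x 1 * (fps_x 1 :: 'a fps))"
    by (simp_all add: fps_x_add[symmetric])
  have num: "fps_const (\<gamma> * 2) = fps_const \<gamma> * 2" "fps_const (\<gamma> * 3) = fps_const \<gamma> * 3"
    by (simp_all add: fps_numeral_fps_const)
  have e: "leaf_coordinate \<gamma> (Del 0) = p" "leaf_coordinate \<gamma> (Del 1) = x * p + g"
    "leaf_coordinate \<gamma> (Del 2) = x * x * p + 2 * g * x"
    "leaf_coordinate \<gamma> (Del 3) = x * x * x * p + 3 * g * x * x"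
    by (simp_all add: leaf_coordinate_def x_def p_def g_def x num numeral_poly mult_ac)
  have c: "[:fps_const (2 * \<gamma>\<^sup>2):] = 2 * g * g" "[:fps_const (2 * \<gamma> ^ 3):] = 2 * g * g * g"
    by (simp_all add: g_def numeral_poly power2_eq_square power3_eq_cube fps_numeral_fps_const mult_ac)
  show ?thesis
    unfolding leaf_relation_def leaf_map.hom_minus leaf_map.hom_mult leaf_map_const leaf_map_var e c
    by (simp add: algebra_simps)
qed

lemma sym_lift_leaf_relation: "sym_lift (chi_one \<delta>) (leaf_relation \<gamma>) = 2 * \<gamma>\<^sup>2 * (\<delta> - \<gamma>)"
  unfolding leaf_relation_def sym_lift.hom_minus sym_lift.hom_mult sym_lift_const sym_lift_var chi_one_basis
  by (simp add: power2_eq_square power3_eq_cube algebra_simps)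

text \<open>The kernel of \<open>leaf_map \<gamma>\<close> is a Poisson ideal in the maximal ideal at \<open>\<chi>\<^bsub>1;0,\<gamma>\<^esub>\<close>, so the core contains
  \<open>leaf_relation \<gamma>\<close>, whose value at \<open>\<chi>\<^bsub>1;0,\<delta>\<^esub>\<close> is \<open>2 \<gamma>\<^sup>2 (\<delta> - \<gamma>)\<close>.\<close>

lemma poisson_core_chi_one_separated:
  fixes \<gamma> \<delta> :: "'k::field_char_0"
  assumes "poisson_core (chi_one \<gamma>) \<subseteq> max_ideal_at (chi_one \<delta>)" "\<gamma> \<noteq> 0"
  shows "\<delta> = \<gamma>"
proof -
  have "{q. leaf_map \<gamma> q = 0} \<subseteq> max_ideal_at (chi_one \<gamma>)"
    by (auto simp: max_ideal_at_def simp flip: leaf_kernel_at_point)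
  then have "{q. leaf_map \<gamma> q = 0} \<subseteq> poisson_core (chi_one \<gamma>)"
    by (rule poisson_core_greatest(3)[OF leaf_kernel_poisson])
  then have "leaf_relation \<gamma> \<in> max_ideal_at (chi_one \<delta>)"
    using assms(1) leaf_relation_vanishes[of \<gamma>] by blast
  then show ?thesis using assms(2) by (simp add: max_ideal_at_def sym_lift_leaf_relation)
qed

section \<open>The augmentation ideal\<close>

lemma augmentation_ideal_eq: "augmentation_ideal = max_ideal_at (\<lambda>_. 0 :: 'k::comm_ring_1)"
proof
  have lin: "vir_linear (\<lambda>_. 0 :: 'k)" by (simp add: vir_linear_def)
  show "augmentation_ideal \<subseteq> max_ideal_at (\<lambda>_. 0 :: 'k)"
    unfolding augmentation_ideal_def
    by (intro module.span_minimal[OF module_mult] is_ideal_max_ideal_at)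
      (auto simp: max_ideal_at_def sym_lift_incl[OF lin])
  have ideal: "is_ideal (augmentation_ideal :: 'k sym_vir set)"
    by (simp add: augmentation_ideal_def is_ideal_ideal_gen)
  have "p - sym_const (sym_lift (\<lambda>_. 0) p) \<in> augmentation_ideal" for p :: "'k sym_vir"
  proof (induction p rule: sym_induct)
    case (const c)
    show ?case by (simp add: sym_lift_const ideal_zero[OF ideal])
  next
    case (var x)
    have "sym_incl (vir_basis x) \<in> augmentation_ideal"
      unfolding augmentation_ideal_def by (rule module.span_base[OF module_mult]) simp
    then show ?case by (simp add: sym_lift_var sym_incl_basis)
  next
    case (add p q)
    from ideal_add[OF ideal this] show ?case
      by (simp add: sym_lift.hom_add sym_const_add algebra_simps)
  next
    case (mult p q)
    let ?l = "sym_lift (\<lambda>_. 0 :: 'k)"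
    have "q * (p - sym_const (?l p)) + sym_const (?l p) * (q - sym_const (?l q)) \<in> augmentation_ideal"
      by (intro ideal_add[OF ideal] ideal_mult_left[OF ideal] mult)
    then show ?case by (simp add: sym_lift.hom_mult sym_const_mult algebra_simps)
  qed
  then have "p \<in> augmentation_ideal" if "sym_lift (\<lambda>_. 0) p = (0 :: 'k)" for p
    using that by (metis diff_zero sym_const_0)
  then show "max_ideal_at (\<lambda>_. 0 :: 'k) \<subseteq> augmentation_ideal"
    by (auto simp: max_ideal_at_def)
qed

lemma augmentation_ideal_poisson: "poisson_ideal (augmentation_ideal :: 'k::comm_ring_1 sym_vir set)"
proof -
  have lin: "vir_linear (\<lambda>_. 0 :: 'k)" by (simp add: vir_linear_def)
  have "sym_lift (\<lambda>_. 0) (poisson p q) = (0 :: 'k)" for p q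
    unfolding poisson_def by (simp add: sym_lift.hom_sum sym_lift.hom_mult sym_lift_incl[OF lin])
  then show ?thesis
    unfolding augmentation_ideal_eq poisson_ideal_def
    by (simp add: is_ideal_max_ideal_at) (simp add: max_ideal_at_def)
qed

lemma augmentation_ideal_core: "augmentation_ideal = poisson_core (\<lambda>_. 0 :: 'k::comm_ring_1)"
proof
  show "augmentation_ideal \<subseteq> poisson_core (\<lambda>_. 0 :: 'k)"
    by (rule poisson_core_greatest(3)[OF augmentation_ideal_poisson]) (simp add: augmentation_ideal_eq)
  show "poisson_core (\<lambda>_. 0 :: 'k) \<subseteq> augmentation_ideal"
    unfolding augmentation_ideal_eq by (rule poisson_core_greatest(2))
qed

lemma maximal_augmentation_ideal: "maximal_poisson_ideal (augmentation_ideal :: 'k::field sym_vir set)"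
  unfolding maximal_poisson_ideal_def
proof (intro conjI allI impI)
  show "poisson_ideal (augmentation_ideal :: 'k sym_vir set)" by (rule augmentation_ideal_poisson)
  show "(augmentation_ideal :: 'k sym_vir set) \<noteq> UNIV"
    unfolding augmentation_ideal_eq using one_notin_max_ideal_at by blast
  fix J :: "'k sym_vir set"
  assume J: "poisson_ideal J \<and> J \<noteq> UNIV \<and> augmentation_ideal \<subseteq> J"
  then have ideal: "is_ideal J" by (simp add: poisson_ideal_def)
  have "p \<in> augmentation_ideal" if "p \<in> J" for p
  proof -
    define c where "c = sym_lift (\<lambda>_. 0) p"
    have "p - sym_const c \<in> augmentation_ideal"
      by (simp add: augmentation_ideal_eq max_ideal_at_def c_def sym_lift.hom_minus sym_lift_const)
    moreover have "augmentation_ideal \<subseteq> J" using J by blast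
    ultimately have "p - sym_const c \<in> J" by blast
    from ideal_diff[OF ideal that this] have "sym_const (inverse c) * sym_const c \<in> J"
      by (intro ideal_mult_left[OF ideal]) simp
    moreover have "1 \<notin> J" using J ideal_UNIV_iff[OF ideal] by blast
    ultimately have "c = 0" by (cases "c = 0") (auto simp: sym_const_mult[symmetric])
    then show ?thesis by (simp add: augmentation_ideal_eq max_ideal_at_def c_def)
  qed
  with J show "J = augmentation_ideal" by blast
qed

section \<open>Classification\<close>

lemma maximal_centre_ideal:
  fixes \<zeta> :: "'k::{alg_closed_field, field_char_0}"
  assumes unc: "uncountable (UNIV :: 'k set)" and "\<zeta> \<noteq> 0"
  shows "maximal_poisson_ideal (ideal_gen {sym_var Cen - sym_const \<zeta>})"
  unfolding maximal_poisson_ideal_def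
proof (intro conjI allI impI)
  show "poisson_ideal (ideal_gen {sym_var Cen - sym_const \<zeta>})"
    by (rule poisson_ideal_central) (rule poisson_Cen_minus_const)
  define \<chi> where "\<chi> u = \<zeta> * snd u" for u :: "'k vir"
  have "ideal_gen {sym_var Cen - sym_const \<zeta>} \<subseteq> max_ideal_at \<chi>"
    by (intro module.span_minimal[OF module_mult] is_ideal_max_ideal_at)
      (simp add: max_ideal_at_def sym_lift.hom_minus sym_lift_var sym_lift_const \<chi>_def)
  then show "ideal_gen {sym_var Cen - sym_const \<zeta>} \<noteq> UNIV" using one_notin_max_ideal_at by blast
  fix J assume J: "poisson_ideal J \<and> J \<noteq> UNIV \<and> ideal_gen {sym_var Cen - sym_const \<zeta>} \<subseteq> J"
  moreover have "sym_var Cen - sym_const \<zeta> \<in> ideal_gen {sym_var Cen - sym_const \<zeta>}"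
    by (rule module.span_base[OF module_mult]) simp
  ultimately show "J = ideal_gen {sym_var Cen - sym_const \<zeta>}"
    using poisson_ideal_nonzero_charge[OF unc, of J \<zeta>] \<open>\<zeta> \<noteq> 0\<close> by blast
qed

text \<open>A larger proper Poisson ideal still contains \<open>z\<close>, hence vanishes at some \<open>\<chi>\<^bsub>1;0,\<delta>\<^esub>\<close>, and \<open>\<delta> = \<gamma>\<close> by
  separation.\<close>

lemma maximal_poisson_core_chi_one:
  fixes \<gamma> :: "'k::{alg_closed_field, field_char_0}"
  assumes unc: "uncountable (UNIV :: 'k set)" and "\<gamma> \<noteq> 0"
  shows "maximal_poisson_ideal (poisson_core (chi_one \<gamma>))"
  unfolding maximal_poisson_ideal_def
proof (intro conjI allI impI)
  show "poisson_ideal (poisson_core (chi_one \<gamma>))" by (rule poisson_core_greatest)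
  show "poisson_core (chi_one \<gamma>) \<noteq> UNIV"
    using poisson_core_greatest(2)[of "chi_one \<gamma>"] one_notin_max_ideal_at by blast
  fix J assume J: "poisson_ideal J \<and> J \<noteq> UNIV \<and> poisson_core (chi_one \<gamma>) \<subseteq> J"
  have "ideal_gen {sym_var Cen} \<subseteq> poisson_core (chi_one \<gamma>)"
    by (intro poisson_core_greatest(3) poisson_ideal_central poisson_Cen_left
        module.span_minimal[OF module_mult] is_ideal_max_ideal_at)
      (simp add: max_ideal_at_def sym_lift_var chi_one_basis del: vir_basis.simps)
  then have "sym_var Cen \<in> J" using J module.span_base[OF module_mult, of "sym_var Cen" "{sym_var Cen}"] by blast
  then obtain \<delta> where \<delta>: "J \<subseteq> max_ideal_at (chi_one \<delta>)"
    using poisson_ideal_zero_charge[OF unc] J by blast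
  then have "\<delta> = \<gamma>" using J \<open>\<gamma> \<noteq> 0\<close> by (intro poisson_core_chi_one_separated) auto
  with \<delta> have "J \<subseteq> poisson_core (chi_one \<gamma>)" using J by (intro poisson_core_greatest(3)) auto
  with J show "J = poisson_core (chi_one \<gamma>)" by blast
qed

text \<open>If \<open>\<chi>\<close> is a point of \<open>I\<close>, adding the central element \<open>z - \<chi>(z)\<close> to \<open>I\<close> gives a Poisson ideal for which \<open>\<chi>\<close>
  is still a point.\<close>

lemma maximal_poisson_ideal_contains_charge:
  fixes I :: "'k::alg_closed_field sym_vir set"
  assumes unc: "uncountable (UNIV :: 'k set)" and I: "maximal_poisson_ideal I"
  obtains \<zeta> where "sym_var Cen - sym_const \<zeta> \<in> I"
proof -
  have ideal: "poisson_ideal I" "is_ideal I" "I \<noteq> UNIV"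
    using I by (auto simp: maximal_poisson_ideal_def poisson_ideal_def)
  obtain \<chi> where \<chi>: "vir_linear \<chi>" "I \<subseteq> max_ideal_at \<chi>" by (rule exists_point[OF unc ideal(2,3)])
  define a where "a = sym_var Cen - sym_const (\<chi> (0, 1))"
  define J where "J = {x + c * a | x c. x \<in> I}"
  have "poisson_ideal J"
    unfolding J_def a_def by (rule poisson_ideal_plus_central[OF ideal(1) poisson_Cen_minus_const])
  moreover have "J \<subseteq> max_ideal_at \<chi>"
  proof -
    have "sym_lift \<chi> a = 0" by (simp add: a_def sym_lift.hom_minus sym_lift_var sym_lift_const)
    then show ?thesis
      using \<chi>(2) by (auto simp: J_def max_ideal_at_def sym_lift.hom_add sym_lift.hom_mult)
  qed
  then have "J \<noteq> UNIV" using one_notin_max_ideal_at by blast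
  moreover have "x = x + 0 * a" "a = 0 + 1 * a" for x by simp_all
  then have "I \<subseteq> J" "a \<in> J" unfolding J_def using ideal_zero[OF ideal(2)] by blast+
  ultimately have "a \<in> I" using I unfolding maximal_poisson_ideal_def by blast
  with that show ?thesis by (simp add: a_def)
qed

theorem corollary4p3p18:
  assumes "uncountable (UNIV :: 'k::{alg_closed_field, field_char_0} set)"
  shows "{I :: 'k sym_vir set. maximal_poisson_ideal I} =
      {ideal_gen {sym_var Cen - sym_const \<zeta>} | \<zeta> :: 'k. \<zeta> \<noteq> 0}
      \<union> {poisson_core (chi_one \<gamma>) | \<gamma> :: 'k. \<gamma> \<noteq> 0}
      \<union> {augmentation_ideal}
    \<and> (augmentation_ideal :: 'k sym_vir set) = poisson_core (\<lambda>_. 0)"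
proof (intro conjI equalityI subsetI)
  fix I :: "'k sym_vir set"
  assume "I \<in> {I. maximal_poisson_ideal I}"
  then have I: "maximal_poisson_ideal I" by simp
  then have ideal: "poisson_ideal I" "I \<noteq> UNIV" by (auto simp: maximal_poisson_ideal_def)
  obtain \<zeta> where \<zeta>: "sym_var Cen - sym_const \<zeta> \<in> I"
    by (rule maximal_poisson_ideal_contains_charge[OF assms I])
  show "I \<in> {ideal_gen {sym_var Cen - sym_const \<zeta>} | \<zeta> :: 'k. \<zeta> \<noteq> 0}
      \<union> {poisson_core (chi_one \<gamma>) | \<gamma> :: 'k. \<gamma> \<noteq> 0} \<union> {augmentation_ideal}"
  proof (cases "\<zeta> = 0")
    case False
    then have "I = ideal_gen {sym_var Cen - sym_const \<zeta>}"
      using poisson_ideal_nonzero_charge[OF assms ideal \<zeta>] by blast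
    with False show ?thesis by blast
  next
    case True
    then have "sym_var Cen \<in> I" using \<zeta> by simp
    then obtain \<gamma> where "I \<subseteq> max_ideal_at (chi_one \<gamma>)"
      by (rule poisson_ideal_zero_charge[OF assms ideal])
    then have "I \<subseteq> poisson_core (chi_one \<gamma>)" by (rule poisson_core_greatest(3)[OF ideal(1)])
    moreover have "poisson_core (chi_one \<gamma>) \<noteq> UNIV"
      using poisson_core_greatest(2)[of "chi_one \<gamma>"] one_notin_max_ideal_at by blast
    ultimately have eq: "I = poisson_core (chi_one \<gamma>)"
      using I poisson_core_greatest(1)[of "chi_one \<gamma>"] unfolding maximal_poisson_ideal_def by blast
    show ?thesis
    proof (cases "\<gamma> = 0")
      case True
      then have "I = augmentation_ideal" by (simp add: eq chi_one_0 augmentation_ideal_core)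
      then show ?thesis by simp
    next
      case False
      with eq show ?thesis by blast
    qed
  qed
next
  fix I :: "'k sym_vir set"
  assume "I \<in> {ideal_gen {sym_var Cen - sym_const \<zeta>} | \<zeta> :: 'k. \<zeta> \<noteq> 0}
      \<union> {poisson_core (chi_one \<gamma>) | \<gamma> :: 'k. \<gamma> \<noteq> 0} \<union> {augmentation_ideal}"
  then show "I \<in> {I. maximal_poisson_ideal I}"
    using maximal_centre_ideal[OF assms] maximal_poisson_core_chi_one[OF assms] maximal_augmentation_ideal
    by auto
qed (simp_all add: augmentation_ideal_core)

end
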